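(* Let $\lambda>0$, let $\Omega\subset\mathbb{R}^2$ be such that $T=\partial[\![\Omega]\!]$ is a compactly supported $1$-dimensional current, and let $\Gamma_\lambda=T-\partial S$ be a multiscale flat norm minimizer of $T$ with scale parameter $\lambda$. If $\Gamma_\lambda$ is a $C^{1,1}$ isometric embedding of $\mathcal{S}^1$ into $\mathbb{R}^2$, then $$\operatorname{reach}(\Gamma_\lambda)\ \ge\ \frac{C}{\lambda},\qquad C:=\sup_{\theta\in(3\pi/2,\,2\pi)}\frac{2\cos\theta-(1+\sin\theta)(\cos\theta+2)}{2(\cos\theta+1)}\ \approx\ 0.22 .$$
   Context: Currents and mass: $\mathcal{E}_k$ denotes the space of compactly supported $k$-dimensional currents in $\mathbb{R}^2$, $\partial$ is the boundary operator ($\partial T(\omega)=T(d\omega)$), and $\mathbf{M}$ is mass, $\mathbf{M}(T)=\sup\{T(\omega): \omega \text{ a smooth } k\text{-form},\ \|\omega\|\le 1\}$, where $\|\omega\|=\sup_x\|\omega(x)\|$ and, for a $k$-covector $\varphi$, $\|\varphi\|=\sup\{\varphi(\xi):\xi \text{ a simple } k\text{-vector},\ |\xi|\le 1\}$. For a Lebesgue measurable set $\Omega\subset\mathbb{R}^2$, $[\![\Omega]\!]$ is the $2$-current given by integration over $\Omega$ with the standard orientation. Multiscale flat norm: for $\lambda>0$ and $T\in\mathcal{E}_1$, $$\mathcal{F}_\lambda(T)=\inf\{\mathbf{M}(A)+\lambda\mathbf{M}(S): A\in\mathcal{E}_1,\ S\in\mathcal{E}_2,\ T=A+\partial S\}.$$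 A current $\Gamma=T-\partial S$ with $S\in\mathcal{E}_2$ is called a multiscale flat norm minimizer for $T$ with scale parameter $\lambda$ if $\mathbf{M}(\Gamma)+\lambda\mathbf{M}(S)=\mathcal{F}_\lambda(T)$. Embeddings: $\mathcal{S}^1$ denotes a circle in $\mathbb{R}^2$ of whatever radius makes the embedding isometric, i.e. parametrized by arc length ($|\gamma'|=1$). Saying that the current $\Gamma_\lambda$ is a $C^{1,1}$ isometric embedding of $\mathcal{S}^1$ means that there is a $C^{1,1}$ (i.e. $C^1$ with Lipschitz derivative) injective arc-length parametrized map $\gamma:\mathcal{S}^1\to\mathbb{R}^2$ such that $\Gamma_\lambda$ is the multiplicity-one current of integration over the oriented image of $\gamma$. The current is identified with this image when speaking of its reach. Reach: for $E\subset\mathbb{R}^2$ and $r>0$ let $U_r(E)=\{x\in\mathbb{R}^2:\operatorname{dist}(x,E)<r\}$. Then $\operatorname{reach}(E)\in[0,\infty]$ is the supremum of all $r$ such that every $x\in U_r(E)$ has a unique nearest point in $E$. *)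

theory Defs
  imports "HOL-Analysis.Analysis"
begin

text \<open>A \<open>1\<close>-form assigns to each point a linear functional, a \<open>2\<close>-form an alternating bilinear
  map, i.e. covectors are represented by their values on (simple) vectors.\<close>

type_synonym form1 = "real^2 \<Rightarrow> real^2 \<Rightarrow> real"
type_synonym form2 = "real^2 \<Rightarrow> real^2 \<Rightarrow> real^2 \<Rightarrow> real"

fun iter_deriv :: "(real^2) list \<Rightarrow> (real^2 \<Rightarrow> real) \<Rightarrow> real^2 \<Rightarrow> real" where
  "iter_deriv [] f = f"
| "iter_deriv (v # vs) f = (\<lambda>x. frechet_derivative (iter_deriv vs f) (at x) v)"

text \<open>The library has no \<open>C\<^sup>\<infinity>\<close> predicate. If all iterated directional derivatives
  are differentiable, they are in particular all continuous, so this is \<open>C\<^sup>\<infinity>\<close>.\<close>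

definition smooth :: "(real^2 \<Rightarrow> real) \<Rightarrow> bool" where
  "smooth f \<longleftrightarrow> (\<forall>vs x. iter_deriv vs f differentiable (at x))"

definition forms1 :: "form1 set" where
  "forms1 = {\<omega>. (\<forall>x. linear (\<omega> x)) \<and> (\<forall>v. smooth (\<lambda>x. \<omega> x v))}"

definition forms2 :: "form2 set" where
  "forms2 = {\<omega>. (\<forall>x. bilinear (\<omega> x) \<and> (\<forall>v. \<omega> x v v = 0)) \<and> (\<forall>v w. smooth (\<lambda>x. \<omega> x v w))}"

definition test_forms1 :: "form1 set" where
  "test_forms1 = {\<omega>\<in>forms1. \<exists>K. compact K \<and> (\<forall>x v. x \<notin> K \<longrightarrow> \<omega> x v = 0)}"

definition ext_deriv :: "form1 \<Rightarrow> form2" where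
  "ext_deriv \<omega> = (\<lambda>x v w. frechet_derivative (\<lambda>y. \<omega> y w) (at x) v
                         - frechet_derivative (\<lambda>y. \<omega> y v) (at x) w)"

definition comass1 :: "(real^2 \<Rightarrow> real) \<Rightarrow> real" where
  "comass1 \<phi> = Sup {\<phi> v | v. norm v \<le> 1}"

text \<open>Euclidean norm of the simple \<open>2\<close>-vector \<open>v \<and> w\<close> (Gram determinant).\<close>

definition wedge_norm :: "real^2 \<Rightarrow> real^2 \<Rightarrow> real" where
  "wedge_norm v w = sqrt ((v \<bullet> v) * (w \<bullet> w) - (v \<bullet> w)\<^sup>2)"

definition comass2 :: "(real^2 \<Rightarrow> real^2 \<Rightarrow> real) \<Rightarrow> real" where
  "comass2 \<phi> = Sup {\<phi> v w | v w. wedge_norm v w \<le> 1}"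

definition form_norm1 :: "form1 \<Rightarrow> ereal" where
  "form_norm1 \<omega> = (SUP x. ereal (comass1 (\<omega> x)))"

definition form_norm2 :: "form2 \<Rightarrow> ereal" where
  "form_norm2 \<omega> = (SUP x. ereal (comass2 (\<omega> x)))"

text \<open>Compactly supported currents are the linear functionals on the space of all smooth forms that
  are continuous for uniform convergence of all derivatives on compact sets, i.e. dominated by one
  of the seminorms given by a compact set \<open>K\<close> and an order \<open>N\<close>.  A bound \<open>B\<close> on that
  seminorm is used in place of a supremum.  Only the values on \<open>forms1\<close>, resp. \<open>forms2\<close>, are
  meaningful, so two currents are considered equal if they agree there.\<close>

definition currents1 :: "(form1 \<Rightarrow> real) set" where
  "currents1 = {T.
     (\<forall>\<omega>\<in>forms1. \<forall>\<eta>\<in>forms1. \<forall>a b. T (\<lambda>x v. a * \<omega> x v + b * \<eta> x v) = a * T \<omega> + b * T \<eta>) \<and>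
     (\<exists>K N C. compact K \<and> (\<forall>\<omega>\<in>forms1. \<forall>B\<ge>0.
        (\<forall>x\<in>K. \<forall>v\<in>Basis. \<forall>us. set us \<subseteq> Basis \<and> length us \<le> N \<longrightarrow>
            \<bar>iter_deriv us (\<lambda>y. \<omega> y v) x\<bar> \<le> B) \<longrightarrow> \<bar>T \<omega>\<bar> \<le> C * B))}"

definition currents2 :: "(form2 \<Rightarrow> real) set" where
  "currents2 = {S.
     (\<forall>\<omega>\<in>forms2. \<forall>\<eta>\<in>forms2. \<forall>a b.
        S (\<lambda>x v w. a * \<omega> x v w + b * \<eta> x v w) = a * S \<omega> + b * S \<eta>) \<and>
     (\<exists>K N C. compact K \<and> (\<forall>\<omega>\<in>forms2. \<forall>B\<ge>0.
        (\<forall>x\<in>K. \<forall>v\<in>Basis. \<forall>w\<in>Basis. \<forall>us. set us \<subseteq> Basis \<and> length us \<le> N \<longrightarrow>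
            \<bar>iter_deriv us (\<lambda>y. \<omega> y v w) x\<bar> \<le> B) \<longrightarrow> \<bar>S \<omega>\<bar> \<le> C * B))}"

definition boundary :: "(form2 \<Rightarrow> real) \<Rightarrow> form1 \<Rightarrow> real" where
  "boundary S = (\<lambda>\<omega>. S (ext_deriv \<omega>))"

definition mass1 :: "(form1 \<Rightarrow> real) \<Rightarrow> ereal" where
  "mass1 T = (SUP \<omega>\<in>{\<omega>\<in>forms1. form_norm1 \<omega> \<le> 1}. ereal (T \<omega>))"

definition mass2 :: "(form2 \<Rightarrow> real) \<Rightarrow> ereal" where
  "mass2 S = (SUP \<omega>\<in>{\<omega>\<in>forms2. form_norm2 \<omega> \<le> 1}. ereal (S \<omega>))"

definition region_current :: "(real^2) set \<Rightarrow> form2 \<Rightarrow> real" where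
  "region_current \<Omega> \<omega> = (LINT x:\<Omega>|lebesgue. \<omega> x (axis 1 1) (axis 2 1))"

text \<open>\<open>\<Omega>\<close> may be unbounded, in which case its current cannot be evaluated on
  arbitrary smooth forms.  So the boundary of \<open>\<Omega>\<close> is first a functional on compactly
  supported forms, and \<open>T\<close> is its (unique) extension as a compactly supported current.\<close>

definition is_region_boundary :: "(form1 \<Rightarrow> real) \<Rightarrow> (real^2) set \<Rightarrow> bool" where
  "is_region_boundary T \<Omega> \<longleftrightarrow>
     T \<in> currents1 \<and> (\<forall>\<omega>\<in>test_forms1. T \<omega> = boundary (region_current \<Omega>) \<omega>)"

definition flat_norm :: "real \<Rightarrow> (form1 \<Rightarrow> real) \<Rightarrow> ereal" where
  "flat_norm lam T = Inf {mass1 A + ereal lam * mass2 S | A S.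
     A \<in> currents1 \<and> S \<in> currents2 \<and> (\<forall>\<omega>\<in>forms1. T \<omega> = A \<omega> + boundary S \<omega>)}"

definition flat_norm_minimizer :: "real \<Rightarrow> (form1 \<Rightarrow> real) \<Rightarrow> (form1 \<Rightarrow> real) \<Rightarrow> bool" where
  "flat_norm_minimizer lam T \<Gamma> \<longleftrightarrow>
     (\<exists>S\<in>currents2. (\<forall>\<omega>\<in>forms1. \<Gamma> \<omega> = T \<omega> - boundary S \<omega>) \<and>
        mass1 \<Gamma> + ereal lam * mass2 S = flat_norm lam T)"

definition circle_param :: "real \<Rightarrow> real \<Rightarrow> real^2" where
  "circle_param \<rho> t = vector [\<rho> * cos (t / \<rho>), \<rho> * sin (t / \<rho>)]"

text \<open>The circle is \<open>sphere 0 \<rho>\<close>; derivatives of \<open>\<gamma>\<close> on it are taken with respect to its arc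
  length.  Either orientation of the image occurs, since \<open>\<gamma>\<close> may include a reflection.\<close>

definition C11_isometric_embedding :: "real \<Rightarrow> (real^2 \<Rightarrow> real^2) \<Rightarrow> bool" where
  "C11_isometric_embedding \<rho> \<gamma> \<longleftrightarrow> \<rho> > 0 \<and> inj_on \<gamma> (sphere 0 \<rho>) \<and>
     (\<exists>\<gamma>' L. (\<forall>t. ((\<gamma> \<circ> circle_param \<rho>) has_vector_derivative \<gamma>' t) (at t)) \<and>
        (\<forall>t. norm (\<gamma>' t) = 1) \<and> L-lipschitz_on UNIV \<gamma>')"

definition curve_current :: "real \<Rightarrow> (real^2 \<Rightarrow> real^2) \<Rightarrow> form1 \<Rightarrow> real" where
  "curve_current \<rho> \<gamma> \<omega> = integral {0..2 * pi * \<rho>}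
     (\<lambda>t. \<omega> (\<gamma> (circle_param \<rho> t)) (vector_derivative (\<gamma> \<circ> circle_param \<rho>) (at t)))"

text \<open>\<open>r = 0\<close> always qualifies, which makes the supremum lie in \<open>[0,\<infinity>]\<close>.\<close>

definition reach :: "(real^2) set \<Rightarrow> ereal" where
  "reach E = Sup {ereal r | r. r \<ge> 0 \<and>
     (\<forall>x. infdist x E < r \<longrightarrow> (\<exists>!p. p \<in> E \<and> dist x p = infdist x E))}"

definition reach_const :: real where
  "reach_const = (SUP \<theta>\<in>{3 * pi / 2 <..< 2 * pi}.
     (2 * cos \<theta> - (1 + sin \<theta>) * (cos \<theta> + 2)) / (2 * (cos \<theta> + 1)))"

end

theory Submission
  imports Defs "HOL-Complex_Analysis.Complex_Analysis"
begin

text \<open>If \<open>\<Gamma>\<close> is a minimizer, then \<open>\<^bold>M \<Gamma> \<le> \<^bold>M (\<Gamma> - \<partial>R) + \<lambda> \<^bold>M R\<close> for every \<open>2\<close>-current \<open>R\<close>; the argument only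
  tests this with ruled surfaces \<open>R\<close> spanned by two \<open>C\<^sup>1\<close> curves.
  Pushing an arc of \<open>\<Gamma>\<close> in a fixed direction shows that the unit tangent is \<open>\<lambda>\<close>-Lipschitz. So two
  nearest points of a point at distance less than \<open>0.225 / \<lambda>\<close> are more than \<open>1 / \<lambda>\<close> apart along the
  curve, and minimising the distance of such pairs gives a chord of length \<open>D < 0.45 / \<lambda>\<close> that
  is orthogonal to the curve at both ends and does not meet it in between. By the Jordan curve
  theorem the tangents at the ends are antiparallel. Replacing the two strands of length
  \<open>2 a = 1 / \<lambda>\<close> centred at the ends by two short connections then gives
  \<open>4 a \<le> 2 (D + \<lambda> a\<^sup>2) + \<lambda> (2 a D + 2 \<lambda> a\<^sup>3 / 3)\<close>, i.e. \<open>D \<ge> 17 / (36 \<lambda>)\<close>, a contradiction.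
  The constant \<open>17 / 72\<close> obtained for the reach exceeds \<open>reach_const < 0.225\<close>.\<close>

text \<open>The Lipschitz constant of the tangent in the hypothesis is arbitrary, so the
  quantitative bound \<open>lam\<close> has to be extracted from minimality. Comparing with
  \<open>R\<close> means cancelling the mass of the filling on both sides, which requires that mass
  to be finite; this is where it matters that \<open>T\<close> bounds a region. The surgery on two
  strands depends on orientation: subtracting the boundary of the strip between them removes both
  only if they run in opposite directions; otherwise one is removed and the other doubled. Excluding
  parallel tangents is a global matter, and this is why the chord must avoid the rest of the curve:
  the winding number is constant along it, whereas for parallel tangents it would leave one end on
  the left of the curve and arrive at the other end from the right. The distance 1 /
  \<open>lam\<close> along the curve is the range in which the curve provably advances in its
  initial direction at no less than half speed. It also fixes a = 1 / (2 \<open>lam\<close>): this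
  is the largest half-length for which strands around points that far apart are sure not to
  overlap.\<close>

section \<open>Smooth functions\<close>

text \<open>The case \<open>p = 1\<close> is the usual flat function exp(-1/t). Admitting a
  polynomial factor in 1/t makes the family closed under differentiation.\<close>

definition flat :: "real poly \<Rightarrow> real \<Rightarrow> real" where
  "flat p t = (if t > 0 then poly p (1 / t) * exp (- 1 / t) else 0)"

lemma poly_times_exp_neg_tendsto_0: "((\<lambda>y::real. poly p y * exp (- y)) \<longlongrightarrow> 0) at_top"
proof -
  have "((\<lambda>y. \<Sum>i\<le>degree p. coeff p i * (y ^ i / exp y)) \<longlongrightarrow> (\<Sum>i\<le>degree p. coeff p i * 0)) at_top"
    by (intro tendsto_sum tendsto_mult_left tendsto_power_div_exp_0)
  moreover have "(\<Sum>i\<le>degree p. coeff p i * (y ^ i / exp y)) = poly p y * exp (- y)" for y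
    unfolding poly_altdef sum_distrib_right by (intro sum.cong refl) (simp add: exp_minus field_simps)
  ultimately show ?thesis by simp
qed

text \<open>In the variable y = 1/t one has d/dt = - y^2 d/dy, so p exp(-y) becomes y^2 (p - p')
  exp(-y); the list polynomial is y^2. At 0 the right difference quotient is y p(y) exp(-y), which
  tends to 0 as y grows.\<close>

lemma has_real_derivative_flat:
  "(flat p has_real_derivative flat ([:0, 0, 1:] * (p - pderiv p)) t) (at t)"
proof -
  consider "t > 0" | "t < 0" | "t = 0" by linarith
  then show ?thesis
  proof cases
    case 1
    have d: "((\<lambda>t. - 1 / t) has_real_derivative 1 / t\<^sup>2) (at t)"
      "((\<lambda>t. 1 / t) has_real_derivative - 1 / t\<^sup>2) (at t)"
      using 1 by (auto intro!: derivative_eq_intros simp: power2_eq_square)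
    have "((\<lambda>t. poly p (1 / t) * exp (- 1 / t)) has_real_derivative
        poly (pderiv p) (1 / t) * (- 1 / t\<^sup>2) * exp (- 1 / t) + exp (- 1 / t) * (1 / t\<^sup>2) * poly p (1 / t)) (at t)"
      by (intro DERIV_mult DERIV_chain2[OF poly_DERIV d(2)] DERIV_chain2[OF DERIV_exp d(1)])
    moreover have "poly (pderiv p) (1 / t) * (- 1 / t\<^sup>2) * exp (- 1 / t) + exp (- 1 / t) * (1 / t\<^sup>2) * poly p (1 / t)
      = flat ([:0, 0, 1:] * (p - pderiv p)) t"
    proof -
      have "1 / t\<^sup>2 = (1 / t) * (1 / t)" "- 1 / t\<^sup>2 = - ((1 / t) * (1 / t))"
        by (simp_all add: power2_eq_square)
      moreover have "poly ([:0, 0, 1:] * (p - pderiv p)) y = y * y * (poly p y - poly (pderiv p) y)" for y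
        by (simp add: algebra_simps)
      moreover have "c * (- (y * y)) * e + e * (y * y) * d = y * y * (d - c) * e" for c d e y :: real
        by algebra
      ultimately show ?thesis
        using 1 unfolding flat_def by (simp only: if_True)
    qed
    ultimately have "((\<lambda>t. poly p (1 / t) * exp (- 1 / t)) has_real_derivative
        flat ([:0, 0, 1:] * (p - pderiv p)) t) (at t)" by simp
    moreover have "eventually (\<lambda>x. x > 0) (nhds t)"
      using 1 by (simp add: order_tendstoD(1) eventually_nhds) (metis greaterThan_iff open_greaterThan)
    then have "eventually (\<lambda>x. flat p x = poly p (1 / x) * exp (- 1 / x)) (nhds t)"
      by eventually_elim (simp add: flat_def)
    ultimately show ?thesis
      by (subst DERIV_cong_ev[OF refl _ refl]) auto
  next
    case 2
    have "eventually (\<lambda>x. x < 0) (nhds t)"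
      using 2 by (simp add: eventually_nhds) (metis lessThan_iff open_lessThan)
    then have "eventually (\<lambda>x. flat p x = 0) (nhds t)"
      by eventually_elim (simp add: flat_def)
    moreover have "flat ([:0, 0, 1:] * (p - pderiv p)) t = 0" using 2 by (simp add: flat_def)
    ultimately show ?thesis
      by (subst DERIV_cong_ev[OF refl _ refl, of _ "\<lambda>x. 0"]) auto
  next
    case 3
    have "((\<lambda>h. flat p h / h) \<longlongrightarrow> 0) (at_left 0)"
    proof (rule tendsto_eventually)
      show "\<forall>\<^sub>F h in at_left 0. flat p h / h = 0"
        by (auto simp: eventually_at_filter flat_def)
    qed
    moreover have "((\<lambda>h. flat p h / h) \<longlongrightarrow> 0) (at_right 0)"
    proof -
      have "((\<lambda>h. poly ([:0, 1:] * p) (inverse h) * exp (- inverse h)) \<longlongrightarrow> 0) (at_right 0)"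
        by (rule filterlim_compose[OF poly_times_exp_neg_tendsto_0 filterlim_inverse_at_top_right])
      then show ?thesis
        by (rule Lim_transform_eventually) (auto simp: eventually_at_filter flat_def field_simps)
    qed
    ultimately have "((\<lambda>h. flat p h / h) \<longlongrightarrow> 0) (at 0)"
      by (simp add: filterlim_split_at)
    then show ?thesis
      using 3 by (simp add: has_field_derivative_iff flat_def)
  qed
qed

section \<open>Smoothness by coinduction, and its closure properties\<close>

lemma smooth_differentiable: "smooth f \<Longrightarrow> f differentiable (at x)"
  unfolding smooth_def by (metis iter_deriv.simps(1))

lemma iter_deriv_append: "iter_deriv (us @ vs) f = iter_deriv us (iter_deriv vs f)"
  by (induction us) auto

lemma smooth_iter_deriv: "smooth f \<Longrightarrow> smooth (iter_deriv vs f)"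
  unfolding smooth_def by (metis iter_deriv_append)

lemma smooth_frechet_derivative: "smooth f \<Longrightarrow> smooth (\<lambda>x. frechet_derivative f (at x) v)"
  using smooth_iter_deriv[of f "[v]"] by simp

lemma smooth_has_derivative: "smooth f \<Longrightarrow> (f has_derivative frechet_derivative f (at x)) (at x)"
  using smooth_differentiable frechet_derivative_works by blast

lemma smooth_continuous_on: "smooth f \<Longrightarrow> continuous_on A f"
  by (meson smooth_differentiable continuous_at_imp_continuous_on differentiable_imp_continuous_within)

text \<open>Smoothness is a greatest fixed point: any class of differentiable functions that
  contains the directional derivatives of its members consists of smooth functions. No iterated
  derivative ever has to be computed.\<close>

lemma smooth_coinduct:
  assumes "P f" and "\<And>f. P f \<Longrightarrow> \<exists>f'. \<forall>x. (f has_derivative f' x) (at x) \<and> (\<forall>v. P (\<lambda>x. f' x v))"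
  shows "smooth f"
proof -
  have "P (iter_deriv vs f)" for vs
  proof (induction vs)
    case (Cons v vs)
    from assms(2)[OF this] obtain f' where f': "\<And>x. (iter_deriv vs f has_derivative f' x) (at x)"
      "\<And>v. P (\<lambda>x. f' x v)" by blast
    then have "frechet_derivative (iter_deriv vs f) (at x) = f' x" for x
      using frechet_derivative_at by metis
    then show ?case using f'(2) by simp
  qed (simp add: assms(1))
  then show ?thesis
    unfolding smooth_def using assms(2) differentiable_def by blast
qed

text \<open>The integral operator of the homotopy formula for the Poincare lemma. The exponent is
  left free because every differentiation in \<open>x\<close> produces one more factor
  \<open>s\<close>.\<close>

definition radial_mean :: "nat \<Rightarrow> (real^2 \<Rightarrow> real) \<Rightarrow> real^2 \<Rightarrow> real" where
  "radial_mean k f x = integral {0..1} (\<lambda>s. s ^ k * f (s *\<^sub>R x))"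

lemma has_derivative_radial_mean:
  assumes "smooth f"
  shows "(radial_mean k f has_derivative (\<lambda>v. radial_mean (Suc k) (\<lambda>x. frechet_derivative f (at x) v) x)) (at x)"
proof -
  \<comment> \<open>Differentiation under the integral is applied with the derivative as a bounded
    linear function depending continuously on the parameters; in finite dimension this continuity
    can be checked vector by vector.\<close>
  define D where "D x s = Blinfun (\<lambda>v. s ^ Suc k * frechet_derivative f (at (s *\<^sub>R x)) v)" for x s
  have bl: "bounded_linear (\<lambda>v. s ^ Suc k * frechet_derivative f (at (s *\<^sub>R x)) v)" for x s
    using smooth_has_derivative[OF assms, of "s *\<^sub>R x"]
    by (intro bounded_linear_mult_const bounded_linear_compose[OF bounded_linear_mult_right])
       (auto simp: has_derivative_def)
  have D: "blinfun_apply (D x s) v = s ^ Suc k * frechet_derivative f (at (s *\<^sub>R x)) v" for x s v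
    using bl by (simp add: D_def bounded_linear_Blinfun_apply)
  have cont_D: "continuous_on S (\<lambda>(x, s). D x s)" for S :: "((real^2) \<times> real) set"
  proof (rule continuous_on_blinfun_componentwise)
    fix i :: "real^2"
    have "continuous_on S (\<lambda>y. snd y ^ Suc k * frechet_derivative f (at (snd y *\<^sub>R fst y)) i)"
      by (intro continuous_intros continuous_on_compose2[OF smooth_continuous_on[OF smooth_frechet_derivative[OF assms], of UNIV]]) auto
    then show "continuous_on S (\<lambda>y. blinfun_apply (case y of (x, xa) \<Rightarrow> D x xa) i)"
      by (simp add: case_prod_beta D)
  qed
  have "((\<lambda>x. integral (cbox 0 1) (\<lambda>s. s ^ k * f (s *\<^sub>R x))) has_derivative
      blinfun_apply (integral (cbox 0 1) (D x))) (at x within UNIV)"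
  proof (rule leibniz_rule)
    fix x t
    have "((\<lambda>x. t ^ k * f (t *\<^sub>R x)) has_derivative (\<lambda>v. t ^ k * frechet_derivative f (at (t *\<^sub>R x)) (t *\<^sub>R v))) (at x)"
      by (auto intro!: derivative_eq_intros has_derivative_compose[OF _ smooth_has_derivative[OF assms]])
    moreover have "frechet_derivative f (at (t *\<^sub>R x)) (t *\<^sub>R v) = t * frechet_derivative f (at (t *\<^sub>R x)) v" for v
      using smooth_has_derivative[OF assms, of "t *\<^sub>R x"]
      by (metis has_derivative_linear linear_cmul real_scaleR_def)
    ultimately show "((\<lambda>x. t ^ k * f (t *\<^sub>R x)) has_derivative blinfun_apply (D x t)) (at x within UNIV)"
      by (simp add: D[abs_def] mult_ac)
  next
    show "(\<lambda>s. s ^ k * f (s *\<^sub>R x)) integrable_on cbox 0 1" for x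
      by (intro integrable_continuous continuous_intros
          continuous_on_compose2[OF smooth_continuous_on[OF assms, of UNIV]]) auto
  qed (auto intro: cont_D)
  moreover have "blinfun_apply (integral (cbox 0 1) (D x)) v
      = radial_mean (Suc k) (\<lambda>x. frechet_derivative f (at x) v) x" for v
  proof -
    have "continuous_on (cbox 0 1) (\<lambda>s. D x s)"
    proof -
      have "continuous_on (cbox 0 1) (\<lambda>s::real. (x, s))"
        by (intro continuous_on_Pair continuous_on_const continuous_on_id)
      from continuous_on_compose2[OF cont_D[of UNIV] this] show ?thesis by simp
    qed
    then have "D x integrable_on cbox 0 1" by (intro integrable_continuous) 
    then show ?thesis
      by (simp add: blinfun_apply_integral D radial_mean_def)
  qed
  then have "blinfun_apply (integral (cbox 0 1) (D x))
      = (\<lambda>v. radial_mean (Suc k) (\<lambda>x. frechet_derivative f (at x) v) x)" by blast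
  ultimately show ?thesis
    unfolding radial_mean_def[abs_def] by simp
qed

text \<open>A class generated by exactly the operations used later. The derivative of each
  constructor can be written with the same constructors, so coinduction yields smoothness of all of
  them simultaneously.\<close>

inductive smooth_alg :: "(real^2 \<Rightarrow> real) \<Rightarrow> bool" where
  smooth: "smooth f \<Longrightarrow> smooth_alg f"
| const: "smooth_alg (\<lambda>x. c)"
| bounded_linear: "bounded_linear f \<Longrightarrow> smooth_alg f"
| add: "smooth_alg f \<Longrightarrow> smooth_alg g \<Longrightarrow> smooth_alg (\<lambda>x. f x + g x)"
| mult: "smooth_alg f \<Longrightarrow> smooth_alg g \<Longrightarrow> smooth_alg (\<lambda>x. f x * g x)"
| powr: "smooth_alg f \<Longrightarrow> (\<And>x. f x > 0) \<Longrightarrow> smooth_alg (\<lambda>x. f x powr a)"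
| flat: "smooth_alg f \<Longrightarrow> smooth_alg (\<lambda>x. flat p (f x))"
| radial_mean: "smooth f \<Longrightarrow> smooth_alg (radial_mean k f)"

lemma smooth_alg_derivative:
  "smooth_alg f \<Longrightarrow> \<exists>f'. \<forall>x. (f has_derivative f' x) (at x) \<and> (\<forall>v. smooth_alg (\<lambda>x. f' x v))"
proof (induction rule: smooth_alg.induct)
  case (smooth f)
  then show ?case
    by (intro exI[of _ "\<lambda>x. frechet_derivative f (at x)"])
       (auto intro: smooth_has_derivative smooth_frechet_derivative smooth_alg.smooth)
next
  case (const c)
  then show ?case by (intro exI[of _ "\<lambda>x v. 0"]) (auto intro: smooth_alg.const)
next
  case (bounded_linear f)
  then show ?case by (intro exI[of _ "\<lambda>x. f"]) (auto intro: smooth_alg.const bounded_linear_imp_has_derivative)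
next
  case (add f g)
  then obtain f' g' where "\<And>x. (f has_derivative f' x) (at x)" "\<And>v. smooth_alg (\<lambda>x. f' x v)"
    "\<And>x. (g has_derivative g' x) (at x)" "\<And>v. smooth_alg (\<lambda>x. g' x v)" by metis
  then show ?case
    by (intro exI[of _ "\<lambda>x v. f' x v + g' x v"]) (auto intro: smooth_alg.add has_derivative_add)
next
  case (mult f g)
  then obtain f' g' where "\<And>x. (f has_derivative f' x) (at x)" "\<And>v. smooth_alg (\<lambda>x. f' x v)"
    "\<And>x. (g has_derivative g' x) (at x)" "\<And>v. smooth_alg (\<lambda>x. g' x v)" by metis
  with mult show ?case
    by (intro exI[of _ "\<lambda>x v. f x * g' x v + f' x v * g x"]) (auto intro!: smooth_alg.add smooth_alg.mult has_derivative_mult)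
next
  case (powr f a)
  then obtain f' where f': "\<And>x. (f has_derivative f' x) (at x)" "\<And>v. smooth_alg (\<lambda>x. f' x v)" by metis
  have "((\<lambda>x. f x powr a) has_derivative (\<lambda>v. a * f x powr (a - 1) * f' x v)) (at x)" for x
  proof -
    have "((\<lambda>y. y powr a) has_real_derivative a * f x powr (a - 1)) (at (f x))"
      using powr(2)[of x] by (rule has_real_derivative_powr)
    then show ?thesis
      using has_derivative_compose[OF f'(1)[of x]] unfolding has_field_derivative_def by blast
  qed
  with powr f' show ?case
    by (intro exI[of _ "\<lambda>x v. a * f x powr (a - 1) * f' x v"]) (auto intro!: smooth_alg.mult smooth_alg.const smooth_alg.powr)
next
  case (flat f p)
  then obtain f' where f': "\<And>x. (f has_derivative f' x) (at x)" "\<And>v. smooth_alg (\<lambda>x. f' x v)" by metis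
  let ?q = "[:0, 0, 1:] * (p - pderiv p)"
  have "((\<lambda>x. flat p (f x)) has_derivative (\<lambda>v. flat ?q (f x) * f' x v)) (at x)" for x
    using has_derivative_compose[OF f'(1)[of x]] has_real_derivative_flat[of p "f x"]
    unfolding has_field_derivative_def by blast
  moreover have "smooth_alg (\<lambda>x. flat ?q (f x) * f' x v)" for v
    by (intro smooth_alg.mult smooth_alg.flat flat.hyps f')
  ultimately show ?case
    by (intro exI[of _ "\<lambda>x v. flat ?q (f x) * f' x v"]) blast
next
  case (radial_mean f k)
  then show ?case
    by (intro exI[of _ "\<lambda>x v. radial_mean (Suc k) (\<lambda>x. frechet_derivative f (at x) v) x"])
       (auto intro: has_derivative_radial_mean smooth_frechet_derivative smooth_alg.radial_mean)
qed

text \<open>The generated class collapses to \<open>smooth\<close>, so its introduction rules turn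
  into closure properties of smooth functions.\<close>

lemma smooth_alg_iff: "smooth_alg f \<longleftrightarrow> smooth f"
  using smooth_coinduct[where P = smooth_alg, OF _ smooth_alg_derivative] smooth_alg.smooth by blast

lemmas smooth_const = smooth_alg.const[unfolded smooth_alg_iff]
  and smooth_bounded_linear = smooth_alg.bounded_linear[unfolded smooth_alg_iff]
  and smooth_add = smooth_alg.add[unfolded smooth_alg_iff]
  and smooth_mult = smooth_alg.mult[unfolded smooth_alg_iff]
  and smooth_powr = smooth_alg.powr[unfolded smooth_alg_iff]
  and smooth_flat = smooth_alg.flat[unfolded smooth_alg_iff]
  and smooth_radial_mean = smooth_alg.radial_mean[unfolded smooth_alg_iff]

lemma smooth_minus: "smooth f \<Longrightarrow> smooth g \<Longrightarrow> smooth (\<lambda>x. f x - g x)"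
  using smooth_add[OF _ smooth_mult[OF smooth_const[of "-1"]]] by simp

lemma smooth_nth: "smooth (\<lambda>x. x $ i)"
  by (intro smooth_bounded_linear bounded_linear_vec_nth)

lemma smooth_real_polynomial_function: "real_polynomial_function f \<Longrightarrow> smooth f"
  by (induction rule: real_polynomial_function.induct)
     (auto intro: smooth_const smooth_bounded_linear smooth_add smooth_mult)

lemma frechet_derivative_add: 
  "smooth f \<Longrightarrow> smooth g \<Longrightarrow> frechet_derivative (\<lambda>x. f x + g x) (at x) v = frechet_derivative f (at x) v + frechet_derivative g (at x) v"
  by (subst frechet_derivative_at[symmetric, OF has_derivative_add[OF smooth_has_derivative smooth_has_derivative]]) auto

lemma iter_deriv_add:
  "smooth f \<Longrightarrow> smooth g \<Longrightarrow> iter_deriv us (\<lambda>x. f x + g x) x = iter_deriv us f x + iter_deriv us g x"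
proof (induction us arbitrary: x)
  case (Cons u us)
  then have "iter_deriv us (\<lambda>x. f x + g x) = (\<lambda>x. iter_deriv us f x + iter_deriv us g x)" by auto
  then show ?case using frechet_derivative_add smooth_iter_deriv Cons.prems by simp
qed simp

lemma iter_deriv_cmult:
  "smooth f \<Longrightarrow> iter_deriv us (\<lambda>x. c * f x) x = c * iter_deriv us f x"
proof (induction us arbitrary: x)
  case (Cons u us)
  then have "iter_deriv us (\<lambda>x. c * f x) = (\<lambda>x. c * iter_deriv us f x)" by auto
  then show ?case
  proof -
    have "((\<lambda>x. c * iter_deriv us f x) has_derivative (\<lambda>v. c * frechet_derivative (iter_deriv us f) (at x) v)) (at x)"
      by (auto intro!: derivative_eq_intros smooth_has_derivative smooth_iter_deriv Cons.prems)
    then show ?thesis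
      using \<open>iter_deriv us (\<lambda>x. c * f x) = _\<close> by (simp add: frechet_derivative_at[symmetric])
  qed
qed simp

lemma iter_deriv_eq_0:
  "open U \<Longrightarrow> (\<And>x. x \<in> U \<Longrightarrow> f x = 0) \<Longrightarrow> x \<in> U \<Longrightarrow> iter_deriv us f x = 0"
proof (induction us arbitrary: x)
  case (Cons u us)
  then have "(iter_deriv us f has_derivative (\<lambda>v. 0)) (at x)"
    using has_derivative_transform_within_open[OF has_derivative_const[of 0 "at x"], of U] by metis
  then show ?case by (metis frechet_derivative_at iter_deriv.simps(2))
qed simp

text \<open>The quotient \<alpha> / (\<alpha> + \<beta>), where \<alpha> is positive exactly for
  |x|^2 < r^2 + 1 and \<beta> exactly for |x| > r; the two regions cover the plane, so the
  denominator never vanishes. The value 1 is taken on a whole neighbourhood of \<open>K\<close>,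
  because a current may see derivatives of every order up to some bound at points of
  \<open>K\<close>.\<close>

lemma smooth_cutoff:
  assumes "compact (K :: (real^2) set)"
  obtains f U C where "smooth f" "open U" "K \<subseteq> U" "\<And>x. x \<in> U \<Longrightarrow> f x = 1" "compact C"
    "\<And>x. x \<notin> C \<Longrightarrow> f x = 0"
proof -
  obtain r where r: "r > 0" "\<And>x. x \<in> K \<Longrightarrow> norm x < r"
    using compact_imp_bounded[OF assms] bounded_pos_less by metis
  define \<alpha> where "\<alpha> = (\<lambda>x::real^2. flat 1 (r\<^sup>2 + 1 - ((x $ 1)\<^sup>2 + (x $ 2)\<^sup>2)))"
  define \<beta> where "\<beta> = (\<lambda>x::real^2. flat 1 ((x $ 1)\<^sup>2 + (x $ 2)\<^sup>2 - r\<^sup>2))"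
  have nrm: "(x $ 1)\<^sup>2 + (x $ 2)\<^sup>2 = (norm x)\<^sup>2" for x :: "real^2"
    by (simp add: norm_vec_def L2_set_def sum_2)
  have flat_pos: "flat 1 t > 0" if "t > 0" for t using that by (simp add: flat_def)
  have flat_nonneg: "flat 1 t \<ge> 0" for t by (simp add: flat_def)
  have pos: "\<alpha> x + \<beta> x > 0" for x
  proof (cases "norm x ^ 2 < r ^ 2 + 1")
    case True
    then show ?thesis
      using flat_pos[of "r\<^sup>2 + 1 - (norm x)\<^sup>2"] flat_nonneg[of "(norm x)\<^sup>2 - r\<^sup>2"]
      by (simp add: \<alpha>_def \<beta>_def nrm)
  next
    case False
    then show ?thesis
      using flat_pos[of "(norm x)\<^sup>2 - r\<^sup>2"] flat_nonneg[of "r\<^sup>2 + 1 - (norm x)\<^sup>2"]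
      by (simp add: \<alpha>_def \<beta>_def nrm)
  qed
  have "smooth \<alpha>" "smooth \<beta>"
    unfolding \<alpha>_def \<beta>_def power2_eq_square
    by (rule smooth_flat smooth_minus smooth_add smooth_const smooth_mult smooth_nth)+
  show ?thesis
  proof
    show "smooth (\<lambda>x. \<alpha> x * (\<alpha> x + \<beta> x) powr (-1))"
      by (rule smooth_mult smooth_powr smooth_add \<open>smooth \<alpha>\<close> \<open>smooth \<beta>\<close> pos)+
    show "K \<subseteq> ball 0 r" using r by auto
    show "\<alpha> x * (\<alpha> x + \<beta> x) powr (-1) = 1" if "x \<in> ball 0 r" for x
    proof -
      have "(norm x)\<^sup>2 < r\<^sup>2" using that r by (simp add: power_strict_mono)
      then have "\<beta> x = 0" by (simp add: \<beta>_def nrm flat_def)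
      then show ?thesis using pos[of x] by (simp add: powr_minus)
    qed
    show "\<alpha> x * (\<alpha> x + \<beta> x) powr (-1) = 0" if "x \<notin> cball 0 (r + 1)" for x
    proof -
      have "(r + 1)\<^sup>2 < (norm x)\<^sup>2" using that r by (intro power_strict_mono) auto
      then have "r\<^sup>2 + 1 < (norm x)\<^sup>2" using r by (simp add: power2_sum)
      then show ?thesis by (simp add: \<alpha>_def nrm flat_def)
    qed
  qed auto
qed

section \<open>Forms and currents\<close>

abbreviation e1 :: "real^2" where "e1 \<equiv> axis 1 1"
abbreviation e2 :: "real^2" where "e2 \<equiv> axis 2 1"

definition det2 :: "real^2 \<Rightarrow> real^2 \<Rightarrow> real" where
  "det2 v w = v $ 1 * w $ 2 - v $ 2 * w $ 1"

lemma vec2_eq: "(v :: real^2) = v $ 1 *\<^sub>R e1 + v $ 2 *\<^sub>R e2"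
  by (simp add: vec_eq_iff forall_2 axis_def)

lemma inner_2: "(v :: real^2) \<bullet> w = v $ 1 * w $ 1 + v $ 2 * w $ 2"
  by (simp add: inner_vec_def sum_2)

lemma det2_sq: "(det2 v w)\<^sup>2 + (v \<bullet> w)\<^sup>2 = (norm v)\<^sup>2 * (norm w)\<^sup>2"
  unfolding det2_def power2_norm_eq_inner inner_2 by algebra

lemma abs_det2_eq_wedge_norm: "\<bar>det2 v w\<bar> = wedge_norm v w"
proof -
  have "(v \<bullet> v) * (w \<bullet> w) - (v \<bullet> w)\<^sup>2 = (det2 v w)\<^sup>2"
    using det2_sq[of v w] by (simp add: power2_norm_eq_inner)
  then show ?thesis by (simp add: wedge_norm_def)
qed

lemma abs_det2_le: "\<bar>det2 v w\<bar> \<le> norm v * norm w"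
  using det2_sq[of v w] by (intro abs_le_square_iff[THEN iffD2, of _ "norm v * norm w", simplified])
    (simp add: power_mult_distrib, smt (verit) zero_le_power2)

lemma forms1_smooth: "\<omega> \<in> forms1 \<Longrightarrow> smooth (\<lambda>x. \<omega> x v)"
  by (simp add: forms1_def)

lemma forms1_linear: "\<omega> \<in> forms1 \<Longrightarrow> linear (\<omega> x)"
  by (simp add: forms1_def)

lemma forms1_eq: "\<omega> \<in> forms1 \<Longrightarrow> \<omega> x v = \<omega> x e1 * v $ 1 + \<omega> x e2 * v $ 2"
  using linear_add[OF forms1_linear] linear_cmul[OF forms1_linear]
  by (subst vec2_eq[of v]) (simp add: mult.commute)

lemma forms1I: "smooth a \<Longrightarrow> smooth b \<Longrightarrow> (\<lambda>x v. a x * v $ 1 + b x * v $ 2) \<in> forms1"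
  unfolding forms1_def
  by (auto intro!: linearI smooth_add smooth_mult smooth_const simp: algebra_simps)

lemma forms2_smooth: "\<omega> \<in> forms2 \<Longrightarrow> smooth (\<lambda>x. \<omega> x v w)"
  by (simp add: forms2_def)

text \<open>Alternating bilinear forms on the plane are a one-dimensional space, so a 2-form is
  handled throughout by its single coefficient at \<open>e1\<close>, \<open>e2\<close>.\<close>

lemma forms2_eq:
  assumes "\<omega> \<in> forms2"
  shows "\<omega> x v w = \<omega> x e1 e2 * det2 v w"
proof -
  from assms have bl: "bilinear (\<omega> x)" and alt: "\<And>v. \<omega> x v v = 0"
    by (auto simp: forms2_def)
  from alt[of "e1 + e2"] have "\<omega> x e1 e1 + \<omega> x e1 e2 + (\<omega> x e2 e1 + \<omega> x e2 e2) = 0"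
    by (simp only: bilinear_ladd[OF bl] bilinear_radd[OF bl] ac_simps)
  then have anti: "\<omega> x e2 e1 = - \<omega> x e1 e2"
    using alt[of e1] alt[of e2] by linarith
  have "\<omega> x v w = \<omega> x (v $ 1 *\<^sub>R e1 + v $ 2 *\<^sub>R e2) (w $ 1 *\<^sub>R e1 + w $ 2 *\<^sub>R e2)"
    by (simp flip: vec2_eq)
  also have "\<dots> = \<omega> x e1 e2 * det2 v w"
    by (simp add: bilinear_ladd[OF bl] bilinear_radd[OF bl] bilinear_lmul[OF bl] bilinear_rmul[OF bl]
        alt anti det2_def algebra_simps)
  finally show ?thesis .
qed

lemma forms2I: "smooth f \<Longrightarrow> (\<lambda>x v w. f x * det2 v w) \<in> forms2"
proof -
  assume "smooth f"
  then have "smooth (\<lambda>x. f x * det2 v w)" for v w by (intro smooth_mult smooth_const)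
  moreover have "bilinear (\<lambda>v w. f x * det2 v w)" for x
    unfolding bilinear_def det2_def by (auto intro!: linearI simp: algebra_simps)
  ultimately show ?thesis unfolding forms2_def by (simp add: det2_def)
qed

text \<open>Linearity of the form in \<open>v\<close> and of the derivative in \<open>h\<close>
  reduce all derivatives to four partial derivatives of the two coefficients. In the exterior
  derivative the symmetric part then cancels.\<close>

lemma frechet_derivative_form1:
  assumes "\<omega> \<in> forms1"
  shows "frechet_derivative (\<lambda>y. \<omega> y v) (at x) h
    = (frechet_derivative (\<lambda>y. \<omega> y e1) (at x) e1 * h $ 1 + frechet_derivative (\<lambda>y. \<omega> y e1) (at x) e2 * h $ 2) * v $ 1
    + (frechet_derivative (\<lambda>y. \<omega> y e2) (at x) e1 * h $ 1 + frechet_derivative (\<lambda>y. \<omega> y e2) (at x) e2 * h $ 2) * v $ 2"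
proof -
  let ?D = "\<lambda>v. frechet_derivative (\<lambda>y. \<omega> y v) (at x)"
  have "(\<lambda>y. \<omega> y v) = (\<lambda>y. \<omega> y e1 * v $ 1 + \<omega> y e2 * v $ 2)"
    using forms1_eq[OF assms] by blast
  then have "((\<lambda>y. \<omega> y v) has_derivative (\<lambda>h. ?D e1 h * v $ 1 + ?D e2 h * v $ 2)) (at x)"
    by (auto intro!: derivative_eq_intros smooth_has_derivative forms1_smooth assms)
  from frechet_derivative_at[OF this, symmetric]
  have D: "?D v h = ?D e1 h * v $ 1 + ?D e2 h * v $ 2" by simp
  have L: "?D u h = ?D u e1 * h $ 1 + ?D u e2 * h $ 2" for u
  proof -
    have "linear (?D u)"
      using smooth_has_derivative[OF forms1_smooth[OF assms]] has_derivative_linear by blast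
    from linear_add[OF this] linear_cmul[OF this] show ?thesis
      by (subst vec2_eq[of h]) (simp add: mult.commute)
  qed
  show ?thesis unfolding D L[of e1] L[of e2] ..
qed

lemma ext_deriv_eq:
  assumes "\<omega> \<in> forms1"
  shows "ext_deriv \<omega> x v w
    = (frechet_derivative (\<lambda>y. \<omega> y e2) (at x) e1 - frechet_derivative (\<lambda>y. \<omega> y e1) (at x) e2) * det2 v w"
  unfolding ext_deriv_def frechet_derivative_form1[OF assms, of w x v] frechet_derivative_form1[OF assms, of v x w] det2_def
  by (simp add: algebra_simps)

lemma ext_deriv_forms2: "\<omega> \<in> forms1 \<Longrightarrow> ext_deriv \<omega> \<in> forms2"
proof -
  assume *: "\<omega> \<in> forms1"
  have "ext_deriv \<omega> = (\<lambda>x v w. (frechet_derivative (\<lambda>y. \<omega> y e2) (at x) e1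
      - frechet_derivative (\<lambda>y. \<omega> y e1) (at x) e2) * det2 v w)"
    using ext_deriv_eq[OF *] by blast
  then show ?thesis
    using forms2I[OF smooth_minus[OF smooth_frechet_derivative smooth_frechet_derivative]] forms1_smooth[OF *]
    by simp
qed

lemma form_norm1_leD:
  assumes "\<omega> \<in> forms1" "form_norm1 \<omega> \<le> 1"
  shows "\<bar>\<omega> x v\<bar> \<le> norm v"
proof -
  have "ereal (comass1 (\<omega> x)) \<le> 1"
    using assms(2) unfolding form_norm1_def by (meson SUP_upper UNIV_I order_trans)
  then have le1: "comass1 (\<omega> x) \<le> 1" by simp
  obtain B where B: "\<And>v. norm (\<omega> x v) \<le> B * norm v" "B > 0"
    using linear_bounded_pos[OF forms1_linear[OF assms(1)]] by metis
  \<comment> \<open>The supremum in \<open>comass1\<close> is a real one and bounds its members only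
    once the set is known to be bounded.\<close>
  have bdd: "bdd_above {\<omega> x v |v. norm v \<le> 1}"
  proof (rule bdd_aboveI)
    fix y assume "y \<in> {\<omega> x v |v. norm v \<le> 1}"
    then obtain v where "y = \<omega> x v" "norm v \<le> 1" by auto
    moreover from this B(2) have "B * norm v \<le> B" by (simp add: mult_left_le)
    ultimately show "y \<le> B" using B(1)[of v] by simp
  qed
  have unit: "\<omega> x u \<le> 1" if "norm u \<le> 1" for u
    unfolding comass1_def by (intro order_trans[OF cSup_upper[OF _ bdd] le1[unfolded comass1_def]]) (use that in blast)
  have "\<omega> x v \<le> norm v" for v
  proof (cases "v = 0")
    case True
    then show ?thesis by (simp add: linear_0[OF forms1_linear[OF assms(1)]])
  next
    case False
    then have "\<omega> x (v /\<^sub>R norm v) \<le> 1" by (intro unit) simp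
    then show ?thesis
      using False by (simp add: linear_cmul[OF forms1_linear[OF assms(1)]] field_simps)
  qed
  from this[of v] this[of "- v"] show ?thesis
    by (simp add: linear_neg[OF forms1_linear[OF assms(1)]])
qed

lemma form_norm1_leI:
  assumes "\<And>x v. norm v \<le> 1 \<Longrightarrow> \<omega> x v \<le> 1"
  shows "form_norm1 \<omega> \<le> 1"
  unfolding form_norm1_def
proof (rule SUP_least)
  fix x
  have "comass1 (\<omega> x) \<le> 1"
    unfolding comass1_def by (rule cSup_least) (auto intro: assms exI[of _ 0])
  then show "ereal (comass1 (\<omega> x)) \<le> 1" by simp
qed

lemma form_norm2_leD:
  assumes "\<omega> \<in> forms2" "form_norm2 \<omega> \<le> 1"
  shows "\<bar>\<omega> x e1 e2\<bar> \<le> 1"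
proof -
  have "ereal (comass2 (\<omega> x)) \<le> 1"
    using assms(2) unfolding form_norm2_def by (meson SUP_upper UNIV_I order_trans)
  then have le1: "comass2 (\<omega> x) \<le> 1" by simp
  have bdd: "bdd_above {\<omega> x v w |v w. wedge_norm v w \<le> 1}"
  proof (rule bdd_aboveI)
    fix y assume "y \<in> {\<omega> x v w |v w. wedge_norm v w \<le> 1}"
    then obtain v w where "y = \<omega> x v w" "\<bar>det2 v w\<bar> \<le> 1"
      by (auto simp flip: abs_det2_eq_wedge_norm)
    then have "y = \<omega> x e1 e2 * det2 v w" using forms2_eq[OF assms(1)] by blast
    then show "y \<le> \<bar>\<omega> x e1 e2\<bar>"
      using mult_left_le[of "\<bar>det2 v w\<bar>" "\<bar>\<omega> x e1 e2\<bar>"] \<open>\<bar>det2 v w\<bar> \<le> 1\<close>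
        abs_ge_self[of "\<omega> x e1 e2 * det2 v w"] by (simp add: abs_mult)
  qed
  have "wedge_norm e1 e2 \<le> 1" "wedge_norm e2 e1 \<le> 1"
    by (simp_all flip: abs_det2_eq_wedge_norm add: det2_def axis_def)
  then have "\<omega> x e1 e2 \<le> 1" "\<omega> x e2 e1 \<le> 1"
    unfolding comass2_def by (intro order_trans[OF cSup_upper[OF _ bdd] le1[unfolded comass2_def]]; blast)+
  moreover have "\<omega> x e2 e1 = - \<omega> x e1 e2"
    using forms2_eq[OF assms(1), of x e2 e1] by (simp add: det2_def axis_def)
  ultimately show ?thesis by simp
qed

lemma mass1_leI:
  assumes "\<And>\<omega>. \<omega> \<in> forms1 \<Longrightarrow> (\<And>x v. \<bar>\<omega> x v\<bar> \<le> norm v) \<Longrightarrow> A \<omega> \<le> M"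
  shows "mass1 A \<le> ereal M"
  unfolding mass1_def using assms form_norm1_leD by (intro SUP_least) auto

lemma mass2_leI:
  assumes "\<And>\<omega>. \<omega> \<in> forms2 \<Longrightarrow> (\<And>x. \<bar>\<omega> x e1 e2\<bar> \<le> 1) \<Longrightarrow> S \<omega> \<le> M"
  shows "mass2 S \<le> ereal M"
  unfolding mass2_def using assms form_norm2_leD by (intro SUP_least) auto

lemma mass1_ge:
  assumes "\<omega> \<in> forms1" "\<And>x v. norm v \<le> 1 \<Longrightarrow> \<omega> x v \<le> 1"
  shows "mass1 A \<ge> ereal (A \<omega>)"
  unfolding mass1_def using assms form_norm1_leI by (intro SUP_upper) auto

lemma zero_form2: "(\<lambda>x v w. 0) \<in> forms2"
  using forms2I[OF smooth_const[of 0]] by simp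

lemma mass2_add: "mass2 (\<lambda>\<omega>. S \<omega> + R \<omega>) \<le> mass2 S + mass2 R"
  unfolding mass2_def
  by (rule SUP_least, subst plus_ereal.simps(1)[symmetric], rule add_mono) (auto intro!: SUP_upper)

section \<open>Continuity of currents, and stability under sums and boundaries\<close>

definition seminorm1_le :: "(real^2) set \<Rightarrow> nat \<Rightarrow> form1 \<Rightarrow> real \<Rightarrow> bool" where
  "seminorm1_le K N \<omega> B \<longleftrightarrow> (\<forall>x\<in>K. \<forall>v\<in>Basis. \<forall>us. set us \<subseteq> Basis \<and> length us \<le> N \<longrightarrow>
            \<bar>iter_deriv us (\<lambda>y. \<omega> y v) x\<bar> \<le> B)"

definition seminorm2_le :: "(real^2) set \<Rightarrow> nat \<Rightarrow> form2 \<Rightarrow> real \<Rightarrow> bool" where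
  "seminorm2_le K N \<omega> B \<longleftrightarrow> (\<forall>x\<in>K. \<forall>v\<in>Basis. \<forall>w\<in>Basis. \<forall>us. set us \<subseteq> Basis \<and> length us \<le> N \<longrightarrow>
            \<bar>iter_deriv us (\<lambda>y. \<omega> y v w) x\<bar> \<le> B)"

lemma seminorm1_le_mono:
  "seminorm1_le K' N' \<omega> B \<Longrightarrow> K \<subseteq> K' \<Longrightarrow> N \<le> N' \<Longrightarrow> seminorm1_le K N \<omega> B"
  unfolding seminorm1_le_def by (meson order_trans subsetD)

lemma seminorm2_le_mono:
  "seminorm2_le K' N' \<omega> B \<Longrightarrow> K \<subseteq> K' \<Longrightarrow> N \<le> N' \<Longrightarrow> seminorm2_le K N \<omega> B"
  unfolding seminorm2_le_def by (meson order_trans subsetD)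

lemma currents1_linear:
  assumes "T \<in> currents1" "\<omega> \<in> forms1" "\<eta> \<in> forms1"
  shows "T (\<lambda>x v. a * \<omega> x v + b * \<eta> x v) = a * T \<omega> + b * T \<eta>"
  using assms by (simp add: currents1_def)

lemma currents2_linear:
  assumes "S \<in> currents2" "\<omega> \<in> forms2" "\<eta> \<in> forms2"
  shows "S (\<lambda>x v w. a * \<omega> x v w + b * \<eta> x v w) = a * S \<omega> + b * S \<eta>"
  using assms by (simp add: currents2_def)

lemma currents1_bounded:
  "T \<in> currents1 \<Longrightarrow> \<exists>K N C. compact K \<and> (\<forall>\<omega>\<in>forms1. \<forall>B\<ge>0. seminorm1_le K N \<omega> B \<longrightarrow> \<bar>T \<omega>\<bar> \<le> C * B)"
  unfolding currents1_def mem_Collect_eq seminorm1_le_def by (rule conjunct2)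

lemma currents2_bounded:
  "S \<in> currents2 \<Longrightarrow> \<exists>K N C. compact K \<and> (\<forall>\<omega>\<in>forms2. \<forall>B\<ge>0. seminorm2_le K N \<omega> B \<longrightarrow> \<bar>S \<omega>\<bar> \<le> C * B)"
  unfolding currents2_def mem_Collect_eq seminorm2_le_def by (rule conjunct2)

lemma currents1I:
  assumes "\<And>\<omega> \<eta> a b. \<omega> \<in> forms1 \<Longrightarrow> \<eta> \<in> forms1 \<Longrightarrow> T (\<lambda>x v. a * \<omega> x v + b * \<eta> x v) = a * T \<omega> + b * T \<eta>"
    and "compact K" "\<And>\<omega> B. \<omega> \<in> forms1 \<Longrightarrow> B \<ge> 0 \<Longrightarrow> seminorm1_le K N \<omega> B \<Longrightarrow> \<bar>T \<omega>\<bar> \<le> C * B"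
  shows "T \<in> currents1"
  unfolding currents1_def mem_Collect_eq seminorm1_le_def[symmetric]
  using assms by (intro conjI exI[of _ K] exI[of _ N] exI[of _ C]) auto

lemma currents2I:
  assumes "\<And>\<omega> \<eta> a b. \<omega> \<in> forms2 \<Longrightarrow> \<eta> \<in> forms2 \<Longrightarrow> S (\<lambda>x v w. a * \<omega> x v w + b * \<eta> x v w) = a * S \<omega> + b * S \<eta>"
    and "compact K" "\<And>\<omega> B. \<omega> \<in> forms2 \<Longrightarrow> B \<ge> 0 \<Longrightarrow> seminorm2_le K N \<omega> B \<Longrightarrow> \<bar>S \<omega>\<bar> \<le> C * B"
  shows "S \<in> currents2"
  unfolding currents2_def mem_Collect_eq seminorm2_le_def[symmetric]
  using assms by (intro conjI exI[of _ K] exI[of _ N] exI[of _ C]) auto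

text \<open>The zero form is an admissible test form and linearity sends it to 0. Together with
  finiteness this turns the mass of a filling into a real number.\<close>

lemma mass2_nonneg:
  assumes "S \<in> currents2"
  shows "mass2 S \<ge> 0"
proof -
  have "S (\<lambda>x v w. 0 * 0 + 0 * 0) = 0 * S (\<lambda>x v w. 0) + 0 * S (\<lambda>x v w. 0)"
    using assms zero_form2 zero_form2 by (rule currents2_linear)
  then have "S (\<lambda>x v w. 0) = 0" by simp
  moreover have "comass2 (\<lambda>v w. 0) = 0"
    unfolding comass2_def
    by (rule cSup_eq_maximum) (auto intro!: exI[of _ 0] simp flip: abs_det2_eq_wedge_norm simp: det2_def)
  then have "form_norm2 (\<lambda>x v w. 0) \<le> 1" by (simp add: form_norm2_def)
  ultimately show ?thesis
    unfolding mass2_def using zero_form2 by (intro SUP_upper2[of "\<lambda>x v w. 0"]) auto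
qed

lemma currents2_add:
  assumes "S \<in> currents2" "R \<in> currents2"
  shows "(\<lambda>\<omega>. S \<omega> + R \<omega>) \<in> currents2"
proof -
  obtain K N C where S: "compact K" "\<forall>\<omega>\<in>forms2. \<forall>B\<ge>0. seminorm2_le K N \<omega> B \<longrightarrow> \<bar>S \<omega>\<bar> \<le> C * B"
    using currents2_bounded[OF assms(1)] by blast
  obtain K' N' C' where R: "compact K'" "\<forall>\<omega>\<in>forms2. \<forall>B\<ge>0. seminorm2_le K' N' \<omega> B \<longrightarrow> \<bar>R \<omega>\<bar> \<le> C' * B"
    using currents2_bounded[OF assms(2)] by blast
  show ?thesis
  proof (rule currents2I[of _ "K \<union> K'" "max N N'" "C + C'"])
    fix \<omega> B assume *: "\<omega> \<in> forms2" "(0::real) \<le> B" "seminorm2_le (K \<union> K') (max N N') \<omega> B"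
    have "\<bar>S \<omega>\<bar> \<le> C * B" "\<bar>R \<omega>\<bar> \<le> C' * B"
      using *(1,2) S(2) R(2) seminorm2_le_mono[OF *(3), of K N] seminorm2_le_mono[OF *(3), of K' N'] by auto
    then show "\<bar>S \<omega> + R \<omega>\<bar> \<le> (C + C') * B" by (simp add: algebra_simps)
  qed (use S(1) R(1) assms in \<open>auto simp: currents2_linear algebra_simps\<close>)
qed

lemma ext_deriv_lincomb:
  assumes "\<omega> \<in> forms1" "\<eta> \<in> forms1"
  shows "ext_deriv (\<lambda>x v. a * \<omega> x v + b * \<eta> x v) = (\<lambda>x v w. a * ext_deriv \<omega> x v w + b * ext_deriv \<eta> x v w)"
proof -
  have "frechet_derivative (\<lambda>y. a * \<omega> y v + b * \<eta> y v) (at x) w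
     = a * frechet_derivative (\<lambda>y. \<omega> y v) (at x) w + b * frechet_derivative (\<lambda>y. \<eta> y v) (at x) w" for x v w
  proof -
    have "((\<lambda>y. a * \<omega> y v + b * \<eta> y v) has_derivative
        (\<lambda>w. a * frechet_derivative (\<lambda>y. \<omega> y v) (at x) w + b * frechet_derivative (\<lambda>y. \<eta> y v) (at x) w)) (at x)"
      by (auto intro!: derivative_eq_intros smooth_has_derivative forms1_smooth assms)
    from frechet_derivative_at[OF this, symmetric] show ?thesis by simp
  qed
  then show ?thesis
    unfolding ext_deriv_def by (auto simp: algebra_simps)
qed

text \<open>The exterior derivative is a difference of two first derivatives, so it costs one order
  of differentiation and a factor 2. This is the continuity of the boundary operator.\<close>

lemma iter_deriv_ext_deriv_le:
  assumes "\<omega> \<in> forms1" "set us \<subseteq> Basis" "length us \<le> N" "v \<in> Basis" "w \<in> Basis"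
    and "\<And>v us. v \<in> Basis \<Longrightarrow> set us \<subseteq> Basis \<Longrightarrow> length us \<le> Suc N \<Longrightarrow> \<bar>iter_deriv us (\<lambda>y. \<omega> y v) x\<bar> \<le> B"
  shows "\<bar>iter_deriv us (\<lambda>y. ext_deriv \<omega> y v w) x\<bar> \<le> 2 * B"
proof -
  have "(\<lambda>y. ext_deriv \<omega> y v w) = (\<lambda>y. iter_deriv [v] (\<lambda>y. \<omega> y w) y + (-1) * iter_deriv [w] (\<lambda>y. \<omega> y v) y)"
    by (simp add: ext_deriv_def)
  then have "iter_deriv us (\<lambda>y. ext_deriv \<omega> y v w) x
      = iter_deriv us (iter_deriv [v] (\<lambda>y. \<omega> y w)) x + (-1) * iter_deriv us (iter_deriv [w] (\<lambda>y. \<omega> y v)) x"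
    by (simp only: iter_deriv_add iter_deriv_cmult smooth_mult smooth_const smooth_iter_deriv forms1_smooth assms)
  then have "iter_deriv us (\<lambda>y. ext_deriv \<omega> y v w) x
      = iter_deriv (us @ [v]) (\<lambda>y. \<omega> y w) x - iter_deriv (us @ [w]) (\<lambda>y. \<omega> y v) x"
    unfolding iter_deriv_append by simp
  moreover have "\<bar>iter_deriv (us @ [v]) (\<lambda>y. \<omega> y w) x\<bar> \<le> B" "\<bar>iter_deriv (us @ [w]) (\<lambda>y. \<omega> y v) x\<bar> \<le> B"
    using assms by (auto intro!: assms(6))
  ultimately show ?thesis by linarith
qed

lemma diff_boundary_currents1:
  assumes "T \<in> currents1" "S \<in> currents2"
  shows "(\<lambda>\<omega>. T \<omega> - boundary S \<omega>) \<in> currents1"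
proof -
  obtain K N C where T: "compact K" "\<forall>\<omega>\<in>forms1. \<forall>B\<ge>0. seminorm1_le K N \<omega> B \<longrightarrow> \<bar>T \<omega>\<bar> \<le> C * B"
    using currents1_bounded[OF assms(1)] by blast
  obtain K' N' C' where S: "compact K'" "\<forall>\<omega>\<in>forms2. \<forall>B\<ge>0. seminorm2_le K' N' \<omega> B \<longrightarrow> \<bar>S \<omega>\<bar> \<le> C' * B"
    using currents2_bounded[OF assms(2)] by blast
  show ?thesis
  proof (rule currents1I[of _ "K \<union> K'" "max N (Suc N')" "C + 2 * C'"])
    fix \<omega> B assume *: "\<omega> \<in> forms1" "(0::real) \<le> B" "seminorm1_le (K \<union> K') (max N (Suc N')) \<omega> B"
    have "\<bar>T \<omega>\<bar> \<le> C * B" using *(1,2) T(2) seminorm1_le_mono[OF *(3), of K N] by auto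
    moreover have "seminorm2_le K' N' (ext_deriv \<omega>) (2 * B)"
      unfolding seminorm2_le_def using * by (auto intro!: iter_deriv_ext_deriv_le[of _ _ N'] simp: seminorm1_le_def)
    then have "\<bar>S (ext_deriv \<omega>)\<bar> \<le> C' * (2 * B)"
      using S(2) * ext_deriv_forms2 by simp
    ultimately show "\<bar>T \<omega> - boundary S \<omega>\<bar> \<le> (C + 2 * C') * B" by (simp add: boundary_def algebra_simps)
  qed (use T(1) S(1) assms in \<open>auto simp: currents1_linear currents2_linear ext_deriv_forms2 ext_deriv_lincomb boundary_def algebra_simps\<close>)
qed

section \<open>Finite mass of the filling and the comparison inequality\<close>

text \<open>The cone construction from the origin: contract the form with the radial field and
  integrate along the ray. The weight is \<open>s\<close>, one power from the dilation of the
  remaining tangent vector.\<close>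

definition poincare_primitive :: "form2 \<Rightarrow> form1" where
  "poincare_primitive \<omega> x v = radial_mean 1 (\<lambda>y. \<omega> y e1 e2) x * det2 x v"

lemma poincare_primitive_forms1:
  assumes "\<omega> \<in> forms2"
  shows "poincare_primitive \<omega> \<in> forms1"
proof -
  have "poincare_primitive \<omega> = (\<lambda>x v. (radial_mean 1 (\<lambda>y. \<omega> y e1 e2) x * (- 1 * x $ 2)) * v $ 1
      + (radial_mean 1 (\<lambda>y. \<omega> y e1 e2) x * x $ 1) * v $ 2)"
    by (intro ext) (simp add: poincare_primitive_def det2_def algebra_simps)
  then show ?thesis
    by (simp only:) (intro forms1I smooth_mult smooth_const smooth_nth smooth_radial_mean forms2_smooth assms)
qed

text \<open>Integrate the derivative of s^2 f(s x) over 0 <= s <= 1. The left side is the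
  coefficient of the exterior derivative of the cone primitive.\<close>

lemma radial_mean_euler:
  assumes "smooth f"
  shows "2 * radial_mean 1 f x + radial_mean 2 (\<lambda>y. frechet_derivative f (at y) e1) x * x $ 1
    + radial_mean 2 (\<lambda>y. frechet_derivative f (at y) e2) x * x $ 2 = f x"
proof -
  let ?D = "\<lambda>y. frechet_derivative f (at y)"
  have int: "(\<lambda>s. s ^ k * g (s *\<^sub>R x)) integrable_on {0..1}" if "smooth g" for k g
    unfolding interval_cbox
    by (intro integrable_continuous continuous_intros continuous_on_compose2[OF smooth_continuous_on[OF that, of UNIV]]) auto
  have L: "?D y x = x $ 1 * ?D y e1 + x $ 2 * ?D y e2" for y
  proof -
    have "linear (?D y)"
      using smooth_has_derivative[OF assms] has_derivative_linear by blast
    from linear_add[OF this] linear_cmul[OF this] show ?thesis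
      by (subst vec2_eq[of x]) simp
  qed
  have "((\<lambda>s. s\<^sup>2 * f (s *\<^sub>R x)) has_vector_derivative
      2 * (s ^ 1 * f (s *\<^sub>R x)) + (s\<^sup>2 * ?D (s *\<^sub>R x) e1) * x $ 1 + (s\<^sup>2 * ?D (s *\<^sub>R x) e2) * x $ 2) (at s within {0..1})" for s
  proof -
    have "((\<lambda>s. f (s *\<^sub>R x)) has_derivative (\<lambda>h. ?D (s *\<^sub>R x) (h *\<^sub>R x))) (at s)"
      by (rule has_derivative_compose[OF _ smooth_has_derivative[OF assms]]) (auto intro!: derivative_eq_intros)
    moreover have "?D (s *\<^sub>R x) (h *\<^sub>R x) = h * ?D (s *\<^sub>R x) x" for h
      using smooth_has_derivative[OF assms] by (metis has_derivative_linear linear_cmul real_scaleR_def)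
    ultimately have "((\<lambda>s. f (s *\<^sub>R x)) has_real_derivative ?D (s *\<^sub>R x) x) (at s)"
      by (simp add: has_field_derivative_def mult.commute[of _ "?D (s *\<^sub>R x) x"])
    from DERIV_mult[OF DERIV_power[OF DERIV_ident, of 2] this]
    show ?thesis
      by (auto simp: L[of "s *\<^sub>R x"] algebra_simps has_real_derivative_iff_has_vector_derivative
          intro: has_vector_derivative_at_within)
  qed
  from fundamental_theorem_of_calculus[OF _ this]
  have "((\<lambda>s. 2 * (s ^ 1 * f (s *\<^sub>R x)) + (s\<^sup>2 * ?D (s *\<^sub>R x) e1) * x $ 1 + (s\<^sup>2 * ?D (s *\<^sub>R x) e2) * x $ 2)
      has_integral f x) {0..1}" by force
  moreover have "((\<lambda>s. 2 * (s ^ 1 * f (s *\<^sub>R x)) + (s\<^sup>2 * ?D (s *\<^sub>R x) e1) * x $ 1 + (s\<^sup>2 * ?D (s *\<^sub>R x) e2) * x $ 2)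
      has_integral 2 * radial_mean 1 f x + radial_mean 2 (\<lambda>y. ?D y e1) x * x $ 1 + radial_mean 2 (\<lambda>y. ?D y e2) x * x $ 2) {0..1}"
    unfolding radial_mean_def
    by (intro has_integral_add has_integral_mult_left has_integral_mult_right integrable_integral int smooth_frechet_derivative assms)
  ultimately show ?thesis by (rule has_integral_unique[symmetric])
qed

lemma ext_deriv_poincare_primitive:
  assumes "\<omega> \<in> forms2"
  shows "ext_deriv (poincare_primitive \<omega>) = \<omega>"
proof (intro ext)
  fix x v w :: "real^2"
  let ?f = "\<lambda>y. \<omega> y e1 e2"
  have sm: "smooth ?f" using forms2_smooth[OF assms] .
  have p: "(\<lambda>y. poincare_primitive \<omega> y e1) = (\<lambda>y::real^2. radial_mean 1 ?f y * (- y $ 2))"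
    "(\<lambda>y. poincare_primitive \<omega> y e2) = (\<lambda>y::real^2. radial_mean 1 ?f y * y $ 1)"
    by (simp_all add: poincare_primitive_def det2_def axis_def)
  have nth: "((\<lambda>y::real^2. y $ i) has_derivative (\<lambda>h::real^2. h $ i)) (at x)" for i :: 2
    by (rule bounded_linear_imp_has_derivative[OF bounded_linear_vec_nth])
  have "((\<lambda>y::real^2. radial_mean 1 ?f y * y $ 1) has_derivative
      (\<lambda>h::real^2. radial_mean 1 ?f x * h $ 1 + radial_mean (Suc 1) (\<lambda>y. frechet_derivative ?f (at y) h) x * x $ 1)) (at x)"
    by (intro has_derivative_mult has_derivative_radial_mean sm nth)
  note d2 = frechet_derivative_at[OF this]
  have "((\<lambda>y::real^2. radial_mean 1 ?f y * (- y $ 2)) has_derivative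
      (\<lambda>h::real^2. radial_mean 1 ?f x * (- h $ 2) + radial_mean (Suc 1) (\<lambda>y. frechet_derivative ?f (at y) h) x * (- x $ 2))) (at x)"
    by (intro has_derivative_mult has_derivative_radial_mean has_derivative_minus sm nth)
  note d1 = frechet_derivative_at[OF this]
  show "ext_deriv (poincare_primitive \<omega>) x v w = \<omega> x v w"
    unfolding ext_deriv_eq[OF poincare_primitive_forms1[OF assms]] forms2_eq[OF assms, of x v w] p
      d1[symmetric] d2[symmetric]
    using radial_mean_euler[OF sm, of x] by (simp add: numeral_2_eq_2 axis_def)
qed

text \<open>The bound uses only the supremum of the coefficient and grows with |x|. That is enough
  for the finiteness of the filling's mass, since the primitive is only evaluated against objects
  living on bounded sets.\<close>

lemma poincare_primitive_le:
  assumes "\<omega> \<in> forms2" "\<And>x. \<bar>\<omega> x e1 e2\<bar> \<le> 1"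
  shows "\<bar>poincare_primitive \<omega> x v\<bar> \<le> norm x * norm v"
proof -
  have "norm (integral {0..1} (\<lambda>s. s ^ 1 * \<omega> (s *\<^sub>R x) e1 e2)) \<le> integral {0..1} (\<lambda>s::real. 1)"
  proof (rule integral_norm_bound_integral)
    show "(\<lambda>s. s ^ 1 * \<omega> (s *\<^sub>R x) e1 e2) integrable_on {0..1}"
      unfolding interval_cbox
      by (intro integrable_continuous continuous_intros
          continuous_on_compose2[OF smooth_continuous_on[OF forms2_smooth[OF assms(1)], of UNIV]]) auto
    show "norm (s ^ 1 * \<omega> (s *\<^sub>R x) e1 e2) \<le> 1" if "s \<in> {0..1}" for s
      using that mult_mono[of "\<bar>s\<bar>" 1 "\<bar>\<omega> (s *\<^sub>R x) e1 e2\<bar>" 1] assms(2)[of "s *\<^sub>R x"] by (simp add: abs_mult)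
  qed auto
  then have "\<bar>radial_mean 1 (\<lambda>y. \<omega> y e1 e2) x\<bar> \<le> 1" by (simp add: radial_mean_def)
  then have "\<bar>radial_mean 1 (\<lambda>y. \<omega> y e1 e2) x\<bar> * \<bar>det2 x v\<bar> \<le> 1 * (norm x * norm v)"
    by (intro mult_mono abs_det2_le) auto
  then show ?thesis by (simp add: poincare_primitive_def abs_mult)
qed

text \<open>The filling \<open>S\<close> of a minimizer is not assumed to have finite mass. Testing it on
  \<open>\<omega> = d\<eta>\<close> gives \<open>S \<omega> = T \<eta> - \<Gamma> \<eta>\<close>, and both terms are controlled by \<open>sup \<bar>\<omega>\<bar>\<close>,
  the first one because \<open>T\<close> is the boundary of a region.\<close>

lemma mass2_finite:
  assumes \<Omega>: "is_region_boundary T \<Omega>"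
    and \<Gamma>: "\<And>\<omega>. \<omega> \<in> forms1 \<Longrightarrow> \<Gamma> \<omega> = T \<omega> - boundary S \<omega>"
    and "bounded E"
    and \<Gamma>_bound: "\<And>\<omega> B. \<omega> \<in> forms1 \<Longrightarrow> (\<And>x v. x \<in> E \<Longrightarrow> \<bar>\<omega> x v\<bar> \<le> B * norm v) \<Longrightarrow> \<bar>\<Gamma> \<omega>\<bar> \<le> M * B"
  shows "mass2 S < \<infinity>"
proof -
  from \<Omega> have T_cur: "T \<in> currents1" by (simp add: is_region_boundary_def)
  obtain K N c where T: "compact K" "\<forall>\<omega>\<in>forms1. \<forall>B\<ge>0. seminorm1_le K N \<omega> B \<longrightarrow> \<bar>T \<omega>\<bar> \<le> c * B"
    using currents1_bounded[OF T_cur] by blast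
  have T_region: "T \<omega> = boundary (region_current \<Omega>) \<omega>" if "\<omega> \<in> test_forms1" for \<omega>
    using \<Omega> that unfolding is_region_boundary_def by blast
  obtain f U C where f: "smooth f" "open U" "K \<subseteq> U" "\<And>x. x \<in> U \<Longrightarrow> f x = 1" "compact C"
    "\<And>x. x \<notin> C \<Longrightarrow> f x = 0"
    using smooth_cutoff[OF T(1)] by metis
  obtain r where r: "\<And>x. x \<in> E \<Longrightarrow> norm x \<le> r"
    using \<open>bounded E\<close> bounded_iff by blast
  have "\<exists>b. \<forall>x\<in>C. \<bar>g x\<bar> \<le> b" if "smooth g" for g
    using compact_imp_bounded[OF compact_continuous_image[OF smooth_continuous_on[OF that] \<open>compact C\<close>]]
    unfolding bounded_iff by auto
  note bdd = this[OF f(1)] this[OF smooth_frechet_derivative[OF f(1), of e1]] this[OF smooth_frechet_derivative[OF f(1), of e2]]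
  obtain b0 where b0: "\<And>x. x \<in> C \<Longrightarrow> \<bar>f x\<bar> \<le> b0" using bdd(1) by blast
  obtain b1 where b1: "\<And>x. x \<in> C \<Longrightarrow> \<bar>frechet_derivative f (at x) e1\<bar> \<le> b1" using bdd(2) by blast
  obtain b2 where b2: "\<And>x. x \<in> C \<Longrightarrow> \<bar>frechet_derivative f (at x) e2\<bar> \<le> b2" using bdd(3) by blast
  obtain R where R: "R \<ge> 0" "\<And>x. x \<in> C \<Longrightarrow> norm x \<le> R"
    using compact_imp_bounded[OF \<open>compact C\<close>] by (metis bounded_pos less_imp_le)
  \<comment> \<open>A bound on \<open>C\<close> for the coefficient of d(f \<eta>) = f \<omega> + df
    \<and> \<eta>: there |f| and the partial derivatives of f are bounded, |\<omega>| <= 1, and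
    |\<eta>| <= \<open>R\<close> because the primitive is at most |x|.\<close>
  define G where "G = \<bar>b0\<bar> + \<bar>b1\<bar> * R + \<bar>b2\<bar> * R"
  have "G \<ge> 0" using R(1) by (simp add: G_def)
  have "mass2 S \<le> ereal (G * measure lebesgue C + \<bar>M\<bar> * \<bar>r\<bar>)"
  proof (rule mass2_leI)
    fix \<omega> assume \<omega>: "\<omega> \<in> forms2" "\<And>x. \<bar>\<omega> x e1 e2\<bar> \<le> 1"
    define \<eta> where "\<eta> = poincare_primitive \<omega>"
    have \<eta>: "\<eta> \<in> forms1" "ext_deriv \<eta> = \<omega>" "\<And>x v. \<bar>\<eta> x v\<bar> \<le> norm x * norm v"
      using \<omega> by (simp_all add: \<eta>_def poincare_primitive_forms1 ext_deriv_poincare_primitive poincare_primitive_le)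
    define \<zeta> where "\<zeta> = (\<lambda>x (v::real^2). (f x * \<eta> x e1) * v $ 1 + (f x * \<eta> x e2) * v $ 2)"
    have \<zeta>: "\<zeta> \<in> forms1"
      unfolding \<zeta>_def by (intro forms1I smooth_mult f forms1_smooth \<eta>)
    have \<zeta>_eq: "\<zeta> x v = f x * \<eta> x v" for x v
      unfolding \<zeta>_def forms1_eq[OF \<eta>(1), of x v] by (simp add: algebra_simps)
    have "\<zeta> \<in> test_forms1"
      unfolding test_forms1_def using \<zeta> \<open>compact C\<close> f(6) by (auto simp: \<zeta>_eq)
    have "(\<lambda>x v. 1 * \<eta> x v + (-1) * \<zeta> x v) = (\<lambda>x (v::real^2). (\<eta> x e1 - \<zeta> x e1) * v $ 1 + (\<eta> x e2 - \<zeta> x e2) * v $ 2)"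
      by (intro ext, subst forms1_eq[OF \<eta>(1)], subst forms1_eq[OF \<zeta>]) (simp add: algebra_simps)
    then have diff: "(\<lambda>x v. 1 * \<eta> x v + (-1) * \<zeta> x v) \<in> forms1"
      by (simp only:) (intro forms1I smooth_minus forms1_smooth \<eta> \<zeta>)
    \<comment> \<open>As f is 1 on the open set \<open>U\<close>, the difference of \<eta> and
      \<zeta> vanishes near \<open>K\<close> with all its derivatives, so \<open>T\<close> cannot
      distinguish the two forms; \<zeta> has compact support and may be tested on the
      region.\<close>
    have "seminorm1_le K N (\<lambda>x v. 1 * \<eta> x v + (-1) * \<zeta> x v) 0"
      unfolding seminorm1_le_def using f by (auto simp: \<zeta>_eq intro!: iter_deriv_eq_0[of U])
    then have "\<bar>T (\<lambda>x v. 1 * \<eta> x v + (-1) * \<zeta> x v)\<bar> \<le> c * 0"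
      using T(2) diff by blast
    then have "T \<eta> = T \<zeta>" using currents1_linear[OF T_cur \<eta>(1) \<zeta>, of 1 "-1"] by simp
    define h where "h x = ext_deriv \<zeta> x e1 e2" for x
    have h: "h x = f x * \<omega> x e1 e2 + frechet_derivative f (at x) e1 * \<eta> x e2 - frechet_derivative f (at x) e2 * \<eta> x e1" for x
    proof -
      have d: "frechet_derivative (\<lambda>y. \<zeta> y v) (at x) u
        = f x * frechet_derivative (\<lambda>y. \<eta> y v) (at x) u + frechet_derivative f (at x) u * \<eta> x v" for u v
        unfolding \<zeta>_eq
        by (subst frechet_derivative_at[symmetric, OF has_derivative_mult[OF smooth_has_derivative smooth_has_derivative]])
           (auto intro: f forms1_smooth \<eta>)
      show ?thesis
        unfolding h_def ext_deriv_def d \<eta>(2)[symmetric] by (simp add: algebra_simps)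
    qed
    have h_le: "\<bar>h x\<bar> \<le> G * indicator C x" for x
    proof (cases "x \<in> C")
      case True
      have "\<bar>\<eta> x e1\<bar> \<le> R" "\<bar>\<eta> x e2\<bar> \<le> R"
        using \<eta>(3)[of x e1] \<eta>(3)[of x e2] R(2)[OF True] by auto
      have "\<bar>f x * \<omega> x e1 e2\<bar> \<le> \<bar>b0\<bar> * 1"
        unfolding abs_mult by (rule mult_mono) (use b0[OF True] \<omega>(2)[of x] in auto)
      moreover have "\<bar>frechet_derivative f (at x) e1 * \<eta> x e2\<bar> \<le> \<bar>b1\<bar> * R"
        unfolding abs_mult by (rule mult_mono) (use b1[OF True] \<open>\<bar>\<eta> x e2\<bar> \<le> R\<close> in auto)
      moreover have "\<bar>frechet_derivative f (at x) e2 * \<eta> x e1\<bar> \<le> \<bar>b2\<bar> * R"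
        unfolding abs_mult by (rule mult_mono) (use b2[OF True] \<open>\<bar>\<eta> x e1\<bar> \<le> R\<close> in auto)
      moreover have "\<bar>p + q - r\<bar> \<le> \<bar>p\<bar> + \<bar>q\<bar> + \<bar>r\<bar>" for p q r :: real by arith
      ultimately have "\<bar>h x\<bar> \<le> G" unfolding h G_def by (smt (verit, best))
      then show ?thesis using True by simp
    next
      case False
      have "open (- C)" using \<open>compact C\<close> by (simp add: compact_imp_closed open_Compl)
      then have "iter_deriv [u] f x = 0" for u
        using False f(6) by (intro iter_deriv_eq_0[of "- C"]) auto
      then show ?thesis using False f(6) unfolding h by simp
    qed
    have C: "C \<in> lmeasurable" using \<open>compact C\<close> by (rule lmeasurable_compact)
    have "\<bar>T \<zeta>\<bar> = \<bar>LINT x:\<Omega>|lebesgue. h x\<bar>"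
      using T_region[OF \<open>\<zeta> \<in> test_forms1\<close>] by (simp add: boundary_def region_current_def h_def)
    also have "\<dots> \<le> (LINT x|lebesgue. norm (indicator \<Omega> x *\<^sub>R h x))"
      unfolding set_lebesgue_integral_def using integral_norm_bound[of lebesgue "\<lambda>x. indicator \<Omega> x *\<^sub>R h x"] by simp
    also have "\<dots> \<le> (LINT x|lebesgue. G * indicator C x)"
    proof (rule integral_mono')
      show "integrable lebesgue (\<lambda>x. G * indicator C x)"
        using C by (intro integrable_mult_right integrable_real_indicator) (simp_all only: fmeasurable_def mem_Collect_eq infinity_ennreal_def)
      show "norm (indicator \<Omega> x *\<^sub>R h x) \<le> G * indicator C x" for x
        using h_le[of x] by (auto simp: indicator_def split: if_splits)
      show "0 \<le> G * indicator C x" for x using \<open>G \<ge> 0\<close> by simp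
    qed
    also have "\<dots> = G * measure lebesgue C" by simp
    finally have T_le: "\<bar>T \<eta>\<bar> \<le> G * measure lebesgue C" using \<open>T \<eta> = T \<zeta>\<close> by simp
    have "\<bar>\<Gamma> \<eta>\<bar> \<le> M * r"
    proof (rule \<Gamma>_bound[OF \<eta>(1)])
      fix x v assume "x \<in> E"
      then show "\<bar>\<eta> x v\<bar> \<le> r * norm v"
        using \<eta>(3)[of x v] mult_right_mono[OF r, of x "norm v"] by simp
    qed
    also have "\<dots> \<le> \<bar>M\<bar> * \<bar>r\<bar>" by (metis abs_ge_self abs_mult)
    finally have "\<bar>\<Gamma> \<eta>\<bar> \<le> \<bar>M\<bar> * \<bar>r\<bar>" .
    moreover have "S \<omega> = T \<eta> - \<Gamma> \<eta>" using \<Gamma>[OF \<eta>(1)] by (simp add: boundary_def \<eta>(2))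
    ultimately show "S \<omega> \<le> G * measure lebesgue C + \<bar>M\<bar> * \<bar>r\<bar>" using T_le by linarith
  qed
  then show ?thesis using order_le_less_trans by fastforce
qed

text \<open>\<open>S + R\<close> is a filling that leaves the remainder \<Gamma> - \<partial>R,
  hence it competes in the infimum defining the flat norm. Subadditivity of mass then bounds its
  cost, and the finite term \<open>lam * m\<close> cancels.\<close>

lemma flat_norm_minimizer_competitor:
  assumes "lam > 0" "is_region_boundary T \<Omega>" "flat_norm_minimizer lam T \<Gamma>"
    and "bounded E"
    and \<Gamma>_bound: "\<And>\<omega> B. \<omega> \<in> forms1 \<Longrightarrow> (\<And>x v. x \<in> E \<Longrightarrow> \<bar>\<omega> x v\<bar> \<le> B * norm v) \<Longrightarrow> \<bar>\<Gamma> \<omega>\<bar> \<le> M * B"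
    and "R \<in> currents2"
  shows "mass1 \<Gamma> \<le> mass1 (\<lambda>\<omega>. \<Gamma> \<omega> - boundary R \<omega>) + ereal lam * mass2 R"
proof -
  obtain S where S: "S \<in> currents2" "\<And>\<omega>. \<omega> \<in> forms1 \<Longrightarrow> \<Gamma> \<omega> = T \<omega> - boundary S \<omega>"
    "mass1 \<Gamma> + ereal lam * mass2 S = flat_norm lam T"
    using assms(3) unfolding flat_norm_minimizer_def by blast
  have "mass2 S < \<infinity>"
    by (rule mass2_finite[OF assms(2) S(2) assms(4) \<Gamma>_bound])
  then obtain m where m: "mass2 S = ereal m" using mass2_nonneg[OF S(1)] by (cases "mass2 S") auto
  define Q where "Q = (\<lambda>\<omega>. S \<omega> + R \<omega>)"
  have Q: "Q \<in> currents2" unfolding Q_def using S(1) assms(6) by (rule currents2_add)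
  have T: "T \<in> currents1" using assms(2) by (simp add: is_region_boundary_def)
  have "mass1 (\<lambda>\<omega>. T \<omega> - boundary Q \<omega>) = mass1 (\<lambda>\<omega>. \<Gamma> \<omega> - boundary R \<omega>)"
    unfolding mass1_def by (rule SUP_cong) (auto simp: S(2) Q_def boundary_def)
  moreover have "flat_norm lam T \<le> mass1 (\<lambda>\<omega>. T \<omega> - boundary Q \<omega>) + ereal lam * mass2 Q"
    unfolding flat_norm_def
    by (intro Inf_lower CollectI exI[of _ "\<lambda>\<omega>. T \<omega> - boundary Q \<omega>"] exI[of _ Q] conjI refl diff_boundary_currents1 T Q) auto
  moreover have "ereal lam * mass2 Q \<le> ereal lam * (ereal m + mass2 R)"
    using mass2_add[of S R] assms(1) by (intro ereal_mult_left_mono) (auto simp: Q_def m)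
  moreover have "ereal lam * (ereal m + mass2 R) = ereal (lam * m) + ereal lam * mass2 R"
    by (subst ereal_distrib_left) (auto simp: assms(1))
  ultimately have "mass1 \<Gamma> + ereal (lam * m) \<le> mass1 (\<lambda>\<omega>. \<Gamma> \<omega> - boundary R \<omega>) + (ereal (lam * m) + ereal lam * mass2 R)"
    unfolding S(3)[symmetric] m times_ereal.simps(1) by (metis (no_types) add_left_mono order_trans)
  then have "mass1 \<Gamma> + ereal (lam * m) \<le> (mass1 (\<lambda>\<omega>. \<Gamma> \<omega> - boundary R \<omega>) + ereal lam * mass2 R) + ereal (lam * m)"
    by (simp add: ac_simps)
  then show ?thesis by (subst (asm) ereal_add_le_add_iff2) auto
qed

section \<open>Ruled surfaces\<close>

definition path_current :: "real \<Rightarrow> real \<Rightarrow> (real \<Rightarrow> real^2) \<Rightarrow> (real \<Rightarrow> real^2) \<Rightarrow> form1 \<Rightarrow> real" where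
  "path_current a b c c' \<omega> = integral {a..b} (\<lambda>t. \<omega> (c t) (c' t))"

definition C1_path :: "real \<Rightarrow> real \<Rightarrow> (real \<Rightarrow> real^2) \<Rightarrow> (real \<Rightarrow> real^2) \<Rightarrow> bool" where
  "C1_path a b c c' \<longleftrightarrow> a \<le> b \<and> (\<forall>t\<in>{a..b}. (c has_vector_derivative c' t) (at t within {a..b})) \<and>
     continuous_on {a..b} c'"

lemma C1_path_continuous: "C1_path a b c c' \<Longrightarrow> continuous_on {a..b} c"
  unfolding C1_path_def by (meson continuous_on_eq_continuous_within has_vector_derivative_continuous)

lemma continuous_on_form1:
  assumes "\<omega> \<in> forms1" "continuous_on S X" "continuous_on S V"
  shows "continuous_on S (\<lambda>z. \<omega> (X z) (V z))"
proof -
  have "continuous_on S (\<lambda>z. \<omega> (X z) e1 * V z $ 1 + \<omega> (X z) e2 * V z $ 2)"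
    by (intro continuous_intros assms continuous_on_compose2[OF smooth_continuous_on[OF forms1_smooth[OF assms(1)], of UNIV]]) auto
  then show ?thesis by (subst forms1_eq[OF assms(1)])
qed

lemma has_vector_derivative_form1:
  assumes "\<omega> \<in> forms1" "(X has_vector_derivative X') (at s within S)" "(V has_vector_derivative V') (at s within S)"
  shows "((\<lambda>s. \<omega> (X s) (V s)) has_vector_derivative
     frechet_derivative (\<lambda>y. \<omega> y (V s)) (at (X s)) X' + \<omega> (X s) V') (at s within S)"
proof -
  let ?D = "\<lambda>v. frechet_derivative (\<lambda>y. \<omega> y v) (at (X s))"
  have D: "?D v X' = ?D e1 X' * v $ 1 + ?D e2 X' * v $ 2" for v
    by (simp add: frechet_derivative_form1[OF assms(1), of _ "X s" X'] axis_def)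
  have lin: "?D v (h *\<^sub>R X') = h * ?D v X'" for v h
    using smooth_has_derivative[OF forms1_smooth[OF assms(1)]] by (metis has_derivative_linear linear_cmul real_scaleR_def)
  have dX: "((\<lambda>s. \<omega> (X s) v) has_derivative (\<lambda>h. h * ?D v X')) (at s within S)" for v
    using has_derivative_compose[OF assms(2)[unfolded has_vector_derivative_def] smooth_has_derivative[OF forms1_smooth[OF assms(1)]]]
    by (simp add: lin)
  have dV: "((\<lambda>s. V s $ i) has_derivative (\<lambda>h. h * V' $ i)) (at s within S)" for i
    using bounded_linear.has_derivative[OF bounded_linear_vec_nth assms(3)[unfolded has_vector_derivative_def]] by simp
  have "((\<lambda>s. \<omega> (X s) e1 * V s $ 1 + \<omega> (X s) e2 * V s $ 2) has_derivative
      (\<lambda>h. (\<omega> (X s) e1 * (h * V' $ 1) + (h * ?D e1 X') * V s $ 1) + (\<omega> (X s) e2 * (h * V' $ 2) + (h * ?D e2 X') * V s $ 2)))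
      (at s within S)"
    by (intro has_derivative_add has_derivative_mult dX dV)
  then show ?thesis
    unfolding has_vector_derivative_def D[of "V s"] forms1_eq[OF assms(1), of "X s" V']
    by (subst forms1_eq[OF assms(1)]) (simp add: algebra_simps)
qed

context
  fixes a b :: real and c0 c0' c1 c1' :: "real \<Rightarrow> real^2"
  assumes c0: "C1_path a b c0 c0'" and c1: "C1_path a b c1 c1'"
begin

definition ruled :: "real \<Rightarrow> real \<Rightarrow> real^2" where
  "ruled t u = c0 t + u *\<^sub>R (c1 t - c0 t)"

definition ruled' :: "real \<Rightarrow> real \<Rightarrow> real^2" where
  "ruled' t u = c0' t + u *\<^sub>R (c1' t - c0' t)"

text \<open>The image of an oriented parameter rectangle under the straight-line homotopy from
  \<open>c0\<close> to \<open>c1\<close>. The tangent vectors are \<open>ruled'\<close> in the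
  direction of \<open>t\<close> and the ruling \<open>c1 t - c0 t\<close> in the direction of
  \<open>u\<close>. Overlaps and degenerate pieces need no care, because integration is over the
  parameters.\<close>

definition ruled_current :: "form2 \<Rightarrow> real" where
  "ruled_current \<omega> = integral {a..b} (\<lambda>t. integral {0..1} (\<lambda>u. \<omega> (ruled t u) (ruled' t u) (c1 t - c0 t)))"

lemma C1_path_le: "a \<le> b" using c0 by (simp add: C1_path_def)

lemma continuous_on_fst_cbox:
  "continuous_on {a..b} c \<Longrightarrow> continuous_on (cbox (a, 0::real) (b, 1)) (\<lambda>z. c (fst z))"
  by (rule continuous_on_compose2[of "{a..b}" c]) (auto intro!: continuous_intros simp: mem_box Basis_prod_def)

lemmas continuous_paths =
  continuous_on_fst_cbox[OF C1_path_continuous[OF c0]] continuous_on_fst_cbox[OF C1_path_continuous[OF c1]]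
  continuous_on_fst_cbox[OF conjunct2[OF conjunct2[OF c0[unfolded C1_path_def]]]]
  continuous_on_fst_cbox[OF conjunct2[OF conjunct2[OF c1[unfolded C1_path_def]]]]

lemma continuous_on_ruled:
  "continuous_on (cbox (a, 0) (b, 1)) (\<lambda>z. ruled (fst z) (snd z))"
  "continuous_on (cbox (a, 0) (b, 1)) (\<lambda>z. ruled' (fst z) (snd z))"
  unfolding ruled_def ruled'_def by (intro continuous_intros continuous_paths)+

lemma continuous_on_ruled_integrand:
  assumes "\<omega> \<in> forms2"
  shows "continuous_on (cbox (a, 0) (b, 1)) (\<lambda>(t, u). \<omega> (ruled t u) (ruled' t u) (c1 t - c0 t))"
proof -
  have "continuous_on (cbox (a, 0) (b, 1)) (\<lambda>z. \<omega> (ruled (fst z) (snd z)) e1 e2 * det2 (ruled' (fst z) (snd z)) (c1 (fst z) - c0 (fst z)))"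
    unfolding det2_def
    by (intro continuous_intros continuous_paths continuous_on_ruled
        continuous_on_compose2[OF smooth_continuous_on[OF forms2_smooth[OF assms], of UNIV]]) auto
  then show ?thesis
    unfolding case_prod_beta by (subst forms2_eq[OF assms]) simp
qed

lemma slice_continuous:
  assumes "continuous_on (cbox (a, 0) (b, 1)) (\<lambda>(t::real, u::real). F t u :: real)" "t \<in> {a..b}"
  shows "continuous_on {0..1} (F t)"
proof -
  have "continuous_on {0..1::real} (\<lambda>u. (t, u))"
    by (intro continuous_on_Pair continuous_on_const continuous_on_id)
  from continuous_on_compose2[OF assms(1) this] assms(2) show ?thesis
    by (simp add: cbox_Pair_eq image_subset_iff)
qed

lemma slice_integral_continuous:
  assumes "continuous_on (cbox (a, 0) (b, 1)) (\<lambda>(t::real, u::real). F t u :: real)"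
  shows "continuous_on {a..b} (\<lambda>t. integral {0..1} (F t))"
  using integral_continuous_on_param[of "{a..b}" 0 1 F] assms by (simp add: cbox_Pair_eq)

text \<open>\<open>m\<close> dominates the area density uniformly along each ruling. The form is
  bounded only on the surface itself, so the same estimate serves for continuity with respect to a
  seminorm of order 0 and for the mass.\<close>

lemma ruled_current_le:
  assumes "\<omega> \<in> forms2" and m: "\<And>t u. t \<in> {a..b} \<Longrightarrow> u \<in> {0..1} \<Longrightarrow> \<bar>det2 (ruled' t u) (c1 t - c0 t)\<bar> \<le> m t"
    and "m integrable_on {a..b}"
    and B: "\<And>t u. t \<in> {a..b} \<Longrightarrow> u \<in> {0..1} \<Longrightarrow> \<bar>\<omega> (ruled t u) e1 e2\<bar> \<le> B"
  shows "\<bar>ruled_current \<omega>\<bar> \<le> integral {a..b} m * B"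
proof -
  note cont = continuous_on_ruled_integrand[OF assms(1)]
  have "norm (ruled_current \<omega>) \<le> integral {a..b} (\<lambda>t. m t * B)"
    unfolding ruled_current_def
  proof (rule integral_norm_bound_integral)
    show "(\<lambda>t. integral {0..1} (\<lambda>u. \<omega> (ruled t u) (ruled' t u) (c1 t - c0 t))) integrable_on {a..b}"
      by (intro integrable_continuous_interval slice_integral_continuous cont)
    show "(\<lambda>t. m t * B) integrable_on {a..b}" using assms(3) by (rule integrable_on_mult_left)
    fix t assume t: "t \<in> {a..b}"
    have "norm (integral {0..1} (\<lambda>u. \<omega> (ruled t u) (ruled' t u) (c1 t - c0 t))) \<le> integral {0..1::real} (\<lambda>u. m t * B)"
    proof (rule integral_norm_bound_integral)
      show "(\<lambda>u. \<omega> (ruled t u) (ruled' t u) (c1 t - c0 t)) integrable_on {0..1}"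
        by (intro integrable_continuous_interval slice_continuous[OF cont t])
      fix u :: real assume u: "u \<in> {0..1}"
      have "\<bar>\<omega> (ruled t u) e1 e2\<bar> * \<bar>det2 (ruled' t u) (c1 t - c0 t)\<bar> \<le> B * m t"
        using m[OF t u] B[OF t u] by (intro mult_mono) auto
      then show "norm (\<omega> (ruled t u) (ruled' t u) (c1 t - c0 t)) \<le> m t * B"
        by (subst forms2_eq[OF assms(1)]) (simp add: abs_mult mult.commute)
    qed auto
    then show "norm (integral {0..1} (\<lambda>u. \<omega> (ruled t u) (ruled' t u) (c1 t - c0 t))) \<le> m t * B" by simp
  qed
  then show ?thesis by simp
qed

lemma ruled_current_currents2:
  assumes m: "\<And>t u. t \<in> {a..b} \<Longrightarrow> u \<in> {0..1} \<Longrightarrow> \<bar>det2 (ruled' t u) (c1 t - c0 t)\<bar> \<le> m t"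
    and "m integrable_on {a..b}"
  shows "ruled_current \<in> currents2"
proof (rule currents2I[of _ "(\<lambda>z. ruled (fst z) (snd z)) ` cbox (a, 0) (b, 1)" 0 "integral {a..b} m"])
  show "compact ((\<lambda>z. ruled (fst z) (snd z)) ` cbox (a, 0) (b, 1))"
    by (intro compact_continuous_image continuous_on_ruled compact_cbox)
  show "\<bar>ruled_current \<omega>\<bar> \<le> integral {a..b} m * B"
    if "\<omega> \<in> forms2" "0 \<le> B" "seminorm2_le ((\<lambda>z. ruled (fst z) (snd z)) ` cbox (a, 0) (b, 1)) 0 \<omega> B" for \<omega> B
  proof (rule ruled_current_le[OF that(1) assms])
    fix t u :: real assume "t \<in> {a..b}" "u \<in> {0..1}"
    then have "ruled t u \<in> (\<lambda>z. ruled (fst z) (snd z)) ` cbox (a, 0) (b, 1)"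
      by (intro image_eqI[of _ _ "(t, u)"]) (auto simp: cbox_Pair_eq)
    moreover have "e1 \<in> Basis" "e2 \<in> Basis" by (auto simp: axis_in_Basis_iff)
    ultimately show "\<bar>\<omega> (ruled t u) e1 e2\<bar> \<le> B"
      using that(3) unfolding seminorm2_le_def by force
  qed auto
  fix \<omega> \<eta> :: form2 and p q :: real assume \<omega>: "\<omega> \<in> forms2" and \<eta>: "\<eta> \<in> forms2"
  let ?F = "\<lambda>\<omega> t u. \<omega> (ruled t u) (ruled' t u) (c1 t - c0 t)"
  have int: "(?F \<omega> t) integrable_on {0..1}" if "t \<in> {a..b}" "\<omega> \<in> forms2" for t \<omega>
    using slice_continuous[OF continuous_on_ruled_integrand[OF that(2)] that(1)] by (rule integrable_continuous_interval)
  have int2: "(\<lambda>t. integral {0..1} (?F \<omega> t)) integrable_on {a..b}" if "\<omega> \<in> forms2" for \<omega>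
    using slice_integral_continuous[OF continuous_on_ruled_integrand[OF that]] by (rule integrable_continuous_interval)
  have "ruled_current (\<lambda>x v w. p * \<omega> x v w + q * \<eta> x v w)
     = integral {a..b} (\<lambda>t. p * integral {0..1} (?F \<omega> t) + q * integral {0..1} (?F \<eta> t))"
    unfolding ruled_current_def
  proof (rule integral_cong)
    fix t assume t: "t \<in> {a..b}"
    have i: "(\<lambda>u. p * ?F \<omega> t u) integrable_on {0..1}" "(\<lambda>u. q * ?F \<eta> t u) integrable_on {0..1}"
      using int[OF t \<omega>] int[OF t \<eta>] by (auto intro: integrable_on_mult_right)
    show "integral {0..1} (\<lambda>u. p * ?F \<omega> t u + q * ?F \<eta> t u) = p * integral {0..1} (?F \<omega> t) + q * integral {0..1} (?F \<eta> t)"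
      by (simp add: Henstock_Kurzweil_Integration.integral_add[OF i])
  qed
  also have "\<dots> = p * ruled_current \<omega> + q * ruled_current \<eta>"
    unfolding ruled_current_def using int2[OF \<omega>] int2[OF \<eta>]
    by (subst Henstock_Kurzweil_Integration.integral_add) (auto intro: integrable_on_mult_right)
  finally show "ruled_current (\<lambda>x v w. p * \<omega> x v w + q * \<eta> x v w) = p * ruled_current \<omega> + q * ruled_current \<eta>" .
qed

lemma mass2_ruled_current:
  assumes m: "\<And>t u. t \<in> {a..b} \<Longrightarrow> u \<in> {0..1} \<Longrightarrow> \<bar>det2 (ruled' t u) (c1 t - c0 t)\<bar> \<le> m t"
    and "m integrable_on {a..b}"
  shows "mass2 ruled_current \<le> ereal (integral {a..b} m)"
proof (rule mass2_leI)
  fix \<omega> assume \<omega>: "\<omega> \<in> forms2" "\<And>x. \<bar>\<omega> x e1 e2\<bar> \<le> 1"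
  have "\<bar>ruled_current \<omega>\<bar> \<le> integral {a..b} m * 1"
    by (rule ruled_current_le[OF \<omega>(1) assms]) (use \<omega>(2) in auto)
  then show "ruled_current \<omega> \<le> integral {a..b} m" by simp
qed

text \<open>Stokes on the parameter rectangle: the pulled-back exterior derivative is a difference
  of a \<open>t\<close>-derivative and a \<open>u\<close>-derivative, each integrated in its own
  variable after exchanging the order for the first. With these signs, subtracting the boundary from
  a curve containing \<open>c0\<close> replaces \<open>c0\<close> by \<open>c1\<close>, up to the
  two end rulings.\<close>

lemma boundary_ruled_current:
  assumes \<omega>: "\<omega> \<in> forms1"
  shows "boundary ruled_current \<omega> =
    path_current 0 1 (ruled b) (\<lambda>_. c1 b - c0 b) \<omega> - path_current 0 1 (ruled a) (\<lambda>_. c1 a - c0 a) \<omega>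
    + path_current a b c0 c0' \<omega> - path_current a b c1 c1' \<omega>"
proof -
  define P where "P t u = \<omega> (ruled t u) (c1 t - c0 t)" for t u
  define Q where "Q t u = \<omega> (ruled t u) (ruled' t u)" for t u
  define Pt where "Pt t u = frechet_derivative (\<lambda>y. \<omega> y (c1 t - c0 t)) (at (ruled t u)) (ruled' t u) + \<omega> (ruled t u) (c1' t - c0' t)" for t u
  define Qu where "Qu t u = frechet_derivative (\<lambda>y. \<omega> y (ruled' t u)) (at (ruled t u)) (c1 t - c0 t) + \<omega> (ruled t u) (c1' t - c0' t)" for t u
  have dP: "((\<lambda>t. P t u) has_vector_derivative Pt t u) (at t within {a..b})" if "t \<in> {a..b}" for t u
    unfolding P_def Pt_def using c0 c1 that
    by (intro has_vector_derivative_form1 \<omega>)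
       (auto simp: ruled_def[abs_def] ruled'_def C1_path_def intro!: derivative_eq_intros)
  have dQ: "((\<lambda>u. Q t u) has_vector_derivative Qu t u) (at u within {0..1})" for t u
    unfolding Q_def Qu_def
    by (intro has_vector_derivative_form1 \<omega>) (auto simp: ruled_def[abs_def] ruled'_def[abs_def] intro!: derivative_eq_intros)
  \<comment> \<open>The terms with the mixed second derivative \<open>c1' t - c0' t\<close> occur in
    both and cancel.\<close>
  have diff: "ext_deriv \<omega> (ruled t u) (ruled' t u) (c1 t - c0 t) = Pt t u - Qu t u" for t u
    by (simp add: ext_deriv_def Pt_def Qu_def)
  have cont_D: "continuous_on (cbox (a, 0) (b, 1)) (\<lambda>z. frechet_derivative (\<lambda>y. \<omega> y (V z)) (at (ruled (fst z) (snd z))) (W z))"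
    if "continuous_on (cbox (a, 0) (b, 1)) V" "continuous_on (cbox (a, 0) (b, 1)) W" for V W
    by (subst frechet_derivative_form1[OF \<omega>]) (intro continuous_intros continuous_on_ruled that
        continuous_on_compose2[OF smooth_continuous_on[OF smooth_frechet_derivative[OF forms1_smooth[OF \<omega>]], of UNIV]]; simp)
  have cont: "continuous_on (cbox (a, 0) (b, 1)) (\<lambda>(t, u). Pt t u)" "continuous_on (cbox (a, 0) (b, 1)) (\<lambda>(t, u). Qu t u)"
    unfolding Pt_def Qu_def case_prod_beta
    by (intro continuous_on_add cont_D continuous_on_form1 \<omega> continuous_on_ruled continuous_on_diff continuous_paths)+
  have "boundary ruled_current \<omega> = integral {a..b} (\<lambda>t. integral {0..1} (\<lambda>u. Pt t u - Qu t u))"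
    unfolding boundary_def ruled_current_def diff ..
  also have "\<dots> = integral {a..b} (\<lambda>t. integral {0..1} (Pt t) - integral {0..1} (Qu t))"
    by (intro integral_cong Henstock_Kurzweil_Integration.integral_diff integrable_continuous_interval slice_continuous cont)
  also have "\<dots> = integral {a..b} (\<lambda>t. integral {0..1} (Pt t)) - integral {a..b} (\<lambda>t. integral {0..1} (Qu t))"
    by (intro Henstock_Kurzweil_Integration.integral_diff integrable_continuous_interval slice_integral_continuous cont)
  also have "integral {a..b} (\<lambda>t. integral {0..1} (Pt t)) = integral {0..1} (\<lambda>u. integral {a..b} (\<lambda>t. Pt t u))"
    using integral_swap_continuous[OF cont(1)] by simp
  also have "\<dots> = integral {0..1} (\<lambda>u. P b u - P a u)"
    by (intro integral_cong integral_unique fundamental_theorem_of_calculus C1_path_le dP)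
  also have "\<dots> = integral {0..1} (P b) - integral {0..1} (P a)"
  proof -
    have "continuous_on {0..1} (P t)" for t
      unfolding P_def ruled_def by (intro continuous_on_form1 \<omega> continuous_intros)
    then show ?thesis
      by (intro Henstock_Kurzweil_Integration.integral_diff integrable_continuous_interval)
  qed
  also have "integral {a..b} (\<lambda>t. integral {0..1} (Qu t)) = integral {a..b} (\<lambda>t. Q t 1 - Q t 0)"
    by (intro integral_cong integral_unique fundamental_theorem_of_calculus dQ) auto
  also have "\<dots> = integral {a..b} (\<lambda>t. Q t 1) - integral {a..b} (\<lambda>t. Q t 0)"
  proof -
    have "continuous_on {a..b} (\<lambda>t. Q t u)" for u
      unfolding Q_def ruled_def ruled'_def using C1_path_continuous[OF c0] C1_path_continuous[OF c1] c0 c1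
      by (intro continuous_on_form1 \<omega> continuous_intros) (auto simp: C1_path_def)
    then show ?thesis
      by (intro Henstock_Kurzweil_Integration.integral_diff integrable_continuous_interval)
  qed
  finally show ?thesis
    by (simp add: path_current_def P_def[abs_def] Q_def ruled_def ruled'_def)
qed

end

section \<open>Minimal curves\<close>

text \<open>The integral over a window of length \<open>L\<close> has derivative f(x + L) - f(x) = 0
  in its starting point.\<close>

lemma integral_periodic:
  fixes f :: "real \<Rightarrow> real"
  assumes cont: "continuous_on UNIV f" and per: "\<And>t. f (t + L) = f t" and "L \<ge> 0"
  shows "integral {\<tau>..\<tau> + L} f = integral {0..L} f"
proof -
  \<comment> \<open>The margins of 1 place both 0 and \<tau> inside the open interval on which the
    window integral is differentiated.\<close>
  define m where "m = min 0 \<tau> - 1"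
  define M where "M = max 0 \<tau> + L + 1"
  define F where "F x = integral {m..x} f" for x
  have cont': "continuous_on S f" for S using cont continuous_on_subset by blast
  have dF: "(F has_real_derivative f x) (at x)" if "m < x" "x < M" for x
    using integral_has_real_derivative[OF cont', of x m M] that
    by (simp add: F_def[abs_def] at_within_Icc_at)
  have "((\<lambda>x. F (x + L) - F x) has_real_derivative f (x + L) - f x) (at x)" if "x \<in> {m<..<M - L}" for x
    using that \<open>L \<ge> 0\<close> by (intro DERIV_diff DERIV_shift[THEN iffD1] dF) auto
  then have "\<exists>c. \<forall>x\<in>{m<..<M - L}. F (x + L) - F x = c"
    by (intro has_field_derivative_zero_constant)
       (auto simp: per intro: has_field_derivative_at_within)
  then obtain c where "\<And>x. x \<in> {m<..<M - L} \<Longrightarrow> F (x + L) - F x = c" by blast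
  moreover have "\<tau> \<in> {m<..<M - L}" "0 \<in> {m<..<M - L}" by (auto simp: m_def M_def min_def max_def)
  ultimately have "F (\<tau> + L) - F \<tau> = F (0 + L) - F 0" by metis
  moreover have "integral {x..x + L} f = F (x + L) - F x" if "m < x" for x
    using Henstock_Kurzweil_Integration.integral_combine[of m x "x + L" f] that \<open>L \<ge> 0\<close> integrable_continuous_interval[OF cont']
    by (simp add: F_def)
  from this[of \<tau>] this[of 0] have "integral {\<tau>..\<tau> + L} f = F (\<tau> + L) - F \<tau>" "integral {0..L} f = F (0 + L) - F 0"
    by (auto simp: m_def)
  ultimately show ?thesis by simp
qed

section \<open>Elementary inequalities and a test function for the variation\<close>

lemma norm_diff_le_quadratic:
  fixes X :: "real \<Rightarrow> real^2"
  assumes "\<And>x. x \<in> {0..h} \<Longrightarrow> (X has_vector_derivative X' x) (at x within {0..h})"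
    and "\<And>x. x \<in> {0..h} \<Longrightarrow> norm (X' x) \<le> k * x" and "h \<ge> 0"
  shows "norm (X h - X 0) \<le> k * h\<^sup>2 / 2"
proof -
  have "((\<lambda>x. k * x) has_integral k * h\<^sup>2 / 2 - k * 0\<^sup>2 / 2) {0..h}"
    by (intro fundamental_theorem_of_calculus assms)
       (auto intro!: derivative_eq_intros simp flip: has_real_derivative_iff_has_vector_derivative)
  then show ?thesis
    using integral_norm_bound_integral[of X' "{0..h}" "\<lambda>x. k * x"] assms
      fundamental_theorem_of_calculus[of 0 h X X']
    by (auto simp: has_integral_iff)
qed

text \<open>From 2 n <= n^2 + 1 for the norm n of the sum. The linear term is the exact first
  variation of length; the quadratic one disappears in the limit of small pushes.\<close>

lemma norm_add_scaleR_le: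
  fixes v e :: "real^2"
  assumes "norm v = 1" "norm e = 1"
  shows "norm (v + s *\<^sub>R e) \<le> 1 + s * (v \<bullet> e) + s\<^sup>2 / 2"
proof -
  have *: "(norm (v + s *\<^sub>R e))\<^sup>2 = 1 + 2 * s * (v \<bullet> e) + s\<^sup>2"
    unfolding power2_norm_eq_inner using assms
    by (simp add: inner_add inner_commute norm_eq_1 power2_eq_square algebra_simps)
  have "2 * norm (v + s *\<^sub>R e) \<le> (norm (v + s *\<^sub>R e))\<^sup>2 + 1"
    using zero_le_power2[of "norm (v + s *\<^sub>R e) - 1"] by (simp add: power2_diff)
  then show ?thesis unfolding * by simp
qed

text \<open>A monotone \<open>C\<^sup>1\<close> step whose derivative is a tent of half-width \<open>h\<close>. The difference of two
  translates is a nonnegative test function for the first variation.\<close>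

definition tent_primitive :: "real \<Rightarrow> real \<Rightarrow> real" where
  "tent_primitive h y = (max 0 (y + h))\<^sup>2 - 2 * (max 0 y)\<^sup>2 + (max 0 (y - h))\<^sup>2"

lemma has_real_derivative_max_0_sq: "((\<lambda>y::real. (max 0 y)\<^sup>2) has_real_derivative 2 * max 0 y) (at y)"
proof -
  consider "y > 0" | "y < 0" | "y = 0" by linarith
  then show ?thesis
  proof cases
    case 1
    have "((\<lambda>y. y\<^sup>2) has_real_derivative 2 * max 0 y) (at y)"
      using 1 by (auto intro!: derivative_eq_intros)
    then show ?thesis
      by (rule has_field_derivative_transform_within_open[where S = "{0<..}"]) (use 1 in auto)
  next
    case 2
    have "((\<lambda>y. 0) has_real_derivative 2 * max 0 y) (at y)" using 2 by simp
    then show ?thesis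
      by (rule has_field_derivative_transform_within_open[where S = "{..<0}"]) (use 2 in auto)
  next
    case 3
    have "((\<lambda>h::real. (max 0 h)\<^sup>2 / h) \<longlongrightarrow> 0) (at 0)"
    proof (rule Lim_null_comparison)
      show "\<forall>\<^sub>F h in at 0. norm ((max 0 h)\<^sup>2 / h) \<le> \<bar>h\<bar>"
        by (auto simp: eventually_at_filter power2_eq_square max_def)
      show "((\<lambda>h::real. \<bar>h\<bar>) \<longlongrightarrow> 0) (at 0)" using tendsto_rabs_zero[OF tendsto_ident_at] by simp
    qed
    then show ?thesis using 3 by (simp add: has_field_derivative_iff)
  qed
qed

lemma has_real_derivative_tent_primitive:
  assumes "h \<ge> 0"
  shows "(tent_primitive h has_real_derivative 2 * max 0 (h - \<bar>y\<bar>)) (at y)"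
proof -
  have "((\<lambda>y. (max 0 (y + c))\<^sup>2) has_real_derivative 2 * max 0 (y + c)) (at y)" for c
    using DERIV_shift[THEN iffD1, OF has_real_derivative_max_0_sq] .
  from DERIV_add[OF DERIV_diff[OF this[of h] DERIV_cmult[OF this[of 0], of 2]] this[of "- h"]]
  have "(tent_primitive h has_real_derivative 2 * max 0 (y + h) - 2 * (2 * max 0 y) + 2 * max 0 (y - h)) (at y)"
    by (simp add: tent_primitive_def[abs_def])
  moreover have "2 * max 0 (y + h) - 2 * (2 * max 0 y) + 2 * max 0 (y - h) = 2 * max 0 (h - \<bar>y\<bar>)"
    using assms by (auto simp: max_def abs_if)
  ultimately show ?thesis by simp
qed

lemma tent_primitive_mono: "h \<ge> 0 \<Longrightarrow> x \<le> y \<Longrightarrow> tent_primitive h x \<le> tent_primitive h y"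
  by (rule DERIV_nonneg_imp_nondecreasing) (auto intro!: exI has_real_derivative_tent_primitive)

lemma path_current_const_le:
  assumes "\<And>x v. \<bar>\<omega> x v\<bar> \<le> norm v" "\<omega> \<in> forms1" "continuous_on {0..1} c"
  shows "\<bar>path_current 0 1 c (\<lambda>_. v) \<omega>\<bar> \<le> norm v"
proof -
  have "norm (integral {0..1} (\<lambda>t. \<omega> (c t) v)) \<le> integral {0..1::real} (\<lambda>t. norm v)"
    using assms(1) by (intro integral_norm_bound_integral integrable_continuous_interval
        continuous_on_form1[OF assms(2,3)] continuous_on_const) auto
  then show ?thesis by (simp add: path_current_def)
qed

text \<open>What the geometry needs to know about \<Gamma>: a simple closed arc-length curve
  together with the comparison inequality. Parametrizing periodically over the whole line lets arcs
  straddle the base point.\<close>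

locale minimal_curve =
  fixes lam L :: real and g g' :: "real \<Rightarrow> real^2"
  assumes lam: "lam > 0" and L: "L > 0"
    and deriv: "\<And>t. (g has_vector_derivative g' t) (at t)"
    and unit: "\<And>t. norm (g' t) = 1"
    and cont: "continuous_on UNIV g'"
    and periodic: "\<And>t. g (t + L) = g t"
    and inj: "inj_on g {0..<L}"
    and minimal: "\<And>R. R \<in> currents2 \<Longrightarrow> mass1 (path_current 0 L g g')
      \<le> mass1 (\<lambda>\<omega>. path_current 0 L g g' \<omega> - boundary R \<omega>) + ereal lam * mass2 R"
begin

lemma cont_g: "continuous_on S g"
  by (meson deriv continuous_at_imp_continuous_on has_vector_derivative_continuous)

lemma cont_g': "continuous_on S g'"
  using cont continuous_on_subset by blast

lemma periodic': "g' (t + L) = g' t"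
proof -
  have "((\<lambda>t. g (t + L)) has_vector_derivative g' (t + L)) (at t)"
  proof -
    have "((\<lambda>t. t + L) has_vector_derivative 1) (at t)"
      unfolding has_real_derivative_iff_has_vector_derivative[symmetric] by (auto intro!: derivative_eq_intros)
    from vector_diff_chain_at[OF this deriv] show ?thesis by (simp add: o_def)
  qed
  then show ?thesis using deriv[of t] by (simp add: periodic vector_derivative_unique_at)
qed

lemma C1_path_g: "a \<le> b \<Longrightarrow> C1_path a b g g'"
  by (auto simp: C1_path_def deriv cont_g' intro: has_vector_derivative_at_within)

lemma path_current_period:
  assumes "\<omega> \<in> forms1"
  shows "path_current 0 L g g' \<omega> = path_current \<tau> (\<tau> + L) g g' \<omega>"
  unfolding path_current_def
  by (rule integral_periodic[symmetric])
     (use L in \<open>auto simp: periodic periodic' intro: continuous_on_form1[OF assms cont_g cont_g']\<close>)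

lemma path_current_combine:
  assumes "\<omega> \<in> forms1" "a \<le> b" "b \<le> c"
  shows "path_current a c g g' \<omega> = path_current a b g g' \<omega> + path_current b c g g' \<omega>"
  unfolding path_current_def using assms
  by (intro Henstock_Kurzweil_Integration.integral_combine[symmetric] integrable_continuous_interval
      continuous_on_form1 cont_g cont_g') auto

lemma path_current_le:
  assumes "\<omega> \<in> forms1" "\<And>x v. \<bar>\<omega> x v\<bar> \<le> norm v" "a \<le> b"
  shows "path_current a b g g' \<omega> \<le> b - a"
proof -
  have "\<omega> (g t) (g' t) \<le> 1" for t
    using assms(2)[of "g t" "g' t"] unit[of t] by simp
  then have "integral {a..b} (\<lambda>t. \<omega> (g t) (g' t)) \<le> integral {a..b} (\<lambda>t. 1)"
    by (intro integral_le integrable_continuous_interval continuous_on_form1[OF assms(1) cont_g cont_g'] continuous_on_const)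
  then show ?thesis using assms(3) by (simp add: path_current_def)
qed

text \<open>On the compact period interval, preimages of closed sets under the field are images
  under \<open>g\<close> of compact sets, hence closed. The endpoint \<open>L\<close> is covered
  because \<open>g\<close> and \<open>g'\<close> have the same values there as at 0.\<close>

lemma tangent_field:
  obtains V where "continuous_on (g ` {0..L}) V" "\<And>t. t \<in> {0..L} \<Longrightarrow> V (g t) = g' t"
proof
  define V where "V = (\<lambda>x. g' (inv_into {0..<L} g x))"
  show V: "V (g t) = g' t" if "t \<in> {0..L}" for t
  proof (cases "t = L")
    case True
    then show ?thesis
      using inv_into_f_f[OF inj, of 0] periodic[of 0] periodic'[of 0] L by (simp add: V_def)
  next
    case False
    then show ?thesis using inv_into_f_f[OF inj, of t] that by (simp add: V_def)
  qed
  show "continuous_on (g ` {0..L}) V"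
    unfolding continuous_closedin_preimage_eq
  proof safe
    fix C :: "(real^2) set" assume "closed C"
    have eq: "g ` {0..L} \<inter> V -` C = g ` ({0..L} \<inter> g' -` C)" using V by auto
    have "closed (g' -` C)"
      using \<open>closed C\<close> cont continuous_closed_vimage by (metis continuous_on_eq_continuous_at iso_tuple_UNIV_I open_UNIV)
    then have "compact ({0..L} \<inter> g' -` C)" by (intro compact_Int_closed) auto
    then have "closed (g ` ({0..L} \<inter> g' -` C))"
      by (intro compact_imp_closed compact_continuous_image cont_g)
    then show "closedin (top_of_set (g ` {0..L})) (g ` {0..L} \<inter> V -` C)"
      unfolding eq by (intro closed_subset) auto
  qed
qed

text \<open>An approximate calibration: a smooth form of comass at most 1 that almost equals 1 on
  the unit tangent. It comes from a polynomial approximation of the tangent field on the image,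
  which extends to the plane for free.\<close>

lemma mass1_ge_length: "mass1 (path_current 0 L g g') \<ge> ereal L"
proof -
  obtain V where V: "continuous_on (g ` {0..L}) V" "\<And>t. t \<in> {0..L} \<Longrightarrow> V (g t) = g' t"
    using tangent_field by blast
  have key: "ereal (L - 3 * L * e) \<le> mass1 (path_current 0 L g g')" if e: "0 < e" "e < 1" for e
  proof -
    obtain p where p: "polynomial_function p" "\<And>x. x \<in> g ` {0..L} \<Longrightarrow> norm (V x - p x) < e"
      using Stone_Weierstrass_polynomial_function[OF compact_continuous_image[OF cont_g compact_Icc] V(1) e(1)] by blast
    have sm: "smooth (\<lambda>x. p x $ i)" for i :: 2
    proof -
      have "real_polynomial_function ((\<lambda>x. x $ i) \<circ> p)"
        using p(1) bounded_linear_vec_nth unfolding polynomial_function_def by blast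
      then show ?thesis by (intro smooth_real_polynomial_function) (simp add: o_def)
    qed
    \<comment> \<open>Normalising by the square root of e^2 + |p|^2 instead of |p| keeps the factor
      smooth where the polynomial field vanishes and still bounds the comass by 1. On the curve it
      changes the value only by terms of order e.\<close>
    define n where "n = (\<lambda>x. (e\<^sup>2 + ((p x $ 1)\<^sup>2 + (p x $ 2)\<^sup>2)) powr (- (1 / 2)))"
    have smn: "smooth n"
      unfolding n_def power2_eq_square
      by (rule smooth_powr, rule smooth_add[OF smooth_const smooth_add[OF smooth_mult[OF sm sm] smooth_mult[OF sm sm]]])
         (use e in \<open>simp add: add_pos_nonneg\<close>)
    have n_eq: "n x = 1 / sqrt (e\<^sup>2 + (norm (p x))\<^sup>2)" for x
    proof -
      have "(norm (p x))\<^sup>2 = (p x $ 1)\<^sup>2 + (p x $ 2)\<^sup>2"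
        unfolding power2_norm_eq_inner inner_2 by (simp add: power2_eq_square)
      then show ?thesis
        unfolding n_def by (subst powr_minus, subst powr_half_sqrt) (simp_all add: inverse_eq_divide)
    qed
    define \<omega> where "\<omega> = (\<lambda>x (v::real^2). (n x * p x $ 1) * v $ 1 + (n x * p x $ 2) * v $ 2)"
    have \<omega>: "\<omega> \<in> forms1" unfolding \<omega>_def by (intro forms1I smooth_mult smn sm)
    have \<omega>_eq: "\<omega> x v = n x * (p x \<bullet> v)" for x v by (simp add: \<omega>_def inner_2 algebra_simps)
    have "\<omega> x v \<le> 1" if "norm v \<le> 1" for x v
    proof -
      have "p x \<bullet> v \<le> norm (p x) * 1"
        using norm_cauchy_schwarz[of "p x" v] mult_left_mono[OF that, of "norm (p x)"] by simp
      also have "\<dots> \<le> sqrt (e\<^sup>2 + (norm (p x))\<^sup>2)" by (intro real_le_rsqrt) simp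
      finally show ?thesis using e by (simp add: \<omega>_eq n_eq divide_le_eq add_pos_nonneg)
    qed
    with \<omega> have "ereal (path_current 0 L g g' \<omega>) \<le> mass1 (path_current 0 L g g')" by (rule mass1_ge)
    moreover have "L - 3 * L * e \<le> path_current 0 L g g' \<omega>"
    proof -
      have "1 - 3 * e \<le> \<omega> (g t) (g' t)" if t: "t \<in> {0..L}" for t
      proof -
        have d: "norm (g' t - p (g t)) < e" using p(2)[of "g t"] V(2)[OF t] t by auto
        have "(g' t - p (g t)) \<bullet> g' t \<le> norm (g' t - p (g t)) * norm (g' t)" by (rule norm_cauchy_schwarz)
        moreover have "g' t \<bullet> g' t = 1" using unit[of t] by (simp add: norm_eq_1)
        ultimately have num: "1 - e \<le> p (g t) \<bullet> g' t" using d unit[of t] by (simp add: inner_diff_left)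
        have "norm (p (g t)) \<le> 1 + e"
          using norm_triangle_ineq2[of "p (g t)" "g' t"] d unit[of t] by (simp add: norm_minus_commute)
        then have "e\<^sup>2 + (norm (p (g t)))\<^sup>2 \<le> e\<^sup>2 + (1 + e)\<^sup>2" by (intro add_left_mono power_mono) auto
        also have "\<dots> \<le> (1 + 2 * e)\<^sup>2" using e by (simp add: power2_eq_square algebra_simps)
        finally have den: "sqrt (e\<^sup>2 + (norm (p (g t)))\<^sup>2) \<le> 1 + 2 * e" using e by (intro real_le_lsqrt) auto
        have pos: "sqrt (e\<^sup>2 + (norm (p (g t)))\<^sup>2) > 0" using e by (simp add: add_pos_nonneg)
        have "(1 - 3 * e) * (1 + 2 * e) \<le> 1 - e" using e by (simp add: algebra_simps)
        then have "1 - 3 * e \<le> (1 - e) / (1 + 2 * e)" using e by (simp add: pos_le_divide_eq)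
        also have "\<dots> \<le> (1 - e) / sqrt (e\<^sup>2 + (norm (p (g t)))\<^sup>2)"
          using e den pos by (intro divide_left_mono) auto
        also have "\<dots> \<le> p (g t) \<bullet> g' t / sqrt (e\<^sup>2 + (norm (p (g t)))\<^sup>2)"
          using num pos by (intro divide_right_mono) auto
        finally show ?thesis by (simp add: \<omega>_eq n_eq)
      qed
      then have "integral {0..L} (\<lambda>t. 1 - 3 * e) \<le> integral {0..L} (\<lambda>t. \<omega> (g t) (g' t))"
        by (intro integral_le integrable_continuous_interval continuous_on_form1[OF \<omega> cont_g cont_g'] continuous_on_const)
      then show ?thesis using L by (simp add: path_current_def algebra_simps)
    qed
    ultimately show ?thesis using order_trans ereal_less_eq(3) by blast
  qed
  show ?thesis
  proof (rule ereal_le_epsilon2)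
    fix \<epsilon> :: real assume "\<epsilon> > 0"
    define e where "e = min (1 / 2) (\<epsilon> / (3 * L))"
    have "0 < e" "e < 1" using \<open>\<epsilon> > 0\<close> L by (auto simp: e_def)
    moreover have "3 * L * e \<le> \<epsilon>"
      using L mult_left_mono[OF min.cobounded2[of "1 / 2" "\<epsilon> / (3 * L)"], of "3 * L"] by (simp add: e_def)
    then have "ereal L \<le> ereal (L - 3 * L * e) + ereal \<epsilon>" by simp
    ultimately show "ereal L \<le> mass1 (path_current 0 L g g') + ereal \<epsilon>"
      using key[of e] by (meson add_right_mono order_trans)
  qed
qed

text \<open>The comparison inequality in numbers: \<open>l\<close> bounds what is left of the curve
  once \<open>c0\<close> is exchanged for \<open>c1\<close>, the two norms are the lengths of the
  end rulings, and the integral bounds the swept area.\<close>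

lemma ruled_competitor:
  assumes c: "C1_path a b c0 c0'" "C1_path a b c1 c1'"
    and m: "\<And>t u. t \<in> {a..b} \<Longrightarrow> u \<in> {0..1} \<Longrightarrow>
      \<bar>det2 (c0' t + u *\<^sub>R (c1' t - c0' t)) (c1 t - c0 t)\<bar> \<le> m t"
    and "m integrable_on {a..b}"
    and le: "\<And>\<omega>. \<omega> \<in> forms1 \<Longrightarrow> (\<And>x v. \<bar>\<omega> x v\<bar> \<le> norm v) \<Longrightarrow>
      path_current 0 L g g' \<omega> - path_current a b c0 c0' \<omega> + path_current a b c1 c1' \<omega> \<le> l"
  shows "L \<le> l + norm (c1 a - c0 a) + norm (c1 b - c0 b) + lam * integral {a..b} m"
proof -
  let ?R = "ruled_current a b c0 c0' c1 c1'"
  note m' = m[folded ruled'_def[OF c]]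
  have R: "?R \<in> currents2" "mass2 ?R \<le> ereal (integral {a..b} m)"
    by (rule ruled_current_currents2[OF c m' assms(4)] mass2_ruled_current[OF c m' assms(4)]; assumption)+
  have "mass1 (\<lambda>\<omega>. path_current 0 L g g' \<omega> - boundary ?R \<omega>) \<le> ereal (l + norm (c1 a - c0 a) + norm (c1 b - c0 b))"
  proof (rule mass1_leI)
    fix \<omega> assume \<omega>: "\<omega> \<in> forms1" "\<And>x v. \<bar>\<omega> x v\<bar> \<le> norm v"
    have "continuous_on {0..1} (ruled c0 c1 t)" for t
      unfolding ruled_def[OF c] by (intro continuous_intros)
    from path_current_const_le[OF \<omega>(2,1) this[of a], of "c1 a - c0 a"] path_current_const_le[OF \<omega>(2,1) this[of b], of "c1 b - c0 b"]
      boundary_ruled_current[OF c \<omega>(1)] le[OF \<omega>]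
    show "path_current 0 L g g' \<omega> - boundary ?R \<omega> \<le> l + norm (c1 a - c0 a) + norm (c1 b - c0 b)" by linarith
  qed
  moreover have "ereal lam * mass2 ?R \<le> ereal lam * ereal (integral {a..b} m)"
    using lam R(2) by (intro ereal_mult_left_mono) auto
  ultimately have "mass1 (path_current 0 L g g')
      \<le> ereal (l + norm (c1 a - c0 a) + norm (c1 b - c0 b)) + ereal lam * ereal (integral {a..b} m)"
    using minimal[OF R(1)] by (meson add_mono order_trans)
  with mass1_ge_length have "ereal L \<le> ereal (l + norm (c1 a - c0 a) + norm (c1 b - c0 b)) + ereal lam * ereal (integral {a..b} m)"
    by (rule order_trans)
  then show ?thesis by simp
qed

end

section \<open>The first variation and the curvature bound\<close>

context minimal_curve
begin

lemma remove_arc: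
  assumes "\<omega> \<in> forms1" "\<And>x v. \<bar>\<omega> x v\<bar> \<le> norm v" "a \<le> b" "b \<le> a + L"
  shows "path_current 0 L g g' \<omega> - path_current a b g g' \<omega> \<le> L - (b - a)"
  using path_current_le[OF assms(1,2,4)] path_current_combine[OF assms(1,3,4)] path_current_period[OF assms(1), of a]
  by simp

lemma remove_two_arcs:
  assumes "\<omega> \<in> forms1" "\<And>x v. \<bar>\<omega> x v\<bar> \<le> norm v" "a \<le> b" "b \<le> c" "c \<le> d" "d \<le> a + L"
  shows "path_current 0 L g g' \<omega> - path_current a b g g' \<omega> - path_current c d g g' \<omega> \<le> L - (b - a) - (d - c)"
  using path_current_le[OF assms(1,2), of b c] path_current_le[OF assms(1,2), of d "a + L"]
    path_current_combine[OF assms(1), of a b "a + L"] path_current_combine[OF assms(1), of b c "a + L"]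
    path_current_combine[OF assms(1), of c d "a + L"] path_current_period[OF assms(1), of a] assms(3-)
  by simp

text \<open>Push the arc by \<open>\<eta> * \<phi> t\<close> in the constant direction
  \<open>e\<close>. The rulings are parallel to \<open>e\<close>, so the swept area is at most
  \<eta> times the integral of \<phi>, and the end rulings vanish with \<phi>. Length changes by
  \<eta> times the first integral plus a term of order \<eta>^2; divide by \<eta> and let it tend to
  0 from the right. Nonnegativity of \<phi> keeps the area linear without absolute values, and the
  sign of the push is left to the choice of \<open>e\<close>.\<close>

lemma first_variation:
  assumes "a \<le> b" "b \<le> a + L" "norm e = 1"
    and \<phi>: "\<And>t. (\<phi> has_real_derivative \<phi>' t) (at t)" "continuous_on UNIV \<phi>'" "\<phi> a = 0" "\<phi> b = 0"
      "\<And>t. t \<in> {a..b} \<Longrightarrow> \<phi> t \<ge> 0"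
  shows "0 \<le> integral {a..b} (\<lambda>t. \<phi>' t * (g' t \<bullet> e)) + lam * integral {a..b} \<phi>"
proof -
  have cont': "continuous_on {a..b} \<phi>'" using \<phi>(2) continuous_on_subset by blast
  have cont: "continuous_on {a..b} \<phi>" by (meson \<phi>(1) DERIV_isCont continuous_at_imp_continuous_on)
  define I where "I = integral {a..b} (\<lambda>t. \<phi>' t * (g' t \<bullet> e))"
  define J where "J = integral {a..b} (\<lambda>t. (\<phi>' t)\<^sup>2 / 2)"
  define K where "K = integral {a..b} \<phi>"
  have int: "(\<lambda>t. \<phi>' t * (g' t \<bullet> e)) integrable_on {a..b}" "(\<lambda>t. (\<phi>' t)\<^sup>2 / 2) integrable_on {a..b}"
      "\<phi> integrable_on {a..b}"
    by (intro integrable_continuous_interval continuous_intros cont cont' cont_g'; simp)+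
  have "0 \<le> I + lam * K + \<eta> * J" if "\<eta> > 0" for \<eta>
  proof -
    define c where "c t = g t + (\<eta> * \<phi> t) *\<^sub>R e" for t
    define c' where "c' t = g' t + (\<eta> * \<phi>' t) *\<^sub>R e" for t
    have "((\<lambda>t. (\<eta> * \<phi> t) *\<^sub>R e) has_vector_derivative (\<eta> * \<phi>' t) *\<^sub>R e) (at t)" for t
      using has_vector_derivative_scaleR[OF DERIV_cmult[OF \<phi>(1), of \<eta> t] has_vector_derivative_const[of e]] by simp
    then have "(c has_vector_derivative c' t) (at t)" for t
      unfolding c_def[abs_def] c'_def by (intro has_vector_derivative_add deriv)
    moreover have cont_c': "continuous_on {a..b} c'"
      unfolding c'_def[abs_def] by (intro continuous_intros cont_g' cont')
    ultimately have c: "C1_path a b c c'"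
      using assms(1) has_vector_derivative_at_within unfolding C1_path_def by blast
    define l where "l = L - (b - a) + integral {a..b} (\<lambda>t. 1 + \<eta> * (\<phi>' t * (g' t \<bullet> e)) + \<eta>\<^sup>2 * ((\<phi>' t)\<^sup>2 / 2))"
    have "L \<le> l + norm (c a - g a) + norm (c b - g b) + lam * integral {a..b} (\<lambda>t. \<eta> * \<phi> t)"
    proof (rule ruled_competitor[OF C1_path_g[OF assms(1)] c])
      fix t u assume t: "t \<in> {a..b}"
      have "det2 (g' t + u *\<^sub>R (c' t - g' t)) (c t - g t) = \<eta> * \<phi> t * det2 (g' t) e"
        by (simp add: det2_def c_def c'_def algebra_simps)
      moreover have "\<bar>det2 (g' t) e\<bar> \<le> 1" using abs_det2_le[of "g' t" e] unit assms(3) by simp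
      ultimately show "\<bar>det2 (g' t + u *\<^sub>R (c' t - g' t)) (c t - g t)\<bar> \<le> \<eta> * \<phi> t"
        using \<open>\<eta> > 0\<close> \<phi>(5)[OF t] by (simp add: abs_mult mult_left_le)
    next
      show "(\<lambda>t. \<eta> * \<phi> t) integrable_on {a..b}" using int(3) by (rule integrable_on_mult_right)
    next
      fix \<omega> assume \<omega>: "\<omega> \<in> forms1" "\<And>x v. \<bar>\<omega> x v\<bar> \<le> norm v"
      have "\<omega> (c t) (c' t) \<le> 1 + \<eta> * (\<phi>' t * (g' t \<bullet> e)) + \<eta>\<^sup>2 * ((\<phi>' t)\<^sup>2 / 2)" for t
        using \<omega>(2)[of "c t" "c' t"] norm_add_scaleR_le[OF unit assms(3), of t "\<eta> * \<phi>' t"]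
        by (simp add: c'_def power_mult_distrib mult.assoc)
      then have "path_current a b c c' \<omega> \<le> integral {a..b} (\<lambda>t. 1 + \<eta> * (\<phi>' t * (g' t \<bullet> e)) + \<eta>\<^sup>2 * ((\<phi>' t)\<^sup>2 / 2))"
        unfolding path_current_def
        by (intro integral_le integrable_continuous_interval continuous_on_form1[OF \<omega>(1) C1_path_continuous[OF c] cont_c']
            continuous_intros cont_g' cont'; simp)
      then show "path_current 0 L g g' \<omega> - path_current a b g g' \<omega> + path_current a b c c' \<omega> \<le> l"
        using remove_arc[OF \<omega> assms(1,2)] by (simp add: l_def)
    qed
    moreover have "integral {a..b} (\<lambda>t. 1 + \<eta> * (\<phi>' t * (g' t \<bullet> e)) + \<eta>\<^sup>2 * ((\<phi>' t)\<^sup>2 / 2)) = (b - a) + \<eta> * I + \<eta>\<^sup>2 * J"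
    proof (rule integral_unique)
      have "((\<lambda>t. 1) has_integral (b - a)) {a..b}" using has_integral_const_real[of "1::real" a b] assms(1) by simp
      then show "((\<lambda>t. 1 + \<eta> * (\<phi>' t * (g' t \<bullet> e)) + \<eta>\<^sup>2 * ((\<phi>' t)\<^sup>2 / 2)) has_integral (b - a) + \<eta> * I + \<eta>\<^sup>2 * J) {a..b}"
        unfolding I_def J_def by (intro has_integral_add has_integral_mult_right integrable_integral int)
    qed
    ultimately have "0 \<le> \<eta> * I + \<eta>\<^sup>2 * J + lam * (\<eta> * K)"
      by (simp add: l_def c_def \<phi>(3,4) K_def)
    also have "\<dots> = \<eta> * (I + lam * K + \<eta> * J)" by (simp add: power2_eq_square algebra_simps)
    finally show ?thesis using \<open>\<eta> > 0\<close> by (simp add: zero_le_mult_iff)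
  qed
  moreover have "((\<lambda>\<eta>. I + lam * K + \<eta> * J) \<longlongrightarrow> I + lam * K + 0 * J) (at_right 0)"
    by (intro tendsto_intros)
  ultimately have "0 \<le> I + lam * K + 0 * J"
    by (intro tendsto_lowerbound) (auto simp: eventually_at_filter)
  then show ?thesis by (simp add: I_def K_def)
qed

text \<open>The first variation inequality says weakly that F(x) =
  \<open>g' x \<bullet> e - lam * x\<close> does not increase: integrating \<phi> by parts turns it
  into nonnegativity of the integral of \<phi>' F. Here \<phi>' is a positive tent at
  \<open>s\<close> minus an equal tent at \<open>t\<close>, so it compares averages of F near the
  two points, and no second derivative of the curve is required.\<close>

lemma inner_derivative_decreasing:
  assumes "norm e = 1" "s < t" "t < s + L"
  shows "g' t \<bullet> e - lam * t \<le> g' s \<bullet> e - lam * s"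
proof (rule ccontr)
  define F where "F x = g' x \<bullet> e - lam * x" for x
  assume "\<not> g' t \<bullet> e - lam * t \<le> g' s \<bullet> e - lam * s"
  then have less: "F s < F t" by (simp add: F_def)
  define c where "c = (F s + F t) / 2"
  have contF: "continuous_on S F" for S unfolding F_def by (intro continuous_intros cont_g')
  then have isC: "isCont F x" for x using continuous_on_interior[OF contF[of UNIV]] by simp
  have "(F \<longlongrightarrow> F x) (nhds x)" for x
    using isC[of x] by (simp add: isCont_def tendsto_at_iff_tendsto_nhds)
  then have "eventually (\<lambda>x. F x < c) (nhds s)" "eventually (\<lambda>x. F x > c) (nhds t)"
    by (rule order_tendstoD; use less in \<open>simp add: c_def\<close>)+
  then obtain d1 d2 where d: "d1 > 0" "\<And>x. dist x s < d1 \<Longrightarrow> F x < c" "d2 > 0" "\<And>x. dist x t < d2 \<Longrightarrow> c < F x"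
    unfolding eventually_nhds_metric by blast
  \<comment> \<open>The tents must stay where F is below, respectively above, the middle value
    \<open>c\<close>, and the arc from s - h to t + h may not exceed one period.\<close>
  define h where "h = min (min d1 d2) ((L - (t - s)) / 2)"
  have h: "0 < h" "h \<le> d1" "h \<le> d2" "t + h \<le> s - h + L" using assms d by (auto simp: h_def min_def field_simps)
  define \<phi> where "\<phi> x = tent_primitive h (x - s) - tent_primitive h (x - t)" for x
  define \<phi>' where "\<phi>' x = 2 * max 0 (h - \<bar>x - s\<bar>) - 2 * max 0 (h - \<bar>x - t\<bar>)" for x
  have d\<phi>: "(\<phi> has_real_derivative \<phi>' x) (at x)" for x
  proof -
    have "((\<lambda>x. tent_primitive h (x - y)) has_real_derivative 2 * max 0 (h - \<bar>x - y\<bar>)) (at x)" for y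
      using DERIV_shift[THEN iffD1, of "tent_primitive h" _ x "- y"] has_real_derivative_tent_primitive[of h "x - y"] h(1) by simp
    then show ?thesis unfolding \<phi>_def[abs_def] \<phi>'_def by (intro DERIV_diff)
  qed
  have cont': "continuous_on S \<phi>'" for S unfolding \<phi>'_def by (intro continuous_intros)
  have cont: "continuous_on S \<phi>" for S by (meson d\<phi> DERIV_isCont continuous_at_imp_continuous_on)
  have ends: "\<phi> (s - h) = 0" "\<phi> (t + h) = 0"
    using h(1) assms(2) by (simp_all add: \<phi>_def tent_primitive_def max_def power2_eq_square algebra_simps)
  have le: "s - h \<le> t + h" using h(1) assms(2) by simp
  have var: "0 \<le> integral {s - h..t + h} (\<lambda>x. \<phi>' x * (g' x \<bullet> e)) + lam * integral {s - h..t + h} \<phi>"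
  proof (rule first_variation[OF le h(4) assms(1) d\<phi> cont' ends])
    show "0 \<le> \<phi> x" for x using tent_primitive_mono[of h "x - t" "x - s"] h(1) assms(2) by (simp add: \<phi>_def)
  qed
  have ftc: "(f' has_integral f (t + h) - f (s - h)) {s - h..t + h}"
    if "\<And>x. (f has_real_derivative f' x) (at x)" for f f'
    using le that by (intro fundamental_theorem_of_calculus)
      (auto simp flip: has_real_derivative_iff_has_vector_derivative intro: has_field_derivative_at_within)
  have "((\<lambda>x. x * \<phi> x) has_real_derivative \<phi> x + x * \<phi>' x) (at x)" for x
    using DERIV_mult[OF DERIV_ident d\<phi>, of x] by (simp add: mult.commute)
  from ftc[OF this] have parts: "((\<lambda>x. \<phi> x + x * \<phi>' x) has_integral 0) {s - h..t + h}"
    by (simp add: ends)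
  from ftc[OF d\<phi>] have zero: "(\<phi>' has_integral 0) {s - h..t + h}" by (simp add: ends)
  have i: "(\<lambda>x. \<phi>' x * (g' x \<bullet> e)) integrable_on {s - h..t + h}" "\<phi> integrable_on {s - h..t + h}"
    by (intro integrable_continuous_interval continuous_intros cont cont' cont_g')+
  \<comment> \<open>\<open>G\<close> is (c - F) \<phi>'. The constant can be inserted because
    \<phi>' has integral 0. Under the contrary assumption \<open>G\<close> is nonnegative pointwise,
    while its integral is nonpositive by the first variation.\<close>
  define G where "G x = c * \<phi>' x - F x * \<phi>' x" for x
  have "((\<lambda>x. c * \<phi>' x - (\<phi>' x * (g' x \<bullet> e) + lam * \<phi> x) + lam * (\<phi> x + x * \<phi>' x)) has_integral
      c * 0 - (integral {s - h..t + h} (\<lambda>x. \<phi>' x * (g' x \<bullet> e)) + lam * integral {s - h..t + h} \<phi>) + lam * 0) {s - h..t + h}"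
    by (intro has_integral_add has_integral_diff has_integral_mult_right zero parts integrable_integral i)
  then have "(G has_integral
      - (integral {s - h..t + h} (\<lambda>x. \<phi>' x * (g' x \<bullet> e)) + lam * integral {s - h..t + h} \<phi>)) {s - h..t + h}"
    by (simp add: G_def[abs_def] F_def algebra_simps)
  with var have int_le: "integral {s - h..t + h} G \<le> 0" by (auto dest: integral_unique)
  have G_nonneg: "G x \<ge> 0" for x
  proof -
    have "0 \<le> (c - F x) * max 0 (h - \<bar>x - s\<bar>)"
      using d(2)[of x] h(2) by (cases "\<bar>x - s\<bar> < h") (auto simp: dist_real_def max_def)
    moreover have "0 \<le> (F x - c) * max 0 (h - \<bar>x - t\<bar>)"
      using d(4)[of x] h(3) by (cases "\<bar>x - t\<bar> < h") (auto simp: dist_real_def max_def)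
    ultimately show ?thesis by (simp add: G_def \<phi>'_def algebra_simps)
  qed
  have contG: "continuous_on {s - h..t + h} G" unfolding G_def by (intro continuous_intros cont' contF)
  have "integral {s - h..t + h} G \<ge> 0"
    by (intro integral_nonneg integrable_continuous_interval contG G_nonneg)
  with int_le have "\<forall>x\<in>{s - h..t + h}. G x = 0"
    using integral_eq_0_iff[OF contG] G_nonneg h(1) assms(2) by auto
  then have "G s = 0" using h(1) assms(2) by simp
  moreover have "G s > 0"
  proof -
    have "0 < c - F s" using less by (simp add: c_def)
    \<comment> \<open>The two tents may overlap, but the one centred at \<open>t\<close> has not
      reached its full height at \<open>s\<close>.\<close>
    moreover have "max 0 (h - \<bar>s - t\<bar>) < h" using h(1) assms(2) by simp
    ultimately have "0 < (c - F s) * (2 * (h - max 0 (h - \<bar>s - t\<bar>)))"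
      by (intro mult_pos_pos) auto
    also have "\<dots> = G s" using h(1) by (simp add: G_def \<phi>'_def algebra_simps)
    finally show ?thesis .
  qed
  ultimately show False by simp
qed

text \<open>The direction \<open>e\<close> is free, so it is taken along the difference of the two
  tangents.\<close>

lemma derivative_lipschitz:
  assumes "\<bar>t - s\<bar> < L"
  shows "norm (g' t - g' s) \<le> lam * \<bar>t - s\<bar>"
proof -
  have *: "norm (g' t - g' s) \<le> lam * (t - s)" if "s < t" "t < s + L" for s t
  proof (cases "g' t = g' s")
    case True
    then show ?thesis using that lam by simp
  next
    case False
    define e where "e = (g' t - g' s) /\<^sub>R norm (g' t - g' s)"
    have "norm e = 1" using False by (simp add: e_def)
    from inner_derivative_decreasing[OF this that] have "(g' t - g' s) \<bullet> e \<le> lam * (t - s)"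
      by (simp add: inner_diff_left algebra_simps)
    moreover have "(g' t - g' s) \<bullet> e = norm (g' t - g' s)"
      using False by (simp add: e_def power2_norm_eq_inner[symmetric] power2_eq_square)
    ultimately show ?thesis by simp
  qed
  from *[of s t] *[of t s] assms lam show ?thesis
    by (cases s t rule: linorder_cases) (auto simp: norm_minus_commute)
qed

lemma tangent_deviation:
  assumes "\<bar>h\<bar> < L"
  shows "norm (g (s + h) - g s - h *\<^sub>R g' s) \<le> lam * h\<^sup>2 / 2"
proof -
  \<comment> \<open>The sign \<sigma> treats forward and backward arcs at once.\<close>
  have *: "norm (g (s + \<sigma> * k) - g s - (\<sigma> * k) *\<^sub>R g' s) \<le> lam * k\<^sup>2 / 2" if "0 \<le> k" "k < L" "\<bar>\<sigma>\<bar> = 1" for \<sigma> k :: real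
  proof -
    define X where "X x = g (s + \<sigma> * x) - (\<sigma> * x) *\<^sub>R g' s" for x
    have "(X has_vector_derivative \<sigma> *\<^sub>R (g' (s + \<sigma> * x) - g' s)) (at x within {0..k})" for x
    proof -
      have "((\<lambda>x. s + \<sigma> * x) has_vector_derivative \<sigma>) (at x within {0..k})"
        unfolding has_real_derivative_iff_has_vector_derivative[symmetric] by (auto intro!: derivative_eq_intros)
      from vector_diff_chain_within[OF this has_vector_derivative_at_within[OF deriv]]
      have "((\<lambda>x. g (s + \<sigma> * x)) has_vector_derivative \<sigma> *\<^sub>R g' (s + \<sigma> * x)) (at x within {0..k})"
        by (simp add: o_def)
      moreover have "((\<lambda>x. (\<sigma> * x) *\<^sub>R g' s) has_vector_derivative \<sigma> *\<^sub>R g' s) (at x within {0..k})"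
        by (auto intro!: derivative_eq_intros)
      ultimately show ?thesis
        unfolding X_def[abs_def] by (auto intro: has_vector_derivative_diff simp: algebra_simps)
    qed
    moreover have "norm (\<sigma> *\<^sub>R (g' (s + \<sigma> * x) - g' s)) \<le> lam * x" if "x \<in> {0..k}" for x
      using derivative_lipschitz[of "s + \<sigma> * x" s] that \<open>k < L\<close> \<open>\<bar>\<sigma>\<bar> = 1\<close> by (simp add: abs_mult)
    ultimately have "norm (X k - X 0) \<le> lam * k\<^sup>2 / 2"
      using \<open>0 \<le> k\<close> by (rule norm_diff_le_quadratic)
    then show ?thesis by (simp add: X_def algebra_simps)
  qed
  show ?thesis using *[of h 1] *[of "- h" "- 1"] assms by (cases "h \<ge> 0") auto
qed

end

section \<open>Nearest points and bottlenecks\<close>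

context minimal_curve
begin

lemma periodic_int: "g (t + of_int n * L) = g t"
proof (induction n rule: int_induct[where k = 0])
  case (step1 i)
  then show ?case using periodic[of "t + of_int i * L"] by (simp add: algebra_simps)
next
  case (step2 i)
  then show ?case using periodic[of "t + of_int (i - 1) * L"] by (simp add: algebra_simps)
qed simp

lemma obtain_offset:
  obtains h where "0 \<le> h" "h < L" "g u = g (s + h)" "g' u = g' (s + h)"
proof -
  have periodic'_int: "g' (t + of_int n * L) = g' t" for t n
  proof (induction n rule: int_induct[where k = 0])
    case (step1 i)
    then show ?case using periodic'[of "t + of_int i * L"] by (simp add: algebra_simps)
  next
    case (step2 i)
    then show ?case using periodic'[of "t + of_int (i - 1) * L"] by (simp add: algebra_simps)
  qed simp
  define n where "n = \<lfloor>(u - s) / L\<rfloor>"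
  have "of_int n \<le> (u - s) / L" "(u - s) / L < of_int n + 1"
    unfolding n_def by linarith+
  then have "of_int n * L \<le> u - s" "u - s < of_int n * L + L"
    using L by (simp_all add: field_simps)
  moreover have "g u = g (s + (u - s - of_int n * L))"
    using periodic_int[of "u - of_int n * L" n] by simp
  moreover have "g' u = g' (s + (u - s - of_int n * L))"
    using periodic'_int[of "u - of_int n * L" n] by simp
  ultimately show ?thesis by (intro that[of "u - s - of_int n * L"]) auto
qed

lemma g_offset_neq:
  assumes "0 < h" "h < L"
  shows "g (s + h) \<noteq> g s"
proof -
  define n where "n = \<lfloor>s / L\<rfloor>"
  define r where "r = s - of_int n * L"
  have "of_int n \<le> s / L" "s / L < of_int n + 1"
    unfolding n_def by linarith+
  then have r: "0 \<le> r" "r < L"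
    using L by (simp_all add: r_def field_simps)
  have gr: "g s = g r" "g (s + h) = g (r + h)"
    using periodic_int[of r n] periodic_int[of "r + h" n] by (simp_all add: r_def)
  show ?thesis
  proof (cases "r + h < L")
    case True
    then show ?thesis using inj_onD[OF inj, of "r + h" r] r assms gr by auto
  next
    case False
    have "g (r + h) = g (r + h - L)" using periodic[of "r + h - L"] by simp
    then show ?thesis using False inj_onD[OF inj, of "r + h - L" r] r assms gr by auto
  qed
qed

section \<open>The curve against its tangent, and pairs of nearest points\<close>

lemma tangential_advance:
  assumes "\<bar>h\<bar> < L"
  shows "\<bar>(g (s + h) - g s) \<bullet> g' s - h\<bar> \<le> lam * h\<^sup>2 / 2"
proof -
  have "(g (s + h) - g s) \<bullet> g' s - h = (g (s + h) - g s - h *\<^sub>R g' s) \<bullet> g' s"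
    using unit[of s] by (simp add: inner_diff_left norm_eq_1)
  also have "\<bar>\<dots>\<bar> \<le> norm (g (s + h) - g s - h *\<^sub>R g' s) * norm (g' s)"
    by (rule Cauchy_Schwarz_ineq2)
  finally show ?thesis using tangent_deviation[OF assms, of s] unit[of s] by simp
qed

text \<open>For h <= 1 / \<open>lam\<close> the quadratic error consumes at most half of the advance
  h. This is the origin of the threshold 1 / \<open>lam\<close> in what follows.\<close>

lemma tangential_advance_ge:
  assumes "0 \<le> h" "h < L" "h \<le> 1 / lam"
  shows "h / 2 \<le> (g (s + h) - g s) \<bullet> g' s" "h / 2 \<le> (g s - g (s - h)) \<bullet> g' s"
proof -
  have "lam * h \<le> 1" using assms(3) lam by (simp add: field_simps)
  then have "lam * h\<^sup>2 / 2 \<le> h / 2"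
    using mult_right_mono[of "lam * h" 1 h] assms(1) by (simp add: power2_eq_square mult.assoc)
  then show "h / 2 \<le> (g (s + h) - g s) \<bullet> g' s" "h / 2 \<le> (g s - g (s - h)) \<bullet> g' s"
    using abs_le_D2[OF tangential_advance[of h s]] abs_le_D1[OF tangential_advance[of "- h" s]] assms
    by (auto simp: inner_diff_left)
qed

lemma has_real_derivative_norm_sq:
  fixes X :: "real \<Rightarrow> real^2"
  assumes "(X has_vector_derivative X') (at t)"
  shows "((\<lambda>t. (norm (X t))\<^sup>2) has_real_derivative 2 * (X t \<bullet> X')) (at t)"
proof -
  have "((\<lambda>t. X t \<bullet> X t) has_vector_derivative X t \<bullet> X' + X' \<bullet> X t) (at t)"
    using bounded_bilinear.has_vector_derivative[OF bounded_bilinear_inner assms assms] .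
  then show ?thesis
    unfolding has_real_derivative_iff_has_vector_derivative
    by (simp add: power2_norm_eq_inner inner_commute)
qed

lemma nearest_tangent:
  assumes "\<And>t. norm (x - g s) \<le> norm (x - g t)"
  shows "(x - g s) \<bullet> g' s = 0"
proof -
  have "((\<lambda>t. x - g t) has_vector_derivative 0 - g' s) (at s)"
    by (intro has_vector_derivative_diff has_vector_derivative_const deriv)
  from DERIV_local_min[OF has_real_derivative_norm_sq[OF this], of 1] assms
  show ?thesis by (simp add: power_mono)
qed

text \<open>Let y be the chord. Equal distances give |y|^2 = 2 y \<bullet> (x - g s). The second
  factor is normal to the curve, so only the deviation of y from the tangent counts and |y|^2 <= d
  lam h^2. If h were at most 1 / \<open>lam\<close>, then |y| >= h / 2, contradicting d lam < 1 /
  4.\<close>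

lemma nearest_points_far:
  assumes near: "\<And>t. d \<le> norm (x - g t)" "norm (x - g s) = d" "norm (x - g (s + h)) = d"
    and "d * lam < 1 / 4" "0 < h" "h < L"
  shows "h > 1 / lam"
proof (rule ccontr)
  assume "\<not> h > 1 / lam"
  define y where "y = g (s + h) - g s"
  have adv: "h / 2 \<le> y \<bullet> g' s"
    unfolding y_def using tangential_advance_ge(1)[of h s] assms \<open>\<not> h > 1 / lam\<close> by auto
  also have "\<dots> \<le> norm y" using norm_cauchy_schwarz[of y "g' s"] unit[of s] by simp
  finally have ge: "(h / 2)\<^sup>2 \<le> (norm y)\<^sup>2" using assms(5) by (intro power_mono) auto
  have tan: "(x - g s) \<bullet> g' s = 0" using near by (intro nearest_tangent) auto
  have "(norm (x - g s))\<^sup>2 = (norm (x - g s - y))\<^sup>2" using near by (simp add: y_def)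
  then have "(norm y)\<^sup>2 = 2 * (y \<bullet> (x - g s))"
    unfolding power2_norm_eq_inner by (simp add: inner_diff_left inner_diff_right inner_commute)
  also have "y \<bullet> (x - g s) = (y - h *\<^sub>R g' s) \<bullet> (x - g s)"
    using tan by (simp add: inner_diff_left[of y] inner_commute[of "g' s"])
  also have "\<dots> \<le> norm (y - h *\<^sub>R g' s) * norm (x - g s)" by (rule norm_cauchy_schwarz)
  also have "\<dots> \<le> (lam * h\<^sup>2 / 2) * d"
    using tangent_deviation[of h s] assms near(1)[of s] norm_ge_zero[of "x - g s"] lam unfolding y_def by (intro mult_mono) auto
  finally have "(h / 2)\<^sup>2 \<le> (d * lam) * h\<^sup>2" using ge by (simp add: mult_ac)
  also have "\<dots> < (1 / 4) * h\<^sup>2" using assms(4,5) by (intro mult_strict_right_mono) auto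
  finally show False by (simp add: power_divide)
qed

text \<open>Minimise the chord over all pairs whose two connecting arcs both have length at least 1
  / \<open>lam\<close>. On the edge of this set chords have length at least 1 / (2
  \<open>lam\<close>), so the minimiser is interior and critical in both variables.\<close>

lemma bottleneck:
  assumes "1 / lam \<le> h0" "h0 \<le> L - 1 / lam" "norm (g (s0 + h0) - g s0) < 1 / (2 * lam)"
  obtains s h where "1 / lam < h" "h < L - 1 / lam" "norm (g (s + h) - g s) \<le> norm (g (s0 + h0) - g s0)"
    "(g (s + h) - g s) \<bullet> g' s = 0" "(g (s + h) - g s) \<bullet> g' (s + h) = 0"
    "open_segment (g s) (g (s + h)) \<inter> range g = {}"
proof -
  define f where "f = (\<lambda>z. norm (g (fst z + snd z) - g (fst z)))"
  define A where "A = {0..L} \<times> {1 / lam..L - 1 / lam}"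
  have "compact A" "A \<noteq> {}" using assms L by (auto simp: A_def intro!: compact_Times)
  moreover have "continuous_on A f"
    unfolding f_def by (intro continuous_intros continuous_on_compose2[OF cont_g[of UNIV]]) auto
  ultimately obtain z where z: "z \<in> A" "\<And>y. y \<in> A \<Longrightarrow> f z \<le> f y"
    using continuous_attains_inf by metis
  obtain s h where sh: "z = (s, h)" by (cases z)
  define D where "D = norm (g (s + h) - g s)"
  have h: "1 / lam \<le> h" "h \<le> L - 1 / lam" using z(1) by (auto simp: A_def sh)
  have min: "D \<le> norm (g (t + k) - g t)" if "1 / lam \<le> k" "k \<le> L - 1 / lam" for t k
  proof -
    define n where "n = \<lfloor>t / L\<rfloor>"
    define r where "r = t - of_int n * L"
    have "of_int n \<le> t / L" "t / L < of_int n + 1"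
      unfolding n_def by linarith+
    then have "0 \<le> r" "r \<le> L"
      using L by (simp_all add: r_def field_simps)
    then have "f z \<le> f (r, k)" using that by (intro z(2)) (auto simp: A_def)
    moreover have "g t = g r" "g (t + k) = g (r + k)"
      using periodic_int[of r n] periodic_int[of "r + k" n] by (simp_all add: r_def)
    ultimately show ?thesis by (simp add: f_def sh D_def)
  qed
  have D_le: "D \<le> norm (g (s0 + h0) - g s0)" using min assms by blast
  have "0 < 1 / lam" using lam by simp
  then have lamL: "0 < 1 / lam" "1 / lam < L" using h by linarith+
  have edge: "1 / (2 * lam) \<le> norm (g (s + 1 / lam) - g s)" "1 / (2 * lam) \<le> norm (g (s - 1 / lam) - g s)"
    using tangential_advance_ge[of "1 / lam" s] lamL unit[of s]
      norm_cauchy_schwarz[of "g (s + 1 / lam) - g s" "g' s"] norm_cauchy_schwarz[of "g s - g (s - 1 / lam)" "g' s"]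
    by (auto simp: norm_minus_commute)
  have h_strict: "1 / lam < h" "h < L - 1 / lam"
  proof -
    have "h \<noteq> 1 / lam" using edge(1) D_le assms(3) by (auto simp: D_def)
    moreover have "h \<noteq> L - 1 / lam"
    proof
      assume "h = L - 1 / lam"
      then have "s + h = s - 1 / lam + L" by simp
      then have "g (s + h) = g (s - 1 / lam + L)" by (rule arg_cong)
      also have "\<dots> = g (s - 1 / lam)" by (rule periodic)
      finally have "g (s + h) = g (s - 1 / lam)" .
      then show False using edge(2) D_le assms(3) by (simp add: D_def)
    qed
    ultimately show "1 / lam < h" "h < L - 1 / lam" using h by auto
  qed
  define \<delta> where "\<delta> = min (h - 1 / lam) (L - 1 / lam - h)"
  have dg: "((\<lambda>k. g (c + k)) has_vector_derivative g' (c + k)) (at k)" for c k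
  proof -
    have "((\<lambda>k. c + k) has_vector_derivative 1) (at k)"
      unfolding has_real_derivative_iff_has_vector_derivative[symmetric] by (auto intro!: derivative_eq_intros)
    from vector_diff_chain_at[OF this deriv] show ?thesis by (simp add: o_def)
  qed
  have "((\<lambda>k. g (s + k) - g s) has_vector_derivative g' (s + h) - 0) (at h)"
    by (intro has_vector_derivative_diff has_vector_derivative_const dg)
  note d1 = has_real_derivative_norm_sq[OF this]
  have "\<delta> > 0" using h_strict by (simp add: \<delta>_def)
  moreover have "(norm (g (s + h) - g s))\<^sup>2 \<le> (norm (g (s + k) - g s))\<^sup>2" if "\<bar>h - k\<bar> < \<delta>" for k
  proof -
    have "1 / lam \<le> k" "k \<le> L - 1 / lam" using that unfolding \<delta>_def by linarith+
    from min[OF this] show ?thesis by (intro power_mono) (auto simp: D_def)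
  qed
  ultimately have crit1: "(g (s + h) - g s) \<bullet> g' (s + h) = 0"
    using DERIV_local_min[OF d1, of \<delta>] by simp
  have "((\<lambda>t. g (h + t) - g t) has_vector_derivative g' (h + s) - g' s) (at s)"
    by (intro has_vector_derivative_diff deriv dg)
  from DERIV_local_min[OF has_real_derivative_norm_sq[OF this], of 1]
  have "(g (h + s) - g s) \<bullet> (g' (h + s) - g' s) = 0"
    using h min by (auto simp: D_def add.commute[of h] intro!: power_mono)
  \<comment> \<open>Moving \<open>s\<close> at fixed \<open>h\<close> moves both ends, so
    criticality there gives orthogonality to the difference of the tangents; subtracting the
    condition at the far end leaves the one at \<open>s\<close>.\<close>
  then have crit2: "(g (s + h) - g s) \<bullet> g' s = 0"
    using crit1 by (simp add: inner_diff_right add.commute)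
  \<comment> \<open>A point of the curve on the chord would be nearer to \<open>g s\<close> than the
    minimum, so its arc distance from \<open>s\<close> is below 1 / \<open>lam\<close>. There the
    curve has advanced along \<open>g' s\<close>, whereas the chord is orthogonal to
    \<open>g' s\<close>.\<close>
  have "g u \<notin> open_segment (g s) (g (s + h))" for u
  proof
    assume u: "g u \<in> open_segment (g s) (g (s + h))"
    obtain k where k: "0 \<le> k" "k < L" "g u = g (s + k)" using obtain_offset[of u s] by blast
    obtain \<mu> where \<mu>: "0 < \<mu>" "\<mu> < 1" "g u = (1 - \<mu>) *\<^sub>R g s + \<mu> *\<^sub>R g (s + h)"
      using u by (auto simp: in_segment)
    then have diff: "g u - g s = \<mu> *\<^sub>R (g (s + h) - g s)" by (simp add: algebra_simps)
    then have orth: "(g u - g s) \<bullet> g' s = 0" by (simp add: crit2)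
    have "g (s + h) \<noteq> g s" using u by auto
    then have "g u \<noteq> g s" using diff \<mu>(1) by auto
    then have "k > 0" using k by (cases "k = 0") auto
    have "norm (g u - g s) < D" using diff \<mu> \<open>g (s + h) \<noteq> g s\<close> by (simp add: D_def)
    then consider "k < 1 / lam" | "L - k < 1 / lam" using min[of k s] k by force
    then show False
    proof cases
      case 1
      then show False using tangential_advance_ge(1)[of k s] k \<open>k > 0\<close> orth by simp
    next
      case 2
      moreover have "g (s - (L - k)) = g u" using periodic[of "s - (L - k)"] k(3) by (simp add: algebra_simps)
      ultimately show False
        using tangential_advance_ge(2)[of "L - k" s] k \<open>k > 0\<close> orth by (simp add: inner_diff_left)
    qed
  qed
  then have "open_segment (g s) (g (s + h)) \<inter> range g = {}" by auto
  with h_strict D_le crit1 crit2 show ?thesis by (intro that[of h s]) (auto simp: D_def)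
qed

section \<open>Cutting off two antiparallel strands\<close>

lemma path_current_shift:
  "path_current (s + a) (s + b) g g' \<omega> = path_current a b (\<lambda>t. g (s + t)) (\<lambda>t. g' (s + t)) \<omega>"
  unfolding path_current_def
  using integral_shift_real_ivl[of "s + a" s "s + b" "\<lambda>t. \<omega> (g t) (g' t)"] by (simp add: add.commute)

lemma path_current_reflect:
  assumes "\<omega> \<in> forms1"
  shows "path_current (s - b) (s - a) g g' \<omega> = - path_current a b (\<lambda>t. g (s - t)) (\<lambda>t. - g' (s - t)) \<omega>"
  using path_current_shift[of s "- b" "- a" \<omega>]
    Henstock_Kurzweil_Integration.integral_reflect_real[of b a "\<lambda>t. \<omega> (g (s - t)) (g' (s - t))"]
  by (simp add: path_current_def linear_neg[OF forms1_linear[OF assms]])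

text \<open>Both strands are parametrized so that they run side by side, the one through
  \<open>g s\<close> backwards. The strip between them costs its area and its two ends but saves
  both strands. The outcome is a chord of at least 17 / 36 in units of 1 / \<open>lam\<close>, a
  little above 0.45.\<close>

lemma antiparallel_bottleneck_wide:
  assumes h: "1 / lam \<le> h" "h \<le> L - 1 / lam" and anti: "g' (s + h) = - g' s"
  shows "norm (g (s + h) - g s) \<ge> 0.45 / lam"
proof -
  define D where "D = norm (g (s + h) - g s)"
  \<comment> \<open>The strands are disjoint exactly when \<open>2 * a\<close> is at most
    \<open>h\<close> and at most \<open>L - h\<close>, which is what the hypotheses allow for this
    value.\<close>
  define a where "a = 1 / (2 * lam)"
  have a: "a > 0" "2 * a = 1 / lam" "lam * a = 1 / 2" using lam by (simp_all add: a_def)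
  have aL: "a < L" using h a by simp
  define c0 where "c0 t = g (s + h + t)" for t
  define c1 where "c1 t = g (s - t)" for t
  have "((\<lambda>t. s + h + t) has_vector_derivative 1) (at t)" "((\<lambda>t. s - t) has_vector_derivative - 1) (at t)" for t
    unfolding has_real_derivative_iff_has_vector_derivative[symmetric] by (auto intro!: derivative_eq_intros)
  from vector_diff_chain_at[OF this(1) deriv] vector_diff_chain_at[OF this(2) deriv]
  have d: "(c0 has_vector_derivative g' (s + h + t)) (at t)" "(c1 has_vector_derivative - g' (s - t)) (at t)" for t
    by (simp_all add: o_def c0_def[abs_def] c1_def[abs_def])
  have C: "C1_path (- a) a c0 (\<lambda>t. g' (s + h + t))" "C1_path (- a) a c1 (\<lambda>t. - g' (s - t))"
    unfolding C1_path_def using a(1)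
    by (auto intro!: has_vector_derivative_at_within d continuous_intros continuous_on_compose2[OF cont_g'[of UNIV]])
  have width: "norm (c1 t - c0 t) \<le> D + lam * t\<^sup>2" if "t \<in> {- a..a}" for t
  proof -
    have "g' (h + s) = - g' s" using anti by (simp add: add.commute)
    \<comment> \<open>Both strands move to first order along \<open>- g' s\<close>, so the linear
      terms cancel and each strand contributes only its quadratic deviation to the width.\<close>
    then have "c1 t - c0 t = (g s - g (s + h)) + (g (s + - t) - g s - (- t) *\<^sub>R g' s)
        - (g (s + h + t) - g (s + h) - t *\<^sub>R g' (s + h))"
      using anti by (simp add: c0_def c1_def algebra_simps)
    also have "norm \<dots> \<le> D + lam * (- t)\<^sup>2 / 2 + lam * t\<^sup>2 / 2"
    proof -
      have tri: "norm (A + B - C) \<le> p + q + r" if "norm A \<le> p" "norm B \<le> q" "norm C \<le> r" for A B C :: "real^2" and p q r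
        using that norm_triangle_ineq4[of "A + B" C] norm_triangle_ineq[of A B] by linarith
      show ?thesis
        using that aL by (intro tri tangent_deviation) (auto simp: D_def norm_minus_commute)
    qed
    finally show ?thesis by simp
  qed
  \<comment> \<open>\<open>c0\<close> runs along the curve and is subtracted; \<open>c1\<close> runs
    against it, so adding it cancels the strand through \<open>g s\<close> as well. Each strand has
    length \<open>2 * a\<close>.\<close>
  have "L \<le> (L - 4 * a) + norm (c1 (- a) - c0 (- a)) + norm (c1 a - c0 a) + lam * integral {- a..a} (\<lambda>t. D + lam * t\<^sup>2)"
  proof (rule ruled_competitor[OF C])
    fix t u :: real assume t: "t \<in> {- a..a}" and u: "u \<in> {0..1}"
    \<comment> \<open>The velocity in \<open>t\<close> is a convex combination of two unit vectors,
      so the area density is at most the width of the strip.\<close>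
    have "g' (s + h + t) + u *\<^sub>R (- g' (s - t) - g' (s + h + t)) = (1 - u) *\<^sub>R g' (s + h + t) - u *\<^sub>R g' (s - t)"
      by (simp add: algebra_simps)
    also have "norm \<dots> \<le> (1 - u) + u"
      using u norm_triangle_ineq4[of "(1 - u) *\<^sub>R g' (s + h + t)" "u *\<^sub>R g' (s - t)"] by (simp add: unit)
    finally have "norm (g' (s + h + t) + u *\<^sub>R (- g' (s - t) - g' (s + h + t))) * norm (c1 t - c0 t) \<le> 1 * (D + lam * t\<^sup>2)"
      by (intro mult_mono width t) auto
    then show "\<bar>det2 (g' (s + h + t) + u *\<^sub>R (- g' (s - t) - g' (s + h + t))) (c1 t - c0 t)\<bar> \<le> D + lam * t\<^sup>2"
      using abs_det2_le order_trans by fastforce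
  next
    show "(\<lambda>t. D + lam * t\<^sup>2) integrable_on {- a..a}"
      by (intro integrable_continuous_interval continuous_intros)
  next
    fix \<omega> assume \<omega>: "\<omega> \<in> forms1" "\<And>x v. \<bar>\<omega> x v\<bar> \<le> norm v"
    have "path_current 0 L g g' \<omega> - path_current (s + - a) (s + a) g g' \<omega> - path_current (s + h + - a) (s + h + a) g g' \<omega>
        \<le> L - (s + a - (s + - a)) - (s + h + a - (s + h + - a))"
      using a h by (intro remove_two_arcs[OF \<omega>]) auto
    moreover have "path_current (s + h + - a) (s + h + a) g g' \<omega> = path_current (- a) a c0 (\<lambda>t. g' (s + h + t)) \<omega>"
      unfolding path_current_shift c0_def ..
    moreover have "path_current (s + - a) (s + a) g g' \<omega> = - path_current (- a) a c1 (\<lambda>t. - g' (s - t)) \<omega>"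
      using path_current_reflect[OF \<omega>(1), of s a "- a"] by (simp add: c1_def[abs_def])
    ultimately show "path_current 0 L g g' \<omega> - path_current (- a) a c0 (\<lambda>t. g' (s + h + t)) \<omega>
        + path_current (- a) a c1 (\<lambda>t. - g' (s - t)) \<omega> \<le> L - 4 * a"
      by simp
  qed
  moreover have "norm (c1 (- a) - c0 (- a)) \<le> D + lam * a\<^sup>2" "norm (c1 a - c0 a) \<le> D + lam * a\<^sup>2"
    using width[of a] width[of "- a"] a(1) by auto
  moreover have "integral {- a..a} (\<lambda>t. D + lam * t\<^sup>2) = 2 * a * D + 2 * lam * a ^ 3 / 3"
  proof -
    have "((\<lambda>t. D + lam * t\<^sup>2) has_integral (D * a + lam * a ^ 3 / 3) - (D * (- a) + lam * (- a) ^ 3 / 3)) {- a..a}"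
      using a(1) by (intro fundamental_theorem_of_calculus)
       (auto intro!: derivative_eq_intros simp flip: has_real_derivative_iff_has_vector_derivative)
    then show ?thesis by (simp add: integral_unique)
  qed
  ultimately have "4 * a \<le> 2 * D + 2 * (lam * a\<^sup>2) + lam * (2 * a * D + 2 * lam * a ^ 3 / 3)" by simp
  also have "lam * a\<^sup>2 = a / 2" using a(3) by (simp add: power2_eq_square flip: mult.assoc)
  also have "lam * (2 * a * D + 2 * lam * a ^ 3 / 3) = 2 * (lam * a) * D + 2 * (lam * a) * (lam * a) * a / 3"
    by (simp add: power3_eq_cube algebra_simps)
  finally have "4 * a \<le> 2 * D + a + D + a / 6" unfolding a(3) by simp
  then have "17 * a \<le> 18 * D" by simp
  then show ?thesis using lam by (simp add: a_def D_def field_simps)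
qed

end

section \<open>Winding numbers across a curve\<close>

text \<open>With Q = t^2 + \<epsilon>^2 the denominator is Q (1 + b), where |b| <= 1 / 4 because y
  is within ten percent of t. Then y' / (1 + b) differs from 1 by at most 0.35 / 0.75 < 1 / 2, so at
  least half of the kernel 1 / Q survives in the real part.\<close>

lemma Re_quotient_near:
  fixes y' y :: complex
  assumes "norm (y' - 1) \<le> 1 / 10" "norm (y - of_real t) \<le> \<bar>t\<bar> / 10" "\<epsilon> > 0"
  shows "y\<^sup>2 + of_real (\<epsilon>\<^sup>2) \<noteq> 0" "Re (y' / (y\<^sup>2 + of_real (\<epsilon>\<^sup>2))) \<ge> 1 / (2 * (t\<^sup>2 + \<epsilon>\<^sup>2))"
proof -
  define Q where "Q = t\<^sup>2 + \<epsilon>\<^sup>2"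
  have Q: "Q > 0" using assms(3) by (simp add: Q_def add_nonneg_pos)
  define b where "b = (y\<^sup>2 - (of_real t)\<^sup>2) / of_real Q"
  have q: "y\<^sup>2 + of_real (\<epsilon>\<^sup>2) = of_real Q * (1 + b)"
  proof -
    have "of_real Q * (1 + b) = of_real Q + (y\<^sup>2 - (of_real t)\<^sup>2)"
      using Q by (simp add: b_def distrib_left)
    then show ?thesis by (simp add: Q_def)
  qed
  have "norm (y + of_real t) \<le> norm (y - of_real t) + norm (2 * complex_of_real t)"
    using norm_triangle_ineq[of "y - of_real t" "2 * complex_of_real t"] by (simp add: algebra_simps)
  then have "norm (y + of_real t) \<le> 21 / 10 * \<bar>t\<bar>" using assms(2) by (simp add: norm_mult)
  moreover have "y\<^sup>2 - (of_real t)\<^sup>2 = (y - of_real t) * (y + of_real t)" by (simp add: power2_eq_square algebra_simps)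
  ultimately have "norm (y\<^sup>2 - (of_real t)\<^sup>2) \<le> (\<bar>t\<bar> / 10) * (21 / 10 * \<bar>t\<bar>)"
    using mult_mono[OF assms(2), of "norm (y + of_real t)" "21 / 10 * \<bar>t\<bar>"] by (simp only: norm_mult) simp
  also have "\<dots> \<le> t\<^sup>2 / 4" by (simp add: power2_eq_square)
  also have "\<dots> \<le> Q / 4" by (simp add: Q_def)
  finally have b: "norm b \<le> 1 / 4" using Q by (simp add: b_def norm_divide field_simps)
  then have nb: "norm (1 + b) \<ge> 3 / 4" using norm_triangle_ineq2[of 1 "- b"] by simp
  then have nz: "1 + b \<noteq> 0" by auto
  then show "y\<^sup>2 + of_real (\<epsilon>\<^sup>2) \<noteq> 0" unfolding q using Q by simp
  have "y' / (1 + b) - 1 = (y' - 1 - b) / (1 + b)" using nz by (simp add: field_simps)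
  moreover have "norm (y' - 1 - b) \<le> 1 / 10 + 1 / 4"
    using norm_triangle_ineq4[of "y' - 1" b] assms(1) b by linarith
  ultimately have "norm (y' / (1 + b) - 1) \<le> (1 / 10 + 1 / 4) / (3 / 4)"
    using nb by (simp only: norm_divide) (intro frac_le, auto)
  then have "\<bar>Re (y' / (1 + b) - 1)\<bar> \<le> 1 / 2" using abs_Re_le_cmod[of "y' / (1 + b) - 1"] by simp
  from abs_le_D2[OF this] have "Re (y' / (1 + b)) \<ge> 1 / 2" by simp
  moreover have "Re (y' / (y\<^sup>2 + of_real (\<epsilon>\<^sup>2))) = Re (y' / (1 + b)) / Q"
  proof -
    have "y' / (of_real Q * (1 + b)) = (y' / (1 + b)) / of_real Q" by (simp add: mult.commute)
    then show ?thesis unfolding q by (metis Re_divide_of_real)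
  qed
  ultimately show "Re (y' / (y\<^sup>2 + of_real (\<epsilon>\<^sup>2))) \<ge> 1 / (2 * (t\<^sup>2 + \<epsilon>\<^sup>2))"
    using divide_right_mono[of "1 / 2" "Re (y' / (1 + b))" Q] Q by (simp add: Q_def)
qed

text \<open>Crossing a \<open>C\<^sup>1\<close> curve from right to left increases its winding number. In the normalised
  coordinate \<open>y = (P - P x0) / P' x0\<close> the increment is
  \<open>(\<epsilon> / \<pi>) * \<integral> y' / (y\<^sup>2 + \<epsilon>\<^sup>2)\<close>, and near \<open>x0\<close> the integrand
  is comparable to the Poisson kernel.\<close>

lemma winding_number_jump:
  fixes P P' :: "real \<Rightarrow> complex"
  assumes deriv: "\<And>x. (P has_vector_derivative P' x) (at x)" and cont: "continuous_on UNIV P'"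
    and x0: "0 < x0" "x0 < 1" and nz: "P' x0 \<noteq> 0"
    and inj: "\<And>x. x \<in> {0..1} \<Longrightarrow> P x = P x0 \<Longrightarrow> x = x0"
  shows "eventually (\<lambda>\<epsilon>. P x0 + of_real \<epsilon> * (\<i> * P' x0) \<notin> path_image P \<and>
    P x0 - of_real \<epsilon> * (\<i> * P' x0) \<notin> path_image P \<and>
    Re (winding_number P (P x0 - of_real \<epsilon> * (\<i> * P' x0))) < Re (winding_number P (P x0 + of_real \<epsilon> * (\<i> * P' x0)))) (at_right 0)"
proof -
  define y where "y x = (P x - P x0) / P' x0" for x
  define y' where "y' x = P' x / P' x0" for x
  have dy: "(y has_vector_derivative y' x) (at x)" for x
  proof -
    have "((\<lambda>x. (P x - P x0) * (1 / P' x0)) has_vector_derivative (P' x - 0) * (1 / P' x0)) (at x)"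
      by (intro has_vector_derivative_mult_left has_vector_derivative_diff deriv has_vector_derivative_const)
    then show ?thesis by (simp add: y_def[abs_def] y'_def)
  qed
  have cont_P': "continuous_on S P'" for S using cont continuous_on_subset by blast
  have cont_y': "continuous_on S y'" for S unfolding y'_def by (intro continuous_intros cont_P') (use nz in auto)
  have cont_y: "continuous_on S y" for S
    by (meson dy continuous_at_imp_continuous_on has_vector_derivative_continuous)
  have "isCont y' x0" using continuous_on_interior[OF cont_y'[of UNIV]] by simp
  then obtain \<delta>0 where \<delta>0: "\<delta>0 > 0" "\<And>x. \<bar>x - x0\<bar> < \<delta>0 \<Longrightarrow> norm (y' x - y' x0) < 1 / 10"
    unfolding continuous_at_eps_delta by (metis dist_norm dist_real_def zero_less_divide_1_iff zero_less_numeral)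
  have y'x0: "y' x0 = 1" using nz by (simp add: y'_def)
  define \<delta> where "\<delta> = min (\<delta>0 / 2) (min x0 (1 - x0))"
  have \<delta>: "0 < \<delta>" "\<delta> < \<delta>0" "\<delta> \<le> x0" "\<delta> \<le> 1 - x0" using \<delta>0(1) x0 by (auto simp: \<delta>_def)
  have near': "norm (y' x - 1) \<le> 1 / 10" if "\<bar>x - x0\<bar> \<le> \<delta>" for x
    using \<delta>0(2)[of x] that \<delta>(2) y'x0 by auto
  have near: "norm (y x - of_real (x - x0)) \<le> \<bar>x - x0\<bar> / 10" if "\<bar>x - x0\<bar> \<le> \<delta>" for x
  proof -
    have "norm ((y x - of_real x) - (y x0 - of_real x0)) \<le> 1 / 10 * norm (x - x0)"
    proof (rule differentiable_bound[of "{x0 - \<delta>..x0 + \<delta>}" "\<lambda>x. y x - of_real x" "\<lambda>x h. h *\<^sub>R (y' x - 1)"])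
      fix u assume u: "u \<in> {x0 - \<delta>..x0 + \<delta>}"
      have "((\<lambda>x. y x - of_real x) has_vector_derivative y' u - 1) (at u within {x0 - \<delta>..x0 + \<delta>})"
        by (intro has_vector_derivative_diff has_vector_derivative_at_within[OF dy])
           (auto simp: has_vector_derivative_def scaleR_conv_of_real intro!: derivative_eq_intros)
      then show "((\<lambda>x. y x - of_real x) has_derivative (\<lambda>h. h *\<^sub>R (y' u - 1))) (at u within {x0 - \<delta>..x0 + \<delta>})"
        by (simp add: has_vector_derivative_def)
      show "onorm (\<lambda>h. h *\<^sub>R (y' u - 1)) \<le> 1 / 10"
      proof (rule onorm_le)
        have n: "norm (y' u - 1) \<le> 1 / 10" using near'[of u] u by (auto simp: abs_le_iff)
        show "norm (h *\<^sub>R (y' u - 1)) \<le> 1 / 10 * norm h" for h :: real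
          using mult_right_mono[OF n, of "\<bar>h\<bar>"] by (simp add: mult.commute)
      qed
    qed (use that in auto)
    then show ?thesis by (simp add: y_def algebra_simps)
  qed
  \<comment> \<open>The parameters away from \<open>x0\<close>. By injectivity y has no zero on this
    compact set, so its modulus is bounded below there.\<close>
  define F where "F = {0..1} - {x0 - \<delta><..<x0 + \<delta>}"
  have "compact F" unfolding F_def by (intro compact_diff) auto
  have "\<exists>\<mu>>0. \<forall>x\<in>F. \<mu> \<le> norm (y x)"
  proof (cases "F = {}")
    case False
    obtain x1 where "x1 \<in> F" "\<And>x. x \<in> F \<Longrightarrow> norm (y x1) \<le> norm (y x)"
      using continuous_attains_inf[OF \<open>compact F\<close> False continuous_on_norm[OF cont_y]] by blast
    moreover from this(1) have "y x1 \<noteq> 0"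
      using inj[of x1] nz \<delta>(1) by (auto simp: F_def y_def)
    ultimately show ?thesis by (intro exI[of _ "norm (y x1)"]) auto
  qed (auto intro: exI[of _ 1])
  then obtain \<mu> where \<mu>: "\<mu> > 0" "\<And>x. x \<in> F \<Longrightarrow> \<mu> \<le> norm (y x)" by blast
  have "bounded (y' ` {0..1})"
    by (intro compact_imp_bounded compact_continuous_image cont_y' compact_Icc)
  then obtain B where B: "B > 0" "\<And>x. x \<in> {0..1} \<Longrightarrow> norm (y' x) \<le> B"
    unfolding bounded_pos by auto
  define M where "M = B / (3 * \<mu>\<^sup>2 / 4)"
  have "M > 0" using B(1) \<mu>(1) by (simp add: M_def)
  \<comment> \<open>The last bound gives 1 / (2 \<epsilon>) > \<open>M\<close>, so the contribution
    near \<open>x0\<close> outweighs whatever the far part subtracts.\<close>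
  define \<epsilon>0 where "\<epsilon>0 = min (min \<delta> (\<mu> / 2)) (1 / (2 * M))"
  have "\<epsilon>0 > 0" using \<delta> \<mu> \<open>M > 0\<close> by (simp add: \<epsilon>0_def)
  have "P x0 + of_real \<epsilon> * (\<i> * P' x0) \<notin> path_image P \<and> P x0 - of_real \<epsilon> * (\<i> * P' x0) \<notin> path_image P \<and>
    Re (winding_number P (P x0 - of_real \<epsilon> * (\<i> * P' x0))) < Re (winding_number P (P x0 + of_real \<epsilon> * (\<i> * P' x0)))"
    if \<epsilon>: "0 < \<epsilon>" "\<epsilon> < \<epsilon>0" for \<epsilon>
  proof -
    have \<epsilon>': "\<epsilon> < \<delta>" "\<epsilon> < \<mu> / 2" "\<epsilon> * (2 * M) < 1"
      using \<epsilon> \<open>M > 0\<close> by (auto simp: \<epsilon>0_def field_simps)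
    define q where "q x = (y x)\<^sup>2 + of_real (\<epsilon>\<^sup>2)" for x
    have far: "3 * \<mu>\<^sup>2 / 4 \<le> norm (q x)" if "x \<in> F" for x
    proof -
      have "norm (q x) \<ge> norm ((y x)\<^sup>2) - norm (complex_of_real (\<epsilon>\<^sup>2))"
        unfolding q_def using norm_triangle_ineq2[of "(y x)\<^sup>2" "- complex_of_real (\<epsilon>\<^sup>2)"] by simp
      moreover have "norm ((y x)\<^sup>2) \<ge> \<mu>\<^sup>2" using \<mu>(2)[OF that] \<mu>(1) by (simp add: norm_power power_mono)
      moreover have "\<epsilon>\<^sup>2 \<le> (\<mu> / 2)\<^sup>2" using \<epsilon> \<epsilon>' by (intro power_mono) auto
      ultimately show ?thesis by (simp add: power_divide norm_power)
    qed
    have q_nz: "q x \<noteq> 0" if "x \<in> {0..1}" for x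
    proof (cases "x \<in> F")
      case True
      then show ?thesis using far[OF True] \<mu>(1) by auto
    next
      case False
      then have "\<bar>x - x0\<bar> \<le> \<delta>" using that by (auto simp: F_def)
      then show ?thesis unfolding q_def by (intro Re_quotient_near(1)[OF near' near] \<epsilon>)
    qed
    \<comment> \<open>As a polynomial in y, \<open>q\<close> has the zeros i \<epsilon> and - i
      \<epsilon>, the normalised coordinates of the two test points. By partial fractions their
      Cauchy kernels differ by 2 i \<epsilon> / q.\<close>
    have q_fac: "q x = (y x - of_real \<epsilon> * \<i>) * (y x + of_real \<epsilon> * \<i>)" for x
      by (simp add: q_def power2_eq_square algebra_simps)
    define w1 where "w1 = P x0 + of_real \<epsilon> * (\<i> * P' x0)"
    define w2 where "w2 = P x0 - of_real \<epsilon> * (\<i> * P' x0)"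
    have P_w: "P x - w1 = P' x0 * (y x - of_real \<epsilon> * \<i>)" "P x - w2 = P' x0 * (y x + of_real \<epsilon> * \<i>)" for x
      using nz by (simp_all add: y_def w1_def w2_def field_simps)
    have w: "w1 \<notin> path_image P" "w2 \<notin> path_image P"
    proof -
      have "P x - w1 \<noteq> 0 \<and> P x - w2 \<noteq> 0" if "x \<in> {0..1}" for x
        unfolding P_w using q_nz[OF that] nz by (auto simp: q_fac)
      then show "w1 \<notin> path_image P" "w2 \<notin> path_image P" unfolding path_image_def by force+
    qed
    have "P C1_differentiable_on {0..1}"
      unfolding C1_differentiable_on_def using deriv cont_P' by blast
    then have valid: "valid_path P" by (simp add: valid_path_def C1_differentiable_imp_piecewise)
    have wn: "((\<lambda>x. 1 / (P x - w) * P' x) has_integral (2 * pi * \<i> * winding_number P w)) {0..1}"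
      if "w \<notin> path_image P" for w
    proof -
      have vd: "vector_derivative P (at x within {0..1}) = P' x" if "x \<in> {0..1}" for x
        using that has_vector_derivative_at_within[OF deriv]
        by (intro vector_derivative_within_cbox[of 0 1, simplified]) auto
      show ?thesis
        by (rule has_integral_eq[OF _ has_contour_integral_winding_number[OF valid that, unfolded has_contour_integral_def]])
           (simp add: vd)
    qed
    have "((\<lambda>x. (1 / (P x - w1) * P' x - 1 / (P x - w2) * P' x) * (1 / (2 * pi * \<i>))) has_integral
      (2 * pi * \<i> * winding_number P w1 - 2 * pi * \<i> * winding_number P w2) * (1 / (2 * pi * \<i>))) {0..1}"
      by (intro has_integral_mult_left has_integral_diff wn w)
    moreover have "(1 / (P x - w1) * P' x - 1 / (P x - w2) * P' x) * (1 / (2 * pi * \<i>)) = of_real (\<epsilon> / pi) * (y' x / q x)"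
      if "x \<in> {0..1}" for x
    proof -
      define u where "u = y x - of_real \<epsilon> * \<i>"
      define v where "v = y x + of_real \<epsilon> * \<i>"
      have uv: "u \<noteq> 0" "v \<noteq> 0" "q x = u * v" using q_nz[OF that] by (auto simp: q_fac u_def v_def)
      have "P' x = P' x0 * y' x" using nz by (simp add: y'_def)
      then have "1 / (P x - w1) * P' x - 1 / (P x - w2) * P' x = y' x / u - y' x / v"
        unfolding P_w u_def[symmetric] v_def[symmetric] using nz by simp
      also have "\<dots> = y' x * (v - u) / q x" using uv by (simp add: field_simps)
      also have "v - u = 2 * of_real \<epsilon> * \<i>" by (simp add: u_def v_def)
      finally show ?thesis by (simp add: mult.commute)
    qed
    ultimately have "((\<lambda>x. of_real (\<epsilon> / pi) * (y' x / q x)) has_integral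
      (2 * pi * \<i> * winding_number P w1 - 2 * pi * \<i> * winding_number P w2) * (1 / (2 * pi * \<i>))) {0..1}"
      by (rule has_integral_eq[rotated]) auto
    moreover have "(2 * pi * \<i> * winding_number P w1 - 2 * pi * \<i> * winding_number P w2) * (1 / (2 * pi * \<i>))
      = winding_number P w1 - winding_number P w2"
      by (simp add: field_simps)
    ultimately have "((\<lambda>x. of_real (\<epsilon> / pi) * (y' x / q x)) has_integral (winding_number P w1 - winding_number P w2)) {0..1}"
      by (simp only:)
    moreover have "Re (of_real r * v) = r * Re v" for r v by simp
    ultimately have int: "((\<lambda>x. \<epsilon> / pi * Re (y' x / q x)) has_integral Re (winding_number P w1) - Re (winding_number P w2)) {0..1}"
      by (metis (no_types, lifting) has_integral_Re has_integral_eq minus_complex.simps(1))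
    define S where "S = {x0 - \<epsilon>..x0 + \<epsilon>}"
    \<comment> \<open>A crude minorant is enough, since only the sign of the jump is wanted: 1 / (4
      \<epsilon>^2) on an interval of length 2 \<epsilon> around \<open>x0\<close>, and -
      \<open>M\<close> throughout. Its integral is 1 / (2 \<epsilon>) - \<open>M\<close>, up to the
      positive factor in front.\<close>
    have low: "((\<lambda>x. \<epsilon> / pi * ((if x \<in> S then 1 / (4 * \<epsilon>\<^sup>2) else 0) - M)) has_integral \<epsilon> / pi * (2 * \<epsilon> * (1 / (4 * \<epsilon>\<^sup>2)) - M)) {0..1}"
    proof -
      have "S \<subseteq> {0..1}" using \<epsilon>' \<delta> by (auto simp: S_def)
      moreover have "((\<lambda>x. 1 / (4 * \<epsilon>\<^sup>2)) has_integral 2 * \<epsilon> * (1 / (4 * \<epsilon>\<^sup>2))) S"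
        using has_integral_const_real[of "1 / (4 * \<epsilon>\<^sup>2)" "x0 - \<epsilon>" "x0 + \<epsilon>"] \<epsilon> by (simp add: S_def)
      ultimately have "((\<lambda>x. if x \<in> S then 1 / (4 * \<epsilon>\<^sup>2) else 0) has_integral 2 * \<epsilon> * (1 / (4 * \<epsilon>\<^sup>2))) {0..1}"
        by (simp add: has_integral_restrict)
      moreover have "((\<lambda>x. M) has_integral M) {0..1::real}" using has_integral_const_real[of M 0 1] by simp
      ultimately show ?thesis by (intro has_integral_mult_right has_integral_diff)
    qed
    have "\<epsilon> / pi * (2 * \<epsilon> * (1 / (4 * \<epsilon>\<^sup>2)) - M) \<le> Re (winding_number P w1) - Re (winding_number P w2)"
    proof (rule has_integral_le[OF low int])
      fix x :: real assume x: "x \<in> {0..1}"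
      have "(if x \<in> S then 1 / (4 * \<epsilon>\<^sup>2) else 0) - M \<le> Re (y' x / q x)"
      proof (cases "\<bar>x - x0\<bar> \<le> \<delta>")
        case True
        have ge: "Re (y' x / q x) \<ge> 1 / (2 * ((x - x0)\<^sup>2 + \<epsilon>\<^sup>2))"
          unfolding q_def by (rule Re_quotient_near(2)[OF near'[OF True] near[OF True] \<epsilon>(1)])
        have "0 \<le> 1 / (2 * ((x - x0)\<^sup>2 + \<epsilon>\<^sup>2))" by simp
        moreover have "1 / (4 * \<epsilon>\<^sup>2) \<le> 1 / (2 * ((x - x0)\<^sup>2 + \<epsilon>\<^sup>2))" if "x \<in> S"
        proof (rule divide_left_mono)
          have "(x - x0)\<^sup>2 \<le> \<epsilon>\<^sup>2" using that by (intro power2_le_iff_abs_le[THEN iffD2]) (auto simp: S_def \<epsilon>(1) less_imp_le)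
          then show "2 * ((x - x0)\<^sup>2 + \<epsilon>\<^sup>2) \<le> 4 * \<epsilon>\<^sup>2" by simp
        qed (use \<epsilon>(1) in \<open>auto simp: add_nonneg_pos\<close>)
        ultimately have "(if x \<in> S then 1 / (4 * \<epsilon>\<^sup>2) else 0) \<le> 1 / (2 * ((x - x0)\<^sup>2 + \<epsilon>\<^sup>2))"
          by (simp only: split: if_split) blast
        then show ?thesis using ge \<open>M > 0\<close> by linarith
      next
        case False
        then have "x \<in> F" "x \<notin> S" using x \<epsilon>' by (auto simp: F_def S_def)
        have "norm (y' x / q x) \<le> M"
          unfolding norm_divide M_def using far[OF \<open>x \<in> F\<close>] B(2)[OF x] B(1) \<mu>(1) by (intro frac_le) auto
        then have "\<bar>Re (y' x / q x)\<bar> \<le> M" using abs_Re_le_cmod order_trans by blast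
        then show ?thesis using \<open>x \<notin> S\<close> by simp
      qed
      then show "\<epsilon> / pi * ((if x \<in> S then 1 / (4 * \<epsilon>\<^sup>2) else 0) - M) \<le> \<epsilon> / pi * Re (y' x / q x)"
        using \<epsilon>(1) by (intro mult_left_mono) auto
    qed
    moreover have "0 < \<epsilon> / pi * (2 * \<epsilon> * (1 / (4 * \<epsilon>\<^sup>2)) - M)"
      using \<epsilon>(1) \<epsilon>'(3) by (intro mult_pos_pos) (auto simp: power2_eq_square field_simps)
    ultimately show ?thesis using w unfolding w1_def w2_def by auto
  qed
  then show ?thesis
    using \<open>\<epsilon>0 > 0\<close> unfolding eventually_at_right_field by blast
qed

section \<open>Orientation at a bottleneck\<close>

text \<open>Off a simple closed curve the winding number has only two values, so a strict increase
  from right to left puts the larger on the left and the smaller on the right, at every point of the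
  curve. If the tangents at the ends of a normal chord agreed, the chord would start on one side of
  the curve and end on the opposite one. The winding number would then take both values along it,
  although it is constant there.\<close>

lemma closed_curve_tangents_not_parallel:
  fixes z z' :: "real \<Rightarrow> complex"
  assumes deriv: "\<And>t. (z has_vector_derivative z' t) (at t)" and cont: "continuous_on UNIV z'"
    and per: "\<And>t. z (t + L) = z t"
    and inj: "\<And>s h. 0 < h \<Longrightarrow> h < L \<Longrightarrow> z (s + h) \<noteq> z s"
    and h: "0 < h" "h < L" and nz: "z' s \<noteq> 0"
    and chord: "z (s + h) - z s = of_real c * (\<i> * z' s)" "open_segment (z s) (z (s + h)) \<inter> range z = {}"
  shows "z' (s + h) \<noteq> z' s"
proof
  assume par: "z' (s + h) = z' s"
  have L: "L > 0" using h by simp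
  define r where "r = s - (L - h) / 2"
  define P where "P x = z (r + L * x)" for x
  define P' where "P' x = of_real L * z' (r + L * x)" for x
  define xp where "xp = (s - r) / L"
  define xq where "xq = (s + h - r) / L"
  have xp: "0 < xp" "xp < 1" "r + L * xp = s" and xq: "0 < xq" "xq < 1" "r + L * xq = s + h"
    using L h by (simp_all add: xp_def xq_def r_def field_simps)
  have dP: "(P has_vector_derivative P' x) (at x)" for x
  proof -
    have "((\<lambda>x. r + L * x) has_vector_derivative L) (at x)"
      unfolding has_real_derivative_iff_has_vector_derivative[symmetric] by (auto intro!: derivative_eq_intros)
    from vector_diff_chain_at[OF this deriv] show ?thesis
      by (simp add: o_def P_def[abs_def] P'_def scaleR_conv_of_real)
  qed
  have contP': "continuous_on UNIV P'"
    unfolding P'_def by (intro continuous_intros continuous_on_compose2[OF cont]) auto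
  have path: "path P"
    unfolding path_def by (meson dP continuous_at_imp_continuous_on has_vector_derivative_continuous)
  have loop: "pathfinish P = pathstart P"
    using per[of r] by (simp add: pathfinish_def pathstart_def P_def)
  have P_eq: "x = y \<or> \<bar>x - y\<bar> = 1" if "x \<in> {0..1}" "y \<in> {0..1}" "P x = P y" for x y
  proof (rule ccontr)
    assume ne: "\<not> (x = y \<or> \<bar>x - y\<bar> = 1)"
    have *: False if "x < y" "y < x + 1" "P x = P y" for x y
    proof -
      have "0 < L * (y - x)" "L * (y - x) < L" using that L by auto
      from inj[OF this, of "r + L * x"] show False using that(3) by (simp add: P_def algebra_simps)
    qed
    show False
    proof (cases "x < y")
      case True
      then show False using *[of x y] that ne by auto
    next
      case False
      then show False using *[of y x] that ne by auto
    qed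
  qed
  have "loop_free P"
    unfolding loop_free_def
  proof (intro ballI impI)
    fix x y :: real assume xy: "x \<in> {0..1}" "y \<in> {0..1}" "P x = P y"
    from P_eq[OF this] xy show "x = y \<or> x = 0 \<and> y = 1 \<or> x = 1 \<and> y = 0"
      by (auto simp: abs_if split: if_splits)
  qed
  then have simple: "simple_path P" using path by (simp add: simple_path_def)
  \<comment> \<open>The Jordan curve theorem: 0 outside, and constantly 1 or constantly -1 inside.
    \<sigma> is the inside value, for either orientation.\<close>
  obtain \<sigma> where wn: "\<And>w. w \<notin> path_image P \<Longrightarrow> winding_number P w \<in> {0, \<sigma>}"
  proof -
    have out: "winding_number P w = 0" if "w \<in> outside (path_image P)" for w
      by (rule winding_number_zero_in_outside[OF path loop that])
    have "w \<in> inside (path_image P) \<or> w \<in> outside (path_image P)" if "w \<notin> path_image P" for w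
      using that inside_Un_outside[of "path_image P"] by blast
    then show ?thesis
      using simple_closed_path_winding_number_inside[OF simple] out that[of 1] that[of "- 1"] by (metis insertI1 insertI2)
  qed
  have range: "path_image P \<subseteq> range z" by (auto simp: path_image_def P_def)
  have P'p: "P' xp = of_real L * z' s" and P'q: "P' xq = of_real L * z' s"
    using xp xq par by (simp_all add: P'_def)
  have Pp: "P xp = z s" and Pq: "P xq = z (s + h)" using xp xq by (simp_all add: P_def)
  define N where "N = \<i> * (of_real L * z' s)"
  define W where "W w = Re (winding_number P w)" for w
  have inj_p: "x = xp" if "x \<in> {0..1}" "P x = P xp" for x using P_eq[OF that(1) _ that(2)] xp that(1) by auto
  have inj_q: "x = xq" if "x \<in> {0..1}" "P x = P xq" for x using P_eq[OF that(1) _ that(2)] xq that(1) by auto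
  have nzp: "P' xp \<noteq> 0" "P' xq \<noteq> 0" using L nz by (simp_all add: P'p P'q)
  have "c \<noteq> 0" using inj[OF h, of s] chord(1) by auto
  then have "\<forall>\<^sub>F \<epsilon> in at_right 0. \<epsilon> < \<bar>c\<bar> / L"
    using L by (intro order_tendstoD(2)[OF tendsto_ident_at]) auto
  moreover have "\<forall>\<^sub>F \<epsilon> in at_right 0. 0 < (\<epsilon>::real)" by (simp add: eventually_at_filter)
  moreover have "\<forall>\<^sub>F \<epsilon> in at_right 0. z s + of_real \<epsilon> * N \<notin> path_image P \<and> z s - of_real \<epsilon> * N \<notin> path_image P \<and>
      W (z s - of_real \<epsilon> * N) < W (z s + of_real \<epsilon> * N)"
    by (rule winding_number_jump[OF dP contP' xp(1,2) nzp(1), unfolded Pp P'p, folded N_def W_def])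
       (use inj_p Pp in auto)
  moreover have "\<forall>\<^sub>F \<epsilon> in at_right 0. z (s + h) + of_real \<epsilon> * N \<notin> path_image P \<and> z (s + h) - of_real \<epsilon> * N \<notin> path_image P \<and>
      W (z (s + h) - of_real \<epsilon> * N) < W (z (s + h) + of_real \<epsilon> * N)"
    by (rule winding_number_jump[OF dP contP' xq(1,2) nzp(2), unfolded Pq P'q, folded N_def W_def])
       (use inj_q Pq in auto)
  ultimately have "\<forall>\<^sub>F \<epsilon> in at_right 0. \<epsilon> < \<bar>c\<bar> / L \<and> 0 < \<epsilon> \<and>
      (z s + of_real \<epsilon> * N \<notin> path_image P \<and> z s - of_real \<epsilon> * N \<notin> path_image P \<and>
      W (z s - of_real \<epsilon> * N) < W (z s + of_real \<epsilon> * N)) \<and>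
      (z (s + h) + of_real \<epsilon> * N \<notin> path_image P \<and> z (s + h) - of_real \<epsilon> * N \<notin> path_image P \<and>
      W (z (s + h) - of_real \<epsilon> * N) < W (z (s + h) + of_real \<epsilon> * N))"
    by eventually_elim blast
  from eventually_happens'[OF trivial_limit_at_right_real this]
  obtain \<epsilon> where \<epsilon>: "0 < \<epsilon>" "\<epsilon> < \<bar>c\<bar> / L"
      "W (z s - of_real \<epsilon> * N) < W (z s + of_real \<epsilon> * N)" "W (z (s + h) - of_real \<epsilon> * N) < W (z (s + h) + of_real \<epsilon> * N)"
    and notin: "z s + of_real \<epsilon> * N \<notin> path_image P" "z s - of_real \<epsilon> * N \<notin> path_image P"
      "z (s + h) + of_real \<epsilon> * N \<notin> path_image P" "z (s + h) - of_real \<epsilon> * N \<notin> path_image P"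
    by blast
  have same: "W w1 = W w2" if "w1 \<in> open_segment (z s) (z (s + h))" "w2 \<in> open_segment (z s) (z (s + h))" for w1 w2
  proof -
    have "open_segment (z s) (z (s + h)) \<inter> path_image P = {}" using chord(2) range by blast
    from winding_number_eq[OF path loop that convex_connected[OF convex_open_segment] this]
    show ?thesis by (simp add: W_def)
  qed
  have seg: "z s + of_real (\<mu> * c) * (\<i> * z' s) \<in> open_segment (z s) (z (s + h))" if "0 < \<mu>" "\<mu> < 1" for \<mu>
  proof -
    have "z s + of_real (\<mu> * c) * (\<i> * z' s) = (1 - \<mu>) *\<^sub>R z s + \<mu> *\<^sub>R z (s + h)"
      using chord(1) by (simp add: algebra_simps scaleR_conv_of_real diff_eq_eq)
    then show ?thesis using that inj[OF h, of s] unfolding in_segment by metis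
  qed
  have zq: "z (s + h) = z s + of_real c * (\<i> * z' s)"
    using chord(1) by (metis add.commute diff_add_cancel)
  \<comment> \<open>The points displaced from the ends by \<epsilon> \<open>N\<close> into the chord
    have chord parameters \<mu> and 1 - \<mu>, because \<open>N\<close> is \<open>L\<close> times
    the normal and the chord is \<open>c\<close> times the normal. The bound \<epsilon> < |c| /
    \<open>L\<close> is what makes \<mu> < 1.\<close>
  define \<mu> where "\<mu> = \<epsilon> * L / \<bar>c\<bar>"
  have \<mu>: "0 < \<mu>" "\<mu> < 1" using \<epsilon>(1,2) L \<open>c \<noteq> 0\<close> by (auto simp: \<mu>_def field_simps)
  have W01: "W w \<in> {0, Re \<sigma>}" if "w \<notin> path_image P" for w
    using wn[OF that] by (auto simp: W_def)
  note W = W01[OF notin(1)] W01[OF notin(2)] W01[OF notin(3)] W01[OF notin(4)]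
  show False
  proof (cases "c > 0")
    case True
    have e1: "z s + of_real \<epsilon> * N = z s + of_real (\<mu> * c) * (\<i> * z' s)"
      using True by (simp add: N_def \<mu>_def)
    have e2: "z (s + h) - of_real \<epsilon> * N = z s + of_real ((1 - \<mu>) * c) * (\<i> * z' s)"
    proof -
      have "of_real \<epsilon> * N = of_real (\<mu> * c) * (\<i> * z' s)" using True by (simp add: N_def \<mu>_def)
      then show ?thesis unfolding zq by (simp add: left_diff_distrib)
    qed
    have "W (z s + of_real \<epsilon> * N) = W (z (s + h) - of_real \<epsilon> * N)"
      unfolding e1 e2 using \<mu> by (intro same seg) auto
    then show False using W \<epsilon>(3,4) by auto
  next
    case False
    with \<open>c \<noteq> 0\<close> have "c < 0" by simp
    have N: "of_real \<epsilon> * N = - (of_real (\<mu> * c) * (\<i> * z' s))"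
      using \<open>c < 0\<close> by (simp add: N_def \<mu>_def)
    have e1: "z s - of_real \<epsilon> * N = z s + of_real (\<mu> * c) * (\<i> * z' s)" by (simp add: N)
    have e2: "z (s + h) + of_real \<epsilon> * N = z s + of_real ((1 - \<mu>) * c) * (\<i> * z' s)"
      unfolding zq N by (simp add: left_diff_distrib)
    have "W (z s - of_real \<epsilon> * N) = W (z (s + h) + of_real \<epsilon> * N)"
      unfolding e1 e2 using \<mu> by (intro same seg) auto
    then show False using W \<epsilon>(3,4) by auto
  qed
qed

section \<open>Transfer to the complex plane, and uniqueness of nearest points\<close>

definition complex_of_vec :: "real^2 \<Rightarrow> complex" where
  "complex_of_vec v = Complex (v $ 1) (v $ 2)"

lemma bounded_linear_complex_of_vec: "bounded_linear complex_of_vec"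
proof (rule bounded_linear_intro[of _ 1])
  show "norm (complex_of_vec x) \<le> norm x * 1" for x
    by (simp add: complex_of_vec_def cmod_def norm_vec_def L2_set_def sum_2)
qed (simp_all add: complex_of_vec_def complex_eq_iff)

lemma complex_of_vec_eq_iff: "complex_of_vec v = complex_of_vec w \<longleftrightarrow> v = w"
  by (simp add: complex_of_vec_def vec_eq_iff forall_2)

context minimal_curve
begin

text \<open>In the plane two unit vectors orthogonal to the same nonzero chord are equal or
  opposite; the winding number excludes equality.\<close>

lemma bottleneck_antiparallel:
  assumes h: "0 < h" "h < L" and orth: "(g (s + h) - g s) \<bullet> g' s = 0" "(g (s + h) - g s) \<bullet> g' (s + h) = 0"
    and seg: "open_segment (g s) (g (s + h)) \<inter> range g = {}"
  shows "g' (s + h) = - g' s"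
proof -
  define w where "w = g (s + h) - g s"
  define v where "v = g' s"
  define u where "u = g' (s + h)"
  have "w \<noteq> 0" using g_offset_neq[OF h] by (simp add: w_def)
  have v: "(v $ 1)\<^sup>2 + (v $ 2)\<^sup>2 = 1" and u: "(u $ 1)\<^sup>2 + (u $ 2)\<^sup>2 = 1"
    using unit[of s] unit[of "s + h"] unfolding v_def u_def norm_eq_1 inner_2 by (simp_all add: power2_eq_square)
  have wv: "w $ 1 * v $ 1 + w $ 2 * v $ 2 = 0" and wu: "w $ 1 * u $ 1 + w $ 2 * u $ 2 = 0"
    using orth by (simp_all add: w_def v_def u_def inner_2)
  \<comment> \<open>\<open>w\<close> is \<open>c\<close> times \<open>v\<close> turned by a right
    angle, i.e. c (i v) in complex notation, the form of the chord in the winding number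
    argument.\<close>
  define c where "c = det2 v w"
  have w: "w $ 1 = - c * v $ 2" "w $ 2 = c * v $ 1"
    unfolding c_def det2_def using v wv by algebra+
  have "c \<noteq> 0" using w \<open>w \<noteq> 0\<close> by (auto simp: vec_eq_iff forall_2)
  have cross: "v $ 1 * u $ 2 = v $ 2 * u $ 1"
    using wu w \<open>c \<noteq> 0\<close> by (simp add: algebra_simps)
  define k where "k = v $ 1 * u $ 1 + v $ 2 * u $ 2"
  have uk: "u $ 1 = k * v $ 1" "u $ 2 = k * v $ 2"
    unfolding k_def using v cross by algebra+
  have "k\<^sup>2 = 1" using u v unfolding uk by algebra
  then consider "u = v" | "u = - v"
    using uk by (auto simp: power2_eq_1_iff vec_eq_iff forall_2)
  then show ?thesis
  proof cases
    case 1
    let ?z = "\<lambda>t. complex_of_vec (g t)" and ?z' = "\<lambda>t. complex_of_vec (g' t)"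
    interpret bl: bounded_linear complex_of_vec by (rule bounded_linear_complex_of_vec)
    have "?z' (s + h) \<noteq> ?z' s"
    proof (rule closed_curve_tangents_not_parallel[of ?z ?z' L h s c])
      show "(?z has_vector_derivative ?z' t) (at t)" for t
        by (rule bl.has_vector_derivative[OF deriv])
      show "continuous_on UNIV ?z'" by (rule bl.continuous_on[OF cont])
      show "?z (t + L) = ?z t" for t by (simp add: periodic)
      show "?z (t + k) \<noteq> ?z t" if "0 < k" "k < L" for t k
        using g_offset_neq[OF that] by (simp add: complex_of_vec_eq_iff)
      show "?z' s \<noteq> 0" using unit[of s] complex_of_vec_eq_iff[of "g' s" 0] by (auto simp: bl.zero)
      have "?z (s + h) - ?z s = complex_of_vec w" by (simp add: w_def bl.diff)
      then show "?z (s + h) - ?z s = of_real c * (\<i> * ?z' s)"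
        using w by (simp add: complex_of_vec_def complex_eq_iff v_def)
      have "open_segment (?z s) (?z (s + h)) \<subseteq> complex_of_vec ` open_segment (g s) (g (s + h))"
      proof
        fix y assume "y \<in> open_segment (?z s) (?z (s + h))"
        then obtain \<mu> where "0 < \<mu>" "\<mu> < 1" "y = (1 - \<mu>) *\<^sub>R ?z s + \<mu> *\<^sub>R ?z (s + h)"
          by (auto simp: in_segment)
        then show "y \<in> complex_of_vec ` open_segment (g s) (g (s + h))"
          using g_offset_neq[OF h, of s]
          by (intro image_eqI[of _ _ "(1 - \<mu>) *\<^sub>R g s + \<mu> *\<^sub>R g (s + h)"]) (auto simp: bl.add bl.scaleR in_segment)
      qed
      then show "open_segment (?z s) (?z (s + h)) \<inter> range ?z = {}"
        using seg by (fastforce simp: complex_of_vec_eq_iff)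
    qed (use h in auto)
    then show ?thesis using 1 by (simp add: u_def v_def)
  qed (simp add: u_def v_def)
qed

lemma unique_nearest_point:
  assumes "infdist x (range g) < 0.225 / lam"
  shows "\<exists>!p. p \<in> range g \<and> dist x p = infdist x (range g)"
proof -
  define d where "d = infdist x (range g)"
  have range: "range g = g ` {0..L}"
  proof -
    have "g u \<in> g ` {0..L}" for u
      using obtain_offset[of u 0] by (metis add_0 atLeastAtMost_iff imageI less_imp_le)
    then show ?thesis by auto
  qed
  have "closed (range g)"
    unfolding range by (intro compact_imp_closed compact_continuous_image cont_g compact_Icc)
  then obtain p where p: "p \<in> range g" "infdist x (range g) = dist x p"
    using infdist_attains_inf[of "range g" x] by auto
  moreover have "p = q" if "p \<in> range g" "q \<in> range g" "dist x p = d" "dist x q = d" for p q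
  proof (rule ccontr)
    assume "p \<noteq> q"
    from that obtain s u where s: "p = g s" "q = g u" by auto
    obtain h where h: "0 \<le> h" "h < L" "g u = g (s + h)" using obtain_offset[of u s] by blast
    have "h \<noteq> 0" using h \<open>p \<noteq> q\<close> s by auto
    have near: "d \<le> norm (x - g t)" for t
      unfolding d_def using infdist_le[of "g t" "range g" x] by (simp add: dist_norm)
    have ps: "norm (x - g s) = d" "norm (x - g (s + h)) = d" using that s h by (auto simp: dist_norm)
    have wrap: "g (s + h + (L - h)) = g s" using periodic[of s] by (simp add: algebra_simps)
    have dlam: "d * lam < 0.225" using assms lam by (simp add: d_def field_simps)
    have h1: "1 / lam < h" using nearest_points_far[OF near ps _ _ h(2)] h \<open>h \<noteq> 0\<close> dlam by simp
    \<comment> \<open>The same estimate for the complementary arc, from \<open>g (s + h)\<close>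
      onwards to \<open>g s\<close>.\<close>
    have h2: "1 / lam < L - h"
      using nearest_points_far[OF near ps(2), of "L - h"] ps(1) wrap h \<open>h \<noteq> 0\<close> dlam by simp
    have "norm (g (s + h) - g s) \<le> norm (x - g s) + norm (x - g (s + h))"
      using norm_triangle_ineq4[of "x - g s" "x - g (s + h)"] by simp
    then have "norm (g (s + h) - g s) \<le> 2 * d" using ps by simp
    also have "\<dots> < 0.45 / lam" using assms by (simp add: d_def)
    finally have lt: "norm (g (s + h) - g s) < 0.45 / lam" .
    also have "\<dots> < 1 / (2 * lam)" using lam by (simp add: field_simps)
    finally have lt': "norm (g (s + h) - g s) < 1 / (2 * lam)" .
    have "1 / lam \<le> h" "h \<le> L - 1 / lam" using h1 h2 by auto
    obtain s' h' where b: "1 / lam < h'" "h' < L - 1 / lam"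
      "norm (g (s' + h') - g s') \<le> norm (g (s + h) - g s)"
      "(g (s' + h') - g s') \<bullet> g' s' = 0" "(g (s' + h') - g s') \<bullet> g' (s' + h') = 0"
      "open_segment (g s') (g (s' + h')) \<inter> range g = {}"
      by (rule bottleneck[OF \<open>1 / lam \<le> h\<close> \<open>h \<le> L - 1 / lam\<close> lt'])
    have "0 < 1 / lam" using lam by simp
    then have "0 < h'" "h' < L" using b(1,2) by linarith+
    from bottleneck_antiparallel[OF this b(4-6)] have "g' (s' + h') = - g' s'" .
    from antiparallel_bottleneck_wide[OF _ _ this] b lt show False by simp
  qed
  ultimately show ?thesis unfolding d_def by metis
qed

lemma reach_ge: "reach (range g) \<ge> ereal (0.225 / lam)"
  unfolding reach_def
  by (intro Sup_upper CollectI exI[of _ "0.225 / lam"] conjI refl allI impI unique_nearest_point) (use lam in simp)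

end

section \<open>The constant and the theorem\<close>

text \<open>Stereographic projection of the unit circle from (0, 1), with u = c / (1 - s), makes the
  expression rational in u. The bound then becomes a quartic inequality for u > 0. The value 0.2249
  lies just below 0.225, which leaves a strict inequality for the supremum.\<close>

lemma reach_const_term_le:
  fixes c s :: real
  assumes "c > 0" "s < 1" and cs: "c\<^sup>2 + s\<^sup>2 = 1"
  shows "(2 * c - (1 + s) * (c + 2)) / (2 * (c + 1)) \<le> (2249 / 10000)"
proof -
  define u where "u = c / (1 - s)"
  have u: "u > 0" using assms by (simp add: u_def)
  define D where "D = 1 + u\<^sup>2"
  have D: "D > 0" unfolding D_def by (simp add: add_pos_nonneg)
  have c: "c = u * (1 - s)" using assms by (simp add: u_def)
  have "(1 - s) * (1 + s) = c * c" using cs by (simp add: power2_eq_square algebra_simps)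
  also have "\<dots> = (1 - s) * (u\<^sup>2 * (1 - s))" unfolding c by (simp add: power2_eq_square)
  finally have s: "1 + s = u\<^sup>2 * (1 - s)" using assms(2) by simp
  then have "(1 - s) * D = 2" by (simp add: D_def algebra_simps)
  then have k: "1 - s = 2 / D" using D by (simp add: field_simps)
  have c': "c * D = 2 * u" and s': "(1 + s) * D = 2 * u\<^sup>2"
    unfolding s unfolding c k using D by simp_all
  have "(2 * c - (1 + s) * (c + 2)) * D\<^sup>2 = 2 * (c * D) * D - ((1 + s) * D) * (c * D + 2 * D)"
    by (simp add: power2_eq_square algebra_simps)
  also have "\<dots> = 4 * u * D - 2 * u\<^sup>2 * (2 * u + 2 * D)" unfolding c' s' by simp
  also have "\<dots> = 4 * u - 4 * u\<^sup>2 - 4 * u ^ 4"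
    by (simp add: D_def power2_eq_square power3_eq_cube power4_eq_xxxx algebra_simps)
  also have "\<dots> \<le> 4498 / 10000 + 8996 / 10000 * u + 8996 / 10000 * u\<^sup>2 + 8996 / 10000 * u ^ 3 + 4498 / 10000 * u ^ 4"
  proof -
    \<comment> \<open>The squares are centred close to the maximiser, which is about u = 0.265: 0.27
      and its square 0.0729 bound u^3 and u^4 below by lower powers, and 0.2645 handles the
      remaining quadratic.\<close>
    have "0 \<le> (u\<^sup>2 - 729 / 10000)\<^sup>2" "0 \<le> u * (u - 27 / 100)\<^sup>2" "0 \<le> (u - 2645 / 10000)\<^sup>2"
      using u by simp_all
    then have "1458 / 10000 * u\<^sup>2 - 531441 / 100000000 \<le> u ^ 4" "54 / 100 * u\<^sup>2 - 729 / 10000 * u \<le> u ^ 3"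
      "529 / 1000 * u - 6996025 / 100000000 \<le> u\<^sup>2"
      by (simp_all add: power2_eq_square power3_eq_cube power4_eq_xxxx algebra_simps)
    with zero_le_power2[of u] show ?thesis by linarith
  qed
  also have "\<dots> = 2 * (2249 / 10000) * (2 * u + D) * D"
    by (simp add: D_def power2_eq_square power3_eq_cube power4_eq_xxxx algebra_simps)
  also have "\<dots> = (2249 / 10000) * (2 * (c + 1)) * D\<^sup>2"
    unfolding c'[symmetric] by (simp add: power2_eq_square algebra_simps)
  finally have "2 * c - (1 + s) * (c + 2) \<le> (2249 / 10000) * (2 * (c + 1))"
    using D by (simp only: mult_le_cancel_right) auto
  then show ?thesis using assms(1) by (simp add: pos_divide_le_eq)
qed

lemma reach_const_bounds: "43 / 200 < reach_const" "reach_const < 9 / 40"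
proof -
  let ?f = "\<lambda>\<theta>. (2 * cos \<theta> - (1 + sin \<theta>) * (cos \<theta> + 2)) / (2 * (cos \<theta> + 1))"
  let ?I = "{3 * pi / 2<..<2 * pi}"
  have le: "?f \<theta> \<le> (2249 / 10000)" if "\<theta> \<in> ?I" for \<theta>
  proof (rule reach_const_term_le)
    have "cos (2 * pi - \<theta>) > 0" using that by (intro cos_gt_zero_pi) auto
    then show "0 < cos \<theta>" by (simp add: cos_diff)
    moreover have "(cos \<theta>)\<^sup>2 + (sin \<theta>)\<^sup>2 = 1" by simp
    ultimately have "(sin \<theta>)\<^sup>2 < 1\<^sup>2" by (smt (verit) one_power2 zero_less_power)
    then show "sin \<theta> < 1" by (rule power2_less_imp_less) simp
  qed simp
  \<comment> \<open>The Pythagorean triple 8, 15, 17, corresponding to u = 1 / 4 in the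
    stereographic parameter, gives a rational value near the supremum.\<close>
  define \<theta>0 where "\<theta>0 = 2 * pi - arccos (8 / 17)"
  have "0 < arccos (8 / 17)" using arccos_lt_bounded[of "8 / 17"] by simp
  moreover have "arccos (8 / 17) < pi / 2" using arccos_less_arccos[of 0 "8 / 17"] by simp
  ultimately have \<theta>0: "\<theta>0 \<in> ?I" by (simp add: \<theta>0_def)
  have "sqrt (1 - (8 / 17)\<^sup>2) = 15 / (17::real)"
    by (rule real_sqrt_unique) (simp_all add: power_divide)
  then have "cos \<theta>0 = 8 / 17" "sin \<theta>0 = - 15 / 17"
    by (simp_all add: \<theta>0_def cos_diff sin_diff sin_arccos)
  then have "?f \<theta>0 = 188 / 850" by (simp only:) simp
  moreover have "bdd_above (?f ` ?I)" using le by (intro bdd_aboveI2)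
  then have "?f \<theta>0 \<le> reach_const" unfolding reach_const_def using \<theta>0 by (rule cSUP_upper[rotated])
  ultimately show "43 / 200 < reach_const" by linarith
  have "reach_const \<le> (2249 / 10000)" unfolding reach_const_def using \<theta>0 le by (intro cSUP_least) auto
  then show "reach_const < 9 / 40" by simp
qed

section \<open>The circle in arc-length parametrization\<close>

lemma circle_param_range:
  assumes "\<rho> > 0"
  shows "range (circle_param \<rho>) = sphere 0 \<rho>"
proof
  show "range (circle_param \<rho>) \<subseteq> sphere 0 \<rho>"
  proof
    fix x assume "x \<in> range (circle_param \<rho>)"
    then obtain t where "x = circle_param \<rho> t" by auto
    then have "(norm x)\<^sup>2 = (\<rho> * cos (t / \<rho>))\<^sup>2 + (\<rho> * sin (t / \<rho>))\<^sup>2"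
      unfolding power2_norm_eq_inner inner_2 by (simp add: circle_param_def power2_eq_square)
    also have "\<dots> = \<rho>\<^sup>2 * ((cos (t / \<rho>))\<^sup>2 + (sin (t / \<rho>))\<^sup>2)"
      by (simp only: power_mult_distrib distrib_left)
    finally have "(norm x)\<^sup>2 = \<rho>\<^sup>2" by simp
    then show "x \<in> sphere 0 \<rho>" using assms by (simp add: power2_eq_iff_nonneg)
  qed
  show "sphere 0 \<rho> \<subseteq> range (circle_param \<rho>)"
  proof
    fix x :: "real^2" assume "x \<in> sphere 0 \<rho>"
    then have "(norm x)\<^sup>2 = \<rho>\<^sup>2" by simp
    then have "(x $ 1)\<^sup>2 + (x $ 2)\<^sup>2 = \<rho>\<^sup>2"
      unfolding power2_norm_eq_inner inner_2 by (simp add: power2_eq_square)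
    then have "(x $ 1 / \<rho>)\<^sup>2 + (x $ 2 / \<rho>)\<^sup>2 = 1" using assms by (simp add: power_divide field_simps)
    then obtain t where "x $ 1 / \<rho> = cos t" "x $ 2 / \<rho> = sin t" using sincos_total_2pi by metis
    then have "x = circle_param \<rho> (\<rho> * t)"
      using assms by (simp add: circle_param_def vec_eq_iff forall_2 field_simps)
    then show "x \<in> range (circle_param \<rho>)" by blast
  qed
qed

lemma circle_param_periodic:
  assumes "\<rho> > 0"
  shows "circle_param \<rho> (t + 2 * pi * \<rho>) = circle_param \<rho> t"
proof -
  have "(t + 2 * pi * \<rho>) / \<rho> = t / \<rho> + 2 * pi" using assms by (simp add: field_simps)
  then show ?thesis by (simp add: circle_param_def)
qed

lemma inj_on_circle_param:
  assumes "\<rho> > 0"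
  shows "inj_on (circle_param \<rho>) {0..<2 * pi * \<rho>}"
proof (rule inj_onI)
  fix s t assume st: "s \<in> {0..<2 * pi * \<rho>}" "t \<in> {0..<2 * pi * \<rho>}" and "circle_param \<rho> s = circle_param \<rho> t"
  then have "cos (s / \<rho>) = cos (t / \<rho>)" "sin (s / \<rho>) = sin (t / \<rho>)"
    using assms by (auto simp: circle_param_def vec_eq_iff forall_2)
  then obtain n :: int where n: "s / \<rho> = t / \<rho> + 2 * pi * n"
    using sin_cos_eq_iff by metis
  then have "s - t = (2 * pi * \<rho>) * of_int n" using assms by (simp add: field_simps)
  moreover have "\<bar>s - t\<bar> < 2 * pi * \<rho>" using st by auto
  ultimately have "(2 * pi * \<rho>) * \<bar>of_int n\<bar> < (2 * pi * \<rho>) * 1" using assms by (simp add: abs_mult)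
  then have "\<bar>real_of_int n\<bar> < 1" using assms by simp
  then have "n = 0" by linarith
  then show "s = t" using n assms by simp
qed

theorem theorem1:
  fixes lam \<rho> :: real
    and \<Omega> :: "(real^2) set"
    and T \<Gamma> :: "form1 \<Rightarrow> real"
    and \<gamma> :: "real^2 \<Rightarrow> real^2"
  assumes "lam > 0"
    and "\<Omega> \<in> sets lebesgue"
    and "is_region_boundary T \<Omega>"
    and "flat_norm_minimizer lam T \<Gamma>"
    and "C11_isometric_embedding \<rho> \<gamma>"
    and "\<forall>\<omega>\<in>forms1. \<Gamma> \<omega> = curve_current \<rho> \<gamma> \<omega>"
  shows "reach (\<gamma> ` sphere 0 \<rho>) \<ge> ereal (reach_const / lam) \<and> \<bar>reach_const - 0.22\<bar> < 0.005"
proof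
  define g where "g = \<gamma> \<circ> circle_param \<rho>"
  define L where "L = 2 * pi * \<rho>"
  obtain g' k where \<rho>: "\<rho> > 0" and inj: "inj_on \<gamma> (sphere 0 \<rho>)"
    and g': "\<And>t. (g has_vector_derivative g' t) (at t)" "\<And>t. norm (g' t) = 1" "k-lipschitz_on UNIV g'"
    using assms(5) unfolding C11_isometric_embedding_def g_def by blast
  have L: "L > 0" using \<rho> by (simp add: L_def)
  have cont: "continuous_on UNIV g'" using g'(3) by (rule lipschitz_on_continuous_on)
  have range: "range g = \<gamma> ` sphere 0 \<rho>"
    unfolding g_def circle_param_range[OF \<rho>, symmetric] by (rule image_comp[symmetric])
  have per: "g (t + L) = g t" for t by (simp add: g_def L_def circle_param_periodic[OF \<rho>])
  have inj_g: "inj_on g {0..<L}"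
    unfolding g_def L_def using circle_param_range[OF \<rho>] inj
    by (intro comp_inj_on inj_on_circle_param \<rho>) (auto intro: inj_on_subset)
  have cont_g: "continuous_on S g" for S
    by (meson g'(1) continuous_at_imp_continuous_on has_vector_derivative_continuous)
  have cont_g': "continuous_on S g'" for S using cont continuous_on_subset by blast
  have "vector_derivative g (at t) = g' t" for t by (rule vector_derivative_at[OF g'(1)])
  then have \<Gamma>: "\<Gamma> \<omega> = path_current 0 L g g' \<omega>" if "\<omega> \<in> forms1" for \<omega>
    using assms(6) that by (simp add: curve_current_def path_current_def g_def[symmetric] L_def)
      (simp add: g_def)
  have bdd: "bounded (g ` {0..L})"
    by (intro compact_imp_bounded compact_continuous_image cont_g compact_Icc)
  \<comment> \<open>Integration over the curve is controlled by the form on the image alone, without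
    derivatives; this is what the finiteness of the filling's mass asks of \<Gamma>.\<close>
  have bound: "\<bar>\<Gamma> \<omega>\<bar> \<le> L * B" if \<omega>: "\<omega> \<in> forms1" and B: "\<And>x v. x \<in> g ` {0..L} \<Longrightarrow> \<bar>\<omega> x v\<bar> \<le> B * norm v" for \<omega> B
  proof -
    have "norm (integral {0..L} (\<lambda>t. \<omega> (g t) (g' t))) \<le> integral {0..L} (\<lambda>t. B)"
      using B g'(2) by (intro integral_norm_bound_integral integrable_continuous_interval
          continuous_on_form1[OF \<omega> cont_g cont_g'] continuous_on_const) (metis image_eqI mult.right_neutral real_norm_def)
    then show ?thesis using L by (simp add: \<Gamma>[OF \<omega>] path_current_def)
  qed
  interpret minimal_curve lam L g g'
  proof
    fix R assume "R \<in> currents2"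
    from flat_norm_minimizer_competitor[OF assms(1,3,4) bdd bound this]
    have "mass1 \<Gamma> \<le> mass1 (\<lambda>\<omega>. \<Gamma> \<omega> - boundary R \<omega>) + ereal lam * mass2 R" .
    moreover have "mass1 \<Gamma> = mass1 (path_current 0 L g g')"
      "mass1 (\<lambda>\<omega>. \<Gamma> \<omega> - boundary R \<omega>) = mass1 (\<lambda>\<omega>. path_current 0 L g g' \<omega> - boundary R \<omega>)"
      unfolding mass1_def using \<Gamma> by (auto intro!: SUP_cong)
    ultimately show "mass1 (path_current 0 L g g')
      \<le> mass1 (\<lambda>\<omega>. path_current 0 L g g' \<omega> - boundary R \<omega>) + ereal lam * mass2 R" by simp
  qed (use assms(1) L g' cont per inj_g in auto)
  \<comment> \<open>The geometric argument reaches 0.225 / \<open>lam\<close>, so an upper bound for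
    the supremum finishes; its lower bound is for the numerical claim.\<close>
  have "ereal (reach_const / lam) \<le> ereal (0.225 / lam)"
    unfolding ereal_less_eq by (rule divide_right_mono) (use reach_const_bounds(2) assms(1) in auto)
  also note reach_ge
  finally show "reach (\<gamma> ` sphere 0 \<rho>) \<ge> ereal (reach_const / lam)" by (simp add: range)
  have "\<bar>reach_const - 11 / 50\<bar> < 1 / 200" unfolding abs_less_iff using reach_const_bounds by (intro conjI; linarith)
  then show "\<bar>reach_const - 0.22\<bar> < 0.005" by simp
qed

end
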